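(* Let $\chi\colon L\to M$ be a morphism of differential graded Lie algebras over $\mathbb{C}$, with suspended mapping cone $(C_\chi,\delta)$ and associated functor of Artin rings $\mathrm{Def}_\chi$. Then: (i) the tangent space $\mathrm{Def}_\chi(\mathbb{C}[\epsilon])$, $\epsilon^2=0$, is isomorphic to $H^1(C_\chi)$; (ii) the obstruction space of $\mathrm{Def}_\chi$ is naturally contained in $H^2(C_\chi)$. More precisely, let $0\to\mathbb{C}\to A\xrightarrow{\alpha}B\to0$ be a small extension in $\mathbf{Art}$ and $(x,e^q)\in\mathrm{MC}_\chi(B)$. Choose $(y,e^p)\in (L^1\otimes\mathfrak{m}_A)\times\exp(M^0\otimes\mathfrak{m}_A)$ with $\alpha(y)=x$, $\alpha(p)=q$, and set \[ h=dy+\tfrac12[y,y]\in L^2\otimes\mathbb{C},\qquad r=e^p\ast\chi(y)\in M^1\otimes\mathbb{C}.\] Then $\delta(h,r)=0$, the cohomology class of $(h,r)$ in $H^2(C_\chi)$ does not depend on the choice of $(y,e^p)$, and it vanishes if and only if $(x,e^q)$ lifts to an element of $\mathrm{MC}_\chi(A)$.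
   Context: DGLA means differential $\mathbb{Z}$-graded Lie algebra over $\mathbb{C}$. $\mathbf{Art}$ is the category of local Artinian $\mathbb{C}$-algebras $(A,\mathfrak{m}_A)$ with residue field $\mathbb{C}$. A small extension $0\to\mathbb{C}\to A\to B\to0$ in $\mathbf{Art}$ is a surjection $A\to B$ in $\mathbf{Art}$ whose kernel is one-dimensional and annihilated by $\mathfrak{m}_A$. For a DGLA $K$, $K\otimes\mathfrak{m}_A$ has $d(v\otimes a)=d(v)\otimes a$, $[v\otimes a,w\otimes b]=[v,w]\otimes ab$; $\exp(K^0\otimes\mathfrak{m}_A)=\{e^a\}$ is the exponential group of the nilpotent Lie algebra $K^0\otimes\mathfrak{m}_A$ (product given by Baker–Campbell–Hausdorff), and for $a\in K^0\otimes\mathfrak{m}_A$, $w\in K^1\otimes\mathfrak{m}_A$, \[ e^a\ast w=w+\sum_{n\ge0}\frac{[a,-]^n}{(n+1)!}([a,w]-da).\] The suspended mapping cone of $\chi$ is $C_\chi^i=L^i\oplus M^{i-1}$ with $\delta(l,m)=(dl,\chi(l)-dm)$. The functor $\mathrm{Def}_\chi$ is defined by \[\mathrm{MC}_\chi(A)=\{(x,e^a)\in(L^1\otimes\mathfrak{m}_A)\times\exp(M^0\otimes\mathfrak{m}_A)\mid dx+\tfrac12[x,x]=0,\ e^a\ast\chi(x)=0\},\] \[\mathrm{Def}_\chi(A)=\mathrm{MC}_\chi(A)/\big(\exp(L^0\otimes\mathfrak{m}_A)\times\exp(dM^{-1}\otimes\mathfrak{m}_A)\big),\] the action being $(e^l,e^{dm})\ast(x,e^a)=(e^l\ast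 x,e^{dm}e^ae^{-\chi(l)})$. *)

theory Defs
  imports Complex_Main "HOL-Library.Poly_Mapping" "HOL-Library.Product_Plus"
begin

section \<open>Complex vector spaces and algebras\<close>

class cvector = ab_group_add +
  fixes cscale :: "complex \<Rightarrow> 'a \<Rightarrow> 'a"  (infixr \<open>*\<^sub>C\<close> 75)
  assumes cscale_add_right: "c *\<^sub>C (x + y) = c *\<^sub>C x + c *\<^sub>C y"
    and cscale_add_left: "(c + d) *\<^sub>C x = c *\<^sub>C x + d *\<^sub>C x"
    and cscale_cscale: "c *\<^sub>C d *\<^sub>C x = (c * d) *\<^sub>C x"
    and cscale_one: "1 *\<^sub>C x = x"

global_interpretation cvec: vector_space "cscale :: complex \<Rightarrow> 'a \<Rightarrow> 'a::cvector"
  by unfold_locales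
    (simp_all add: cscale_add_right cscale_add_left cscale_cscale cscale_one)

abbreviation clinear :: "('a::cvector \<Rightarrow> 'b::cvector) \<Rightarrow> bool"
  where "clinear \<equiv> Vector_Spaces.linear cscale cscale"

lemma clinear_iff:
  "clinear f \<longleftrightarrow> (\<forall>x y. f (x + y) = f x + f y) \<and> (\<forall>c x. f (c *\<^sub>C x) = c *\<^sub>C f x)"
  by (simp add: Vector_Spaces.linear_iff cvec.vector_space_axioms)

definition cbilinear :: "('a::cvector \<Rightarrow> 'b::cvector \<Rightarrow> 'c::cvector) \<Rightarrow> bool"
  where "cbilinear \<beta> \<longleftrightarrow> (\<forall>y. clinear (\<lambda>x. \<beta> x y)) \<and> (\<forall>x. clinear (\<beta> x))"

class calgebra = cvector + comm_ring_1 +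
  assumes cscale_mult_left: "(c *\<^sub>C x) * y = c *\<^sub>C (x * y)"

instantiation complex :: calgebra
begin
definition "c *\<^sub>C (x::complex) = c * x"
instance by standard (simp_all add: cscale_complex_def algebra_simps)
end

instantiation prod :: (cvector, cvector) cvector
begin
definition "c *\<^sub>C p = (c *\<^sub>C fst p, c *\<^sub>C snd p)"
instance
  by standard
    (simp_all add: cscale_prod_def cscale_add_right cscale_add_left cscale_cscale cscale_one)
end

instantiation poly_mapping :: (type, cvector) cvector
begin
lift_definition cscale_poly_mapping :: "complex \<Rightarrow> ('a \<Rightarrow>\<^sub>0 'b) \<Rightarrow> 'a \<Rightarrow>\<^sub>0 'b"
  is "\<lambda>c f k. c *\<^sub>C f k"
proof -
  fix c :: complex and f :: "'a \<Rightarrow> 'b"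
  assume "finite {k. f k \<noteq> 0}"
  then show "finite {k. c *\<^sub>C f k \<noteq> 0}"
    by (rule rev_finite_subset) auto
qed
instance
  by standard
    (transfer, simp add: cscale_add_right cscale_add_left cscale_cscale cscale_one fun_eq_iff)+
end

definition calg_hom :: "('a::calgebra \<Rightarrow> 'b::calgebra) \<Rightarrow> bool"
  where "calg_hom f \<longleftrightarrow> clinear f \<and> f 1 = 1 \<and> (\<forall>x y. f (x * y) = f x * f y)"


section \<open>Tensor products of complex vector spaces\<close>

text \<open>The free vector space on \<open>V \<times> W\<close> modulo the span of the bilinearity relations.\<close>

definition tensor_relators :: "(('v::cvector \<times> 'w::cvector) \<Rightarrow>\<^sub>0 complex) set" where
  "tensor_relators =
     {Poly_Mapping.single (v + v', w) 1 - Poly_Mapping.single (v, w) 1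
        - Poly_Mapping.single (v', w) 1 | v v' w. True} \<union>
     {Poly_Mapping.single (v, w + w') 1 - Poly_Mapping.single (v, w) 1
        - Poly_Mapping.single (v, w') 1 | v w w'. True} \<union>
     {Poly_Mapping.single (c *\<^sub>C v, w) 1 - c *\<^sub>C Poly_Mapping.single (v, w) 1 | c v w. True} \<union>
     {Poly_Mapping.single (v, c *\<^sub>C w) 1 - c *\<^sub>C Poly_Mapping.single (v, w) 1 | c v w. True}"

definition tensor_rel ::
    "(('v::cvector \<times> 'w::cvector) \<Rightarrow>\<^sub>0 complex) \<Rightarrow> (('v \<times> 'w) \<Rightarrow>\<^sub>0 complex) \<Rightarrow> bool"
  where "tensor_rel f g \<longleftrightarrow> f - g \<in> cvec.span tensor_relators"

lemma tensor_relI: "f - g \<in> tensor_relators \<Longrightarrow> tensor_rel f g"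
  unfolding tensor_rel_def by (rule cvec.span_base)

quotient_type (overloaded) ('v, 'w) tensor =
    "('v::cvector \<times> 'w::cvector) \<Rightarrow>\<^sub>0 complex" / tensor_rel
  morphisms rep_tensor abs_tensor
proof (rule equivpI)
  show "reflp tensor_rel"
    by (simp add: reflp_def tensor_rel_def cvec.span_zero)
  show "symp tensor_rel"
    by (rule sympI) (use cvec.span_neg in \<open>fastforce simp: tensor_rel_def\<close>)
  show "transp tensor_rel"
    by (rule transpI) (use cvec.span_add in \<open>fastforce simp: tensor_rel_def\<close>)
qed

instantiation tensor :: (cvector, cvector) cvector
begin
lift_definition zero_tensor :: "('a, 'b) tensor" is 0 .
lift_definition plus_tensor :: "('a, 'b) tensor \<Rightarrow> ('a, 'b) tensor \<Rightarrow> ('a, 'b) tensor" is plus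
  unfolding tensor_rel_def by (simp only: add_diff_add cvec.span_add)
lift_definition uminus_tensor :: "('a, 'b) tensor \<Rightarrow> ('a, 'b) tensor" is uminus
  unfolding tensor_rel_def minus_diff_minus by (rule cvec.span_neg)
lift_definition minus_tensor :: "('a, 'b) tensor \<Rightarrow> ('a, 'b) tensor \<Rightarrow> ('a, 'b) tensor" is minus
proof -
  fix f f' g g' :: "('a \<times> 'b) \<Rightarrow>\<^sub>0 complex"
  assume "tensor_rel f f'" "tensor_rel g g'"
  then have "(f - f') - (g - g') \<in> cvec.span tensor_relators"
    unfolding tensor_rel_def by (rule cvec.span_diff)
  moreover have "f - g - (f' - g') = (f - f') - (g - g')" by simp
  ultimately show "tensor_rel (f - g) (f' - g')"
    by (simp only: tensor_rel_def)
qed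
lift_definition cscale_tensor :: "complex \<Rightarrow> ('a, 'b) tensor \<Rightarrow> ('a, 'b) tensor" is cscale
  unfolding tensor_rel_def cvec.scale_right_diff_distrib[symmetric] by (rule cvec.span_scale)
instance
  by standard
    (transfer,
     simp add: tensor_rel_def cvec.span_zero cscale_add_right cscale_add_left cscale_cscale
       cscale_one add_ac)+
end

lift_definition ptensor :: "'v::cvector \<Rightarrow> 'w::cvector \<Rightarrow> ('v, 'w) tensor"  (infixr \<open>\<otimes>\<close> 76)
  is "\<lambda>v w. Poly_Mapping.single (v, w) 1" .

text \<open>
  The linear map \<open>v \<otimes> w \<mapsto> \<beta> v w\<close> induced by a bilinear map \<open>\<beta>\<close>, evaluated on an arbitrary
  representative; see \<open>tensor_lift_ptensor\<close> and \<open>clinear_tensor_lift\<close> below.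
\<close>

definition tensor_lift ::
    "('v::cvector \<Rightarrow> 'w::cvector \<Rightarrow> 'u::cvector) \<Rightarrow> ('v, 'w) tensor \<Rightarrow> 'u"
  where "tensor_lift \<beta> t =
    (\<Sum>p\<in>Poly_Mapping.keys (rep_tensor t).
       Poly_Mapping.lookup (rep_tensor t) p *\<^sub>C \<beta> (fst p) (snd p))"

lemma cbilinear_ptensor: "cbilinear (\<otimes>)"
  unfolding cbilinear_def clinear_iff
proof (intro conjI allI)
  fix v v' :: "'v::cvector" and w w' :: "'w::cvector" and c
  show "(v + v') \<otimes> w = v \<otimes> w + v' \<otimes> w"
    by transfer (rule tensor_relI, unfold tensor_relators_def diff_diff_eq[symmetric], blast)
  show "v \<otimes> (w + w') = v \<otimes> w + v \<otimes> w'"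
    by transfer (rule tensor_relI, unfold tensor_relators_def diff_diff_eq[symmetric], blast)
  show "(c *\<^sub>C v) \<otimes> w = c *\<^sub>C (v \<otimes> w)"
    by transfer (rule tensor_relI, unfold tensor_relators_def, blast)
  show "v \<otimes> (c *\<^sub>C w) = c *\<^sub>C (v \<otimes> w)"
    by transfer (rule tensor_relI, unfold tensor_relators_def, blast)
qed

context
  fixes \<beta> :: "'v::cvector \<Rightarrow> 'w::cvector \<Rightarrow> 'u::cvector"
begin

private definition fl :: "(('v \<times> 'w) \<Rightarrow>\<^sub>0 complex) \<Rightarrow> 'u"
  where "fl f = (\<Sum>p\<in>Poly_Mapping.keys f. Poly_Mapping.lookup f p *\<^sub>C \<beta> (fst p) (snd p))"

private lemma fl_superset:
  assumes "finite S" "Poly_Mapping.keys f \<subseteq> S"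
  shows "fl f = (\<Sum>p\<in>S. Poly_Mapping.lookup f p *\<^sub>C \<beta> (fst p) (snd p))"
  unfolding fl_def by (rule sum.mono_neutral_left) (use assms in \<open>auto simp: Poly_Mapping.in_keys_iff\<close>)

private lemma clinear_fl: "clinear fl"
  unfolding clinear_iff
proof (intro conjI allI)
  fix f g :: "('v \<times> 'w) \<Rightarrow>\<^sub>0 complex" and c
  show "fl (f + g) = fl f + fl g"
    using Poly_Mapping.keys_add[of f g]
    by (simp add: fl_superset[of "Poly_Mapping.keys f \<union> Poly_Mapping.keys g"]
        Poly_Mapping.lookup_add cscale_add_left sum.distrib)
  have "Poly_Mapping.keys (c *\<^sub>C f) \<subseteq> Poly_Mapping.keys f"
    by (auto simp: Poly_Mapping.in_keys_iff cscale_poly_mapping.rep_eq)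
  then show "fl (c *\<^sub>C f) = c *\<^sub>C fl f"
    by (simp add: fl_superset[of "Poly_Mapping.keys f"] cscale_poly_mapping.rep_eq cvec.scale_sum_right
        cscale_cscale cscale_complex_def)
qed

private lemma fl_single: "fl (Poly_Mapping.single (v, w) 1) = \<beta> v w"
  by (simp add: fl_def cscale_one)

private lemma fl_rel:
  assumes "cbilinear \<beta>" "tensor_rel f g"
  shows "fl f = fl g"
proof -
  interpret fl: Vector_Spaces.linear cscale cscale fl by (rule clinear_fl)
  have "fl r = 0" if "r \<in> tensor_relators" for r
    using that assms(1)
    by (auto simp: tensor_relators_def fl.diff fl.scale fl_single cbilinear_def clinear_iff)
  then have "fl r = 0" if "r \<in> cvec.span tensor_relators" for r
    using fl.eq_0_on_span that by blast
  then show ?thesis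
    using assms(2) by (metis tensor_rel_def fl.diff eq_iff_diff_eq_0)
qed

private lemma tensor_lift_abs:
  assumes "cbilinear \<beta>"
  shows "tensor_lift \<beta> (abs_tensor f) = fl f"
proof -
  have "tensor_rel (rep_tensor (abs_tensor f)) f"
    by (metis Quotient3_abs_rep Quotient3_tensor tensor.abs_eq_iff)
  then show ?thesis
    using fl_rel[OF assms] by (simp add: tensor_lift_def fl_def)
qed

lemma tensor_lift_ptensor:
  assumes "cbilinear \<beta>"
  shows "tensor_lift \<beta> (v \<otimes> w) = \<beta> v w"
  by (simp add: ptensor.abs_eq tensor_lift_abs[OF assms] fl_single)

lemma clinear_tensor_lift:
  assumes "cbilinear \<beta>"
  shows "clinear (tensor_lift \<beta>)"
  unfolding clinear_iff
proof (intro conjI allI)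
  interpret fl: Vector_Spaces.linear cscale cscale fl by (rule clinear_fl)
  fix s t :: "('v, 'w) tensor" and c
  obtain f g where "s = abs_tensor f" "t = abs_tensor g"
    by (metis Quotient3_abs_rep Quotient3_tensor)
  then show "tensor_lift \<beta> (s + t) = tensor_lift \<beta> s + tensor_lift \<beta> t"
    and "tensor_lift \<beta> (c *\<^sub>C s) = c *\<^sub>C tensor_lift \<beta> s"
    by (simp_all add: plus_tensor.abs_eq cscale_tensor.abs_eq tensor_lift_abs[OF assms]
        fl.add fl.scale)
qed

end


section \<open>The category \<open>Art\<close>\<close>

definition is_ideal :: "'a::comm_ring_1 set \<Rightarrow> bool"
  where "is_ideal I \<longleftrightarrow> 0 \<in> I \<and> (\<forall>x\<in>I. \<forall>y\<in>I. x + y \<in> I) \<and> (\<forall>r. \<forall>x\<in>I. r * x \<in> I)"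

definition is_maximal_ideal :: "'a::comm_ring_1 set \<Rightarrow> bool"
  where "is_maximal_ideal I \<longleftrightarrow>
    is_ideal I \<and> I \<noteq> UNIV \<and> (\<forall>J. is_ideal J \<and> I \<subseteq> J \<longrightarrow> J = I \<or> J = UNIV)"

text \<open>Only meaningful for local rings.\<close>

definition max_ideal :: "'a::comm_ring_1 set"
  where "max_ideal = (THE I. is_maximal_ideal I)"

text \<open>
  The last condition says that \<open>\<complex> \<rightarrow> A \<rightarrow> A/\<mm>\<close> is onto; it is injective since \<open>\<mm>\<close> is proper.
\<close>

definition art :: "'a::calgebra itself \<Rightarrow> bool"
  where "art _ \<longleftrightarrow>
    (\<exists>!I::'a set. is_maximal_ideal I) \<and>
    (\<forall>J::nat \<Rightarrow> 'a set. (\<forall>n. is_ideal (J n)) \<and> (\<forall>n. J (Suc n) \<subseteq> J n)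
        \<longrightarrow> (\<exists>N. \<forall>n\<ge>N. J n = J N)) \<and>
    (\<forall>a::'a. \<exists>c. a - c *\<^sub>C 1 \<in> max_ideal)"

definition small_extension ::
    "(complex \<Rightarrow> 'a::calgebra) \<Rightarrow> ('a \<Rightarrow> 'b::calgebra) \<Rightarrow> bool"
  where "small_extension \<iota> \<alpha> \<longleftrightarrow>
    calg_hom \<alpha> \<and> surj \<alpha> \<and> clinear \<iota> \<and> inj \<iota> \<and> range \<iota> = {a. \<alpha> a = 0} \<and>
    (\<forall>a\<in>max_ideal. \<forall>k. \<alpha> k = 0 \<longrightarrow> a * k = 0)"

text \<open>
  The trivial square-zero extension \<open>\<complex> \<oplus> V\<close> of \<open>\<complex>\<close> by a vector space \<open>V\<close>, so
  \<open>Triv s v \<cdot> Triv t w = Triv (s t) (s w + t v)\<close>.  For \<open>V = \<complex>\<close> it is \<open>\<complex>[\<epsilon>]\<close>, and for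
  \<open>V = \<complex>\<^sup>2\<close> it is the fibre product \<open>\<complex>[\<epsilon>] \<times>\<^sub>\<complex> \<complex>[\<epsilon>]\<close>.
\<close>

datatype 'v triv = Triv (sca: complex) (inf: 'v)

instantiation triv :: (cvector) calgebra
begin
definition "0 = Triv 0 0"
definition "1 = Triv 1 0"
definition "x + y = Triv (sca x + sca y) (inf x + inf y)"
definition "x - y = Triv (sca x - sca y) (inf x - inf y)"
definition "- x = Triv (- sca x) (- inf x)"
definition "x * y = Triv (sca x * sca y) (sca x *\<^sub>C inf y + sca y *\<^sub>C inf x)"
definition "c *\<^sub>C x = Triv (c * sca x) (c *\<^sub>C inf x)"
instance
  by standard
    (simp_all add: zero_triv_def one_triv_def plus_triv_def minus_triv_def uminus_triv_def
      times_triv_def cscale_triv_def cscale_add_right cscale_add_left cscale_cscale cscale_one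
      algebra_simps)
end

type_synonym dual = "complex triv"

definition triv_map :: "('v \<Rightarrow> 'w) \<Rightarrow> 'v triv \<Rightarrow> 'w triv"
  where "triv_map f x = Triv (sca x) (f (inf x))"


section \<open>Differential graded Lie algebras\<close>

text \<open>
  The underlying vector space is the whole type \<open>'v\<close>, which is the internal direct sum of the
  homogeneous parts \<open>gr K i\<close>.
\<close>

record 'v dgl =
  gr :: "int \<Rightarrow> 'v set"
  df :: "'v \<Rightarrow> 'v"
  br :: "'v \<Rightarrow> 'v \<Rightarrow> 'v"

locale dgla =
  fixes K :: "'v::cvector dgl"
  assumes subspace_gr: "cvec.subspace (gr K i)"
    and direct_sum: "\<exists>!f. (\<forall>i. f i \<in> gr K i) \<and> finite {i. f i \<noteq> 0} \<and> v = Sum_any f"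
    and clinear_df: "clinear (df K)"
    and df_gr: "x \<in> gr K i \<Longrightarrow> df K x \<in> gr K (i + 1)"
    and df_df: "df K (df K x) = 0"
    and cbilinear_br: "cbilinear (br K)"
    and br_gr: "x \<in> gr K i \<Longrightarrow> y \<in> gr K j \<Longrightarrow> br K x y \<in> gr K (i + j)"
    and br_antisym: "x \<in> gr K i \<Longrightarrow> y \<in> gr K j \<Longrightarrow>
      br K x y = - ((- 1) powi (i * j) *\<^sub>C br K y x)"
    and br_jacobi: "x \<in> gr K i \<Longrightarrow> y \<in> gr K j \<Longrightarrow> z \<in> gr K k \<Longrightarrow>
      br K x (br K y z) = br K (br K x y) z + (- 1) powi (i * j) *\<^sub>C br K y (br K x z)"
    and df_br: "x \<in> gr K i \<Longrightarrow> y \<in> gr K j \<Longrightarrow>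
      df K (br K x y) = br K (df K x) y + (- 1) powi i *\<^sub>C br K x (df K y)"

definition dgla_hom ::
    "'l::cvector dgl \<Rightarrow> 'm::cvector dgl \<Rightarrow> ('l \<Rightarrow> 'm) \<Rightarrow> bool"
  where "dgla_hom L M \<chi> \<longleftrightarrow>
    clinear \<chi> \<and> (\<forall>i. \<forall>x\<in>gr L i. \<chi> x \<in> gr M i) \<and>
    (\<forall>x. \<chi> (df L x) = df M (\<chi> x)) \<and> (\<forall>x y. \<chi> (br L x y) = br M (\<chi> x) (\<chi> y))"


subsection \<open>Suspended mapping cone\<close>

definition cone :: "'l::cvector dgl \<Rightarrow> 'm::cvector dgl \<Rightarrow> int \<Rightarrow> ('l \<times> 'm) set"
  where "cone L M i = gr L i \<times> gr M (i - 1)"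

definition cone_df ::
    "'l::cvector dgl \<Rightarrow> 'm::cvector dgl \<Rightarrow> ('l \<Rightarrow> 'm) \<Rightarrow> 'l \<times> 'm \<Rightarrow> 'l \<times> 'm"
  where "cone_df L M \<chi> = (\<lambda>(l, m). (df L l, \<chi> l - df M m))"

definition cone_class ::
    "'l::cvector dgl \<Rightarrow> 'm::cvector dgl \<Rightarrow> ('l \<Rightarrow> 'm) \<Rightarrow> int \<Rightarrow> 'l \<times> 'm \<Rightarrow> ('l \<times> 'm) set"
  where "cone_class L M \<chi> i z = {z + cone_df L M \<chi> b | b. b \<in> cone L M (i - 1)}"

definition cone_coh ::
    "'l::cvector dgl \<Rightarrow> 'm::cvector dgl \<Rightarrow> ('l \<Rightarrow> 'm) \<Rightarrow> int \<Rightarrow> ('l \<times> 'm) set set"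
  where "cone_coh L M \<chi> i =
    cone_class L M \<chi> i ` {z \<in> cone L M i. cone_df L M \<chi> z = 0}"

definition coh_add :: "('l::cvector \<times> 'm::cvector) set \<Rightarrow> ('l \<times> 'm) set \<Rightarrow> ('l \<times> 'm) set"
  where "coh_add X Y = {x + y | x y. x \<in> X \<and> y \<in> Y}"

text \<open>The coboundaries are added so that \<open>0 \<cdot> X\<close> is the zero class and not the set \<open>{0}\<close>.\<close>

definition coh_scale ::
    "'l::cvector dgl \<Rightarrow> 'm::cvector dgl \<Rightarrow> ('l \<Rightarrow> 'm) \<Rightarrow> int \<Rightarrow> complex \<Rightarrow>
      ('l \<times> 'm) set \<Rightarrow> ('l \<times> 'm) set"
  where "coh_scale L M \<chi> i c X = (\<Union>x\<in>X. cone_class L M \<chi> i (c *\<^sub>C x))"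


subsection \<open>The differential graded Lie algebra \<open>K \<otimes> \<mm>\<^sub>A\<close>\<close>

text \<open>
  Since \<open>\<complex>\<close> is a field, \<open>K\<^sup>i \<otimes> \<mm>\<^sub>A\<close> is a subspace of \<open>K \<otimes> A\<close>; the operations below are
  defined on all of \<open>K \<otimes> A\<close>.
\<close>

definition tgr :: "'v::cvector dgl \<Rightarrow> int \<Rightarrow> ('v, 'a::calgebra) tensor set"
  where "tgr K i = cvec.span {v \<otimes> a | v a. v \<in> gr K i \<and> a \<in> max_ideal}"

definition tmap1 ::
    "('v::cvector \<Rightarrow> 'w::cvector) \<Rightarrow> ('v, 'a::cvector) tensor \<Rightarrow> ('w, 'a) tensor"
  where "tmap1 f = tensor_lift (\<lambda>v a. f v \<otimes> a)"

definition tmap2 ::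
    "('a::cvector \<Rightarrow> 'b::cvector) \<Rightarrow> ('v::cvector, 'a) tensor \<Rightarrow> ('v, 'b) tensor"
  where "tmap2 \<phi> = tensor_lift (\<lambda>v a. v \<otimes> \<phi> a)"

definition tdf :: "'v::cvector dgl \<Rightarrow> ('v, 'a::calgebra) tensor \<Rightarrow> ('v, 'a) tensor"
  where "tdf K = tmap1 (df K)"

definition tbr ::
    "'v::cvector dgl \<Rightarrow> ('v, 'a::calgebra) tensor \<Rightarrow> ('v, 'a) tensor \<Rightarrow> ('v, 'a) tensor"
  where "tbr K s t = tensor_lift (\<lambda>v a. tensor_lift (\<lambda>w b. br K v w \<otimes> (a * b)) t) s"

definition curv :: "'v::cvector dgl \<Rightarrow> ('v, 'a::calgebra) tensor \<Rightarrow> ('v, 'a) tensor"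
  where "curv K x = tdf K x + (1 / 2) *\<^sub>C tbr K x x"

text \<open>
  An element \<open>e\<^sup>a\<close> of \<open>exp(K\<^sup>0 \<otimes> \<mm>\<^sub>A)\<close> is represented by \<open>a\<close>.  The sums over \<open>n\<close> in \<open>gauge\<close> and \<open>bch\<close>
  are finite because \<open>\<mm>\<^sub>A\<close> is nilpotent.
\<close>

definition gauge ::
    "'v::cvector dgl \<Rightarrow> ('v, 'a::calgebra) tensor \<Rightarrow> ('v, 'a) tensor \<Rightarrow> ('v, 'a) tensor"
  where "gauge K a w =
    w + Sum_any (\<lambda>n::nat. (1 / fact (n + 1)) *\<^sub>C (tbr K a ^^ n) (tbr K a w - tdf K a))"

fun nested_br :: "('g::zero \<Rightarrow> 'g \<Rightarrow> 'g) \<Rightarrow> 'g list \<Rightarrow> 'g" where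
  "nested_br b [] = 0"
| "nested_br b [x] = x"
| "nested_br b (x # y # zs) = b x (nested_br b (y # zs))"

text \<open>
  The Baker-Campbell-Hausdorff product in Dynkin's form: the sum over \<open>k \<ge> 1\<close> and over
  \<open>(r\<^sub>1, s\<^sub>1), \<dots>, (r\<^sub>k, s\<^sub>k)\<close> with \<open>r\<^sub>i + s\<^sub>i > 0\<close> of
  \<open>(-1)\<^sup>k\<^sup>-\<^sup>1 / k \<cdot> [x\<^sup>r\<^sup>1 y\<^sup>s\<^sup>1 \<dots> x\<^sup>r\<^sup>k y\<^sup>s\<^sup>k] / ((\<Sum>\<^sub>i (r\<^sub>i + s\<^sub>i)) \<cdot> \<Prod>\<^sub>i r\<^sub>i! s\<^sub>i!)\<close>,
  with right-nested brackets, grouped by the total degree \<open>n = \<Sum>\<^sub>i (r\<^sub>i + s\<^sub>i)\<close>.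
\<close>

definition bch :: "('g::cvector \<Rightarrow> 'g \<Rightarrow> 'g) \<Rightarrow> 'g \<Rightarrow> 'g \<Rightarrow> 'g"
  where "bch b x y = Sum_any (\<lambda>n::nat.
    \<Sum>rs | rs \<noteq> [] \<and> (\<forall>(r, s)\<in>set rs. r + s > 0) \<and> (\<Sum>(r, s)\<leftarrow>rs. r + s) = n.
      ((- 1) ^ (length rs + 1) / of_nat (length rs)
         / (of_nat n * (\<Prod>(r, s)\<leftarrow>rs. fact r * fact s))) *\<^sub>C
      nested_br b (concat (map (\<lambda>(r, s). replicate r x @ replicate s y) rs)))"


section \<open>The functor \<open>Def\<^sub>\<chi>\<close>\<close>

definition MC ::
    "'l::cvector dgl \<Rightarrow> 'm::cvector dgl \<Rightarrow> ('l \<Rightarrow> 'm) \<Rightarrow>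
      (('l, 'a::calgebra) tensor \<times> ('m, 'a) tensor) set"
  where "MC L M \<chi> =
    {(x, a). x \<in> tgr L 1 \<and> a \<in> tgr M 0 \<and> curv L x = 0 \<and> gauge M a (tmap1 \<chi> x) = 0}"

definition act ::
    "'l::cvector dgl \<Rightarrow> 'm::cvector dgl \<Rightarrow> ('l \<Rightarrow> 'm) \<Rightarrow>
      ('l, 'a::calgebra) tensor \<Rightarrow> ('m, 'a) tensor \<Rightarrow>
      ('l, 'a) tensor \<times> ('m, 'a) tensor \<Rightarrow> ('l, 'a) tensor \<times> ('m, 'a) tensor"
  where "act L M \<chi> l m = (\<lambda>(x, a).
    (gauge L l x, bch (tbr M) (bch (tbr M) (tdf M m) a) (- tmap1 \<chi> l)))"

definition def_class ::
    "'l::cvector dgl \<Rightarrow> 'm::cvector dgl \<Rightarrow> ('l \<Rightarrow> 'm) \<Rightarrow>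
      ('l, 'a::calgebra) tensor \<times> ('m, 'a) tensor \<Rightarrow>
      (('l, 'a) tensor \<times> ('m, 'a) tensor) set"
  where "def_class L M \<chi> p = {act L M \<chi> l m p | l m. l \<in> tgr L 0 \<and> m \<in> tgr M (- 1)}"

definition Def ::
    "'l::cvector dgl \<Rightarrow> 'm::cvector dgl \<Rightarrow> ('l \<Rightarrow> 'm) \<Rightarrow>
      (('l, 'a::calgebra) tensor \<times> ('m, 'a) tensor) set set"
  where "Def L M \<chi> = def_class L M \<chi> ` MC L M \<chi>"

definition MC_map ::
    "('a::cvector \<Rightarrow> 'b::cvector) \<Rightarrow>
      ('l::cvector, 'a) tensor \<times> ('m::cvector, 'a) tensor \<Rightarrow> ('l, 'b) tensor \<times> ('m, 'b) tensor"
  where "MC_map \<phi> = (\<lambda>(x, a). (tmap2 \<phi> x, tmap2 \<phi> a))"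

definition Def_map ::
    "'l::cvector dgl \<Rightarrow> 'm::cvector dgl \<Rightarrow> ('l \<Rightarrow> 'm) \<Rightarrow> ('a::calgebra \<Rightarrow> 'b::calgebra) \<Rightarrow>
      (('l, 'a) tensor \<times> ('m, 'a) tensor) set \<Rightarrow> (('l, 'b) tensor \<times> ('m, 'b) tensor) set"
  where "Def_map L M \<chi> \<phi> \<xi> = (\<Union>p\<in>\<xi>. def_class L M \<chi> (MC_map \<phi> p))"


subsection \<open>Tangent space\<close>

text \<open>
  Schlessinger's vector space structure on \<open>Def\<^sub>\<chi>(\<complex>[\<epsilon>])\<close>: addition is
  \<open>Def(\<complex>[\<epsilon>]) \<times> Def(\<complex>[\<epsilon>]) \<cong> Def(\<complex>[\<epsilon>] \<times>\<^sub>\<complex> \<complex>[\<epsilon>]) \<rightarrow> Def(\<complex>[\<epsilon>])\<close>, the last map being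
  induced by \<open>(\<epsilon>, 0), (0, \<epsilon>) \<mapsto> \<epsilon>\<close>, and multiplication by \<open>c\<close> is induced by \<open>\<epsilon> \<mapsto> c \<epsilon>\<close>.
\<close>

definition tangent_space ::
    "'l::cvector dgl \<Rightarrow> 'm::cvector dgl \<Rightarrow> ('l \<Rightarrow> 'm) \<Rightarrow>
      (('l, dual) tensor \<times> ('m, dual) tensor) set set"
  where "tangent_space L M \<chi> = Def L M \<chi>"

definition tangent_add ::
    "'l::cvector dgl \<Rightarrow> 'm::cvector dgl \<Rightarrow> ('l \<Rightarrow> 'm) \<Rightarrow>
      (('l, dual) tensor \<times> ('m, dual) tensor) set \<Rightarrow>
      (('l, dual) tensor \<times> ('m, dual) tensor) set \<Rightarrow>
      (('l, dual) tensor \<times> ('m, dual) tensor) set"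
  where "tangent_add L M \<chi> \<xi> \<eta> =
    Def_map L M \<chi> (triv_map (\<lambda>v::complex \<times> complex. fst v + snd v))
      (THE \<zeta>. \<zeta> \<in> Def L M \<chi> \<and>
         Def_map L M \<chi> (triv_map fst) \<zeta> = \<xi> \<and> Def_map L M \<chi> (triv_map snd) \<zeta> = \<eta>)"

definition tangent_scale ::
    "'l::cvector dgl \<Rightarrow> 'm::cvector dgl \<Rightarrow> ('l \<Rightarrow> 'm) \<Rightarrow> complex \<Rightarrow>
      (('l, dual) tensor \<times> ('m, dual) tensor) set \<Rightarrow>
      (('l, dual) tensor \<times> ('m, dual) tensor) set"
  where "tangent_scale L M \<chi> c = Def_map L M \<chi> (triv_map (\<lambda>v. c * v))"


subsection \<open>Obstructions\<close>

definition is_lift ::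
    "'l::cvector dgl \<Rightarrow> 'm::cvector dgl \<Rightarrow> ('a::calgebra \<Rightarrow> 'b::calgebra) \<Rightarrow>
      ('l, 'b) tensor \<times> ('m, 'b) tensor \<Rightarrow> ('l, 'a) tensor \<times> ('m, 'a) tensor \<Rightarrow> bool"
  where "is_lift L M \<alpha> xq yp \<longleftrightarrow> yp \<in> tgr L 1 \<times> tgr M 0 \<and> MC_map \<alpha> yp = xq"

text \<open>
  \<open>(h, r) \<in> L\<^sup>2 \<oplus> M\<^sup>1\<close> is the pair \<open>(dy + \<onehalf>[y, y], e\<^sup>p * \<chi>(y))\<close> under the identifications
  \<open>L\<^sup>2 = L\<^sup>2 \<otimes> \<complex> \<subseteq> L\<^sup>2 \<otimes> \<mm>\<^sub>A\<close> and \<open>M\<^sup>1 = M\<^sup>1 \<otimes> \<complex> \<subseteq> M\<^sup>1 \<otimes> \<mm>\<^sub>A\<close> given by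
  \<open>\<iota> : \<complex> \<rightarrow> A\<close>.
\<close>

definition obstruction_pair ::
    "'l::cvector dgl \<Rightarrow> 'm::cvector dgl \<Rightarrow> ('l \<Rightarrow> 'm) \<Rightarrow> (complex \<Rightarrow> 'a::calgebra) \<Rightarrow>
      ('l, 'a) tensor \<times> ('m, 'a) tensor \<Rightarrow> 'l \<times> 'm \<Rightarrow> bool"
  where "obstruction_pair L M \<chi> \<iota> = (\<lambda>(y, p) (h, r).
    h \<in> gr L 2 \<and> r \<in> gr M 1 \<and> curv L y = h \<otimes> \<iota> 1 \<and> gauge M p (tmap1 \<chi> y) = r \<otimes> \<iota> 1)"

definition obstruction ::
    "'l::cvector dgl \<Rightarrow> 'm::cvector dgl \<Rightarrow> ('l \<Rightarrow> 'm) \<Rightarrow>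
      (complex \<Rightarrow> 'a::calgebra) \<Rightarrow> ('a \<Rightarrow> 'b::calgebra) \<Rightarrow>
      (('l, 'b) tensor \<times> ('m, 'b) tensor) set \<Rightarrow> ('l \<times> 'm) set"
  where "obstruction L M \<chi> \<iota> \<alpha> \<xi> =
    (THE \<omega>. \<exists>xq yp hr. xq \<in> MC L M \<chi> \<and> def_class L M \<chi> xq = \<xi> \<and> is_lift L M \<alpha> xq yp \<and>
       obstruction_pair L M \<chi> \<iota> yp hr \<and> \<omega> = cone_class L M \<chi> 2 hr)"

definition small_extension_hom ::
    "complex \<Rightarrow> ('a::calgebra \<Rightarrow> 'c::calgebra) \<Rightarrow> ('b::calgebra \<Rightarrow> 'd::calgebra) \<Rightarrow>
      (complex \<Rightarrow> 'a) \<Rightarrow> ('a \<Rightarrow> 'b) \<Rightarrow> (complex \<Rightarrow> 'c) \<Rightarrow> ('c \<Rightarrow> 'd) \<Rightarrow> bool"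
  where "small_extension_hom c \<phi> \<psi> \<iota> \<alpha> \<iota>' \<alpha>' \<longleftrightarrow>
    calg_hom \<phi> \<and> calg_hom \<psi> \<and> (\<forall>z. \<phi> (\<iota> z) = \<iota>' (c * z)) \<and> (\<forall>a. \<psi> (\<alpha> a) = \<alpha>' (\<phi> a))"

end

theory Submission
  imports Defs "HOL-Computational_Algebra.Formal_Power_Series"
begin

text \<open>
  \<^bold>\<open>The gauge action as an exponential.\<close>  On \<open>(K \<otimes> \<mm>\<^sub>A) \<times> \<complex>\<close> an element \<open>a\<close> of degree \<open>0\<close> acts by
  \<open>\<rho>(a)(w, t) = ([a, w] - t da, 0)\<close>; this is what bracketing with \<open>a\<close> becomes when an element
  \<open>\<delta>\<close> with \<open>[\<delta>, -] = d\<close> is adjoined to \<open>K\<close> and \<open>(w, t)\<close> is read as \<open>w + t\<delta>\<close>.  The map \<open>\<rho>\<close> is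
  a nilpotent representation, and \<open>e\<^sup>a * w\<close> is the first component of \<open>exp(\<rho>(a))(w, 1)\<close>
  (\<open>gauge_nexp\<close>).  Two facts follow.  Since \<open>dw + \<onehalf>[w, w]\<close> is the value at \<open>(w, 1)\<close> of a
  quadratic form of which the action of \<open>a\<close> is a derivation, the curvature of \<open>e\<^sup>a * w\<close> is
  \<open>e\<^bsup>[a,-]\<^esup>\<close> applied to the curvature of \<open>w\<close> (\<open>curv_gauge\<close>).  And
  \<open>e\<^bsup>bch(a,b)\<^esup> * w = e\<^sup>a * (e\<^sup>b * w)\<close> (\<open>gauge_bch\<close>), because Dynkin's series satisfies
  \<open>exp(\<rho>(bch(a, b))) = exp(\<rho>(a)) exp(\<rho>(b))\<close> in every nilpotent representation.

  \<^bold>\<open>Dynkin's formula.\<close>  Let \<open>Z = log(e\<^sup>X e\<^sup>Y)\<close> in the ring of noncommutative power series, and let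
  \<open>\<Delta>\<close> be the derivation multiplying words of length \<open>n\<close> by \<open>n\<close>.  Applying \<open>\<Delta>\<close> to
  \<open>e\<^sup>Z = e\<^sup>X e\<^sup>Y\<close> gives \<open>((e\<^sup>z - 1)/z)(ad Z) (\<Delta>Z) = X + e\<^bsup>ad X\<^esup> Y\<close>, and inverting the power series on the
  left gives \<open>\<Delta>Z = \<Sum>\<^sub>k (-1)\<^sup>k/(k+1) (e\<^bsup>ad X\<^esup> e\<^bsup>ad Y\<^esup> - 1)\<^sup>k (X + e\<^bsup>ad X\<^esup> Y)\<close>.  Expanding the exponentials
  produces right-nested commutators; the terms of Dynkin's sum ending in \<open>[X, X]\<close> or \<open>[Y, Y]\<close>
  are exactly the ones that do not occur here, and they vanish.  Dividing the part of degree \<open>n\<close>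
  by \<open>n\<close> gives Dynkin's series (\<open>cf_bchs\<close>).

  \<^bold>\<open>Obstructions.\<close>  Let \<open>\<epsilon>\<close> span the kernel of a small extension \<open>A \<rightarrow> B\<close>.  It is annihilated by
  \<open>\<mm>\<^sub>A\<close>, so every bracket with \<open>h \<otimes> \<epsilon>\<close> is zero.  Hence the Bianchi identity for \<open>y\<close> gives
  \<open>dh = 0\<close>, and comparing the curvatures of \<open>\<chi>(y)\<close> and \<open>e\<^sup>p * \<chi>(y) = r \<otimes> \<epsilon>\<close> gives
  \<open>dr = \<chi>(h)\<close>.  Changing the lift by \<open>(u, v) \<otimes> \<epsilon>\<close> changes \<open>(h, r)\<close> by \<open>\<delta>(u, v)\<close>
  (\<open>obstruction_pair_perturb\<close>), which proves independence of the lift and the lifting criterion at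
  once.  Finally an equivalence between two points of \<open>MC\<^sub>\<chi>(B)\<close> lifts to \<open>A\<close>, and by the two
  facts above it transports a lift of one to a lift of the other with the same pair \<open>(h, r)\<close>
  (\<open>obstruction_pair_act\<close>).

  \<^bold>\<open>Tangent space.\<close>  The maximal ideal of \<open>\<complex> \<oplus> V\<close> has square zero, so all brackets vanish: the
  equations defining \<open>MC\<^sub>\<chi>\<close> become the cocycle condition in \<open>C\<^sub>\<chi> \<otimes> V\<close>, and the group acts by adding
  coboundaries.
\<close>


section \<open>Noncommutative power series in two letters\<close>

text \<open>The ring \<open>\<complex>\<langle>\<langle>X, Y\<rangle>\<rangle>\<close>, a series being its coefficient function on words; the letter \<open>True\<close> stands
  for \<open>X\<close> and \<open>False\<close> for \<open>Y\<close>.\<close>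

datatype ncs = Ncs (cf: "bool list \<Rightarrow> complex")

lemma ncs_eqI: "(\<And>w. cf f w = cf g w) \<Longrightarrow> f = g"
  by (rule ncs.expand) (rule ext)

instantiation ncs :: ring_1
begin
definition "0 = Ncs (\<lambda>w. 0)"
definition "1 = Ncs (\<lambda>w. if w = [] then 1 else 0)"
definition "f + g = Ncs (\<lambda>w. cf f w + cf g w)"
definition "f - g = Ncs (\<lambda>w. cf f w - cf g w)"
definition "- f = Ncs (\<lambda>w. - cf f w)"
definition "f * g = Ncs (\<lambda>w. \<Sum>i\<le>length w. cf f (take i w) * cf g (drop i w))"
instance
proof
  fix f g h :: ncs
  show "f * g * h = f * (g * h)"
  proof (rule ncs_eqI)
    fix w :: "bool list"
    let ?n = "length w"
    let ?t = "\<lambda>i k. cf f (take i w) * cf g (take k (drop i w)) * cf h (drop (i + k) w)"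
    have "cf (f * g * h) w = (\<Sum>j\<le>?n. \<Sum>i\<le>j. ?t i (j - i))"
      by (auto simp: times_ncs_def sum_distrib_right take_take min_def drop_take intro!: sum.cong)
    also have "\<dots> = (\<Sum>(i, k)\<in>{(i, k). i + k \<le> ?n}. ?t i k)"
      by (rule sum.triangle_reindex_eq[symmetric])
    also have "\<dots> = (\<Sum>(i, k)\<in>Sigma {..?n} (\<lambda>i. {..?n - i}). ?t i k)"
      by (rule sum.cong) auto
    also have "\<dots> = (\<Sum>i\<le>?n. \<Sum>k\<le>?n - i. ?t i k)"
      by (simp add: sum.Sigma)
    also have "\<dots> = cf (f * (g * h)) w"
      by (auto simp: times_ncs_def sum_distrib_left mult.assoc add.commute intro!: sum.cong)
    finally show "cf (f * g * h) w = cf (f * (g * h)) w" .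
  qed
  show "1 * f = f"
  proof (rule ncs_eqI)
    fix w
    have "cf (1 * f) w = (\<Sum>i\<le>length w. if i = 0 then cf f (drop i w) else 0)"
      unfolding times_ncs_def one_ncs_def ncs.sel by (rule sum.cong) auto
    then show "cf (1 * f) w = cf f w" by simp
  qed
  show "f * 1 = f"
  proof (rule ncs_eqI)
    fix w
    have "cf (f * 1) w = (\<Sum>i\<le>length w. if i = length w then cf f (take i w) else 0)"
      unfolding times_ncs_def one_ncs_def ncs.sel by (rule sum.cong) auto
    then show "cf (f * 1) w = cf f w" by simp
  qed
  show "(f + g) * h = f * h + g * h" "f * (g + h) = f * g + f * h"
    by (auto intro!: ncs_eqI
        simp: times_ncs_def plus_ncs_def ring_distribs sum.distrib)
  have "cf (0::ncs) [] \<noteq> cf 1 []" by (simp add: zero_ncs_def one_ncs_def)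
  then show "(0::ncs) \<noteq> 1" by metis
qed (auto intro!: ncs_eqI simp: zero_ncs_def plus_ncs_def minus_ncs_def uminus_ncs_def)
end

instantiation ncs :: cvector
begin
definition "c *\<^sub>C f = Ncs (\<lambda>w. c * cf f w)"
instance
  by standard (auto intro!: ncs_eqI simp: cscale_ncs_def plus_ncs_def algebra_simps)
end

lemma cf_simps [simp]:
  "cf 0 w = 0" "cf (f + g) w = cf f w + cf g w" "cf (f - g) w = cf f w - cf g w"
  "cf (- f) w = - cf f w" "cf (c *\<^sub>C f) w = c * cf f w"
  by (simp_all add: zero_ncs_def plus_ncs_def minus_ncs_def uminus_ncs_def cscale_ncs_def)

lemma cf_one: "cf 1 w = (if w = [] then 1 else 0)"
  by (simp add: one_ncs_def)

lemma cf_times: "cf (f * g) w = (\<Sum>i\<le>length w. cf f (take i w) * cf g (drop i w))"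
  by (simp add: times_ncs_def)

lemma cf_sum [simp]: "cf (sum F A) w = (\<Sum>i\<in>A. cf (F i) w)"
  by (induction A rule: infinite_finite_induct) auto

lemma ncs_scale_times [simp]:
  "(c *\<^sub>C f) * g = c *\<^sub>C (f * (g::ncs))" "f * (c *\<^sub>C g) = c *\<^sub>C (f * (g::ncs))"
  by (auto intro!: ncs_eqI simp: cf_times sum_distrib_left mult_ac)

text \<open>Order of vanishing at least \<open>n\<close>; congruence modulo such series is how infinite sums are
  compared with their partial sums.\<close>

definition vanish :: "nat \<Rightarrow> ncs \<Rightarrow> bool"
  where "vanish n f \<longleftrightarrow> (\<forall>w. length w < n \<longrightarrow> cf f w = 0)"

lemma vanish_0 [simp]: "vanish 0 f" by (simp add: vanish_def)

lemma vanish_mono: "vanish n f \<Longrightarrow> m \<le> n \<Longrightarrow> vanish m f" by (auto simp: vanish_def)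

lemma vanish_add: "vanish n f \<Longrightarrow> vanish n g \<Longrightarrow> vanish n (f + g)" by (auto simp: vanish_def)

lemma vanish_diff: "vanish n f \<Longrightarrow> vanish n g \<Longrightarrow> vanish n (f - g)" by (auto simp: vanish_def)

lemma vanish_times:
  assumes "vanish m f" "vanish n g"
  shows "vanish (m + n) (f * g)"
  unfolding vanish_def
proof (intro allI impI)
  fix w :: "bool list" assume "length w < m + n"
  have "cf f (take i w) * cf g (drop i w) = 0" if "i \<le> length w" for i
  proof (cases "i < m")
    case True
    then have "length (take i w) < m" by simp
    then show ?thesis using assms(1) by (simp add: vanish_def)
  next
    case False
    then have "length (drop i w) < n" using \<open>length w < m + n\<close> that by simp
    then show ?thesis using assms(2) by (simp add: vanish_def)
  qed
  then show "cf (f * g) w = 0" by (auto simp: cf_times intro!: sum.neutral)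
qed

lemma vanish_times_left: "vanish n f \<Longrightarrow> vanish n (f * g)"
  using vanish_times[of n f 0 g] by simp

lemma vanish_times_right: "vanish n g \<Longrightarrow> vanish n (f * g)"
  using vanish_times[of 0 f n g] by simp

section \<open>Power series in contracting operators\<close>

text \<open>The condition under which a power series can be evaluated at \<open>T\<close>.\<close>

definition contr :: "(ncs \<Rightarrow> ncs) \<Rightarrow> bool"
  where "contr T \<longleftrightarrow> clinear T \<and> (\<forall>n f. vanish n f \<longrightarrow> vanish (Suc n) (T f))"

definition nonexp :: "(ncs \<Rightarrow> ncs) \<Rightarrow> bool"
  where "nonexp T \<longleftrightarrow> clinear T \<and> (\<forall>n f. vanish n f \<longrightarrow> vanish n (T f))"

lemma contr_nonexp: "contr T \<Longrightarrow> nonexp T"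
  unfolding contr_def nonexp_def using vanish_mono le_SucI order_refl by metis

lemma clinear_scale: "clinear T \<Longrightarrow> T (c *\<^sub>C f) = c *\<^sub>C T f"
  by (simp add: clinear_iff)

lemma clinear_add: "clinear T \<Longrightarrow> T (f + g) = T f + T g"
  by (simp add: clinear_iff)

lemma clinear_0: "clinear T \<Longrightarrow> T 0 = 0"
  using clinear_add[of T 0 0] by simp

lemma clinear_sum: "clinear T \<Longrightarrow> T (sum F A) = (\<Sum>i\<in>A. T (F i))"
  by (induction A rule: infinite_finite_induct) (auto simp: clinear_0 clinear_add)

lemma clinear_diff: "clinear T \<Longrightarrow> T (f - g) = T f - T g"
  using clinear_add[of T "f - g" g] by simp

lemma cscale_two: "2 *\<^sub>C x = x + (x :: 'a::cvector)"
  using cscale_add_left[of 1 1 x] by (simp add: cscale_one)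

lemma clinear_funpow:
  fixes T :: "'a::cvector \<Rightarrow> 'a"
  shows "clinear T \<Longrightarrow> clinear (T ^^ n)"
  unfolding clinear_iff
proof (induction n)
  case 0 show ?case by simp
next
  case (Suc n) then show ?case by simp
qed

text \<open>The derivation rule is only asked for on invariant sets \<open>S\<close>, \<open>S'\<close>: for the gauge action it
  holds only for arguments of degree \<open>1\<close>.\<close>

lemma leibniz:
  fixes \<beta> :: "'u::cvector \<Rightarrow> 'v::cvector \<Rightarrow> 'w::cvector"
  assumes bil: "cbilinear \<beta>" and lin: "clinear T"
    and der: "\<And>u v. u \<in> S \<Longrightarrow> v \<in> S' \<Longrightarrow> T (\<beta> u v) = \<beta> (P u) v + \<beta> u (Q v)"
    and inv: "\<And>u. u \<in> S \<Longrightarrow> P u \<in> S" "\<And>v. v \<in> S' \<Longrightarrow> Q v \<in> S'"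
    and mem: "u \<in> S" "v \<in> S'"
  shows "(T ^^ n) (\<beta> u v) = (\<Sum>k\<le>n. of_nat (n choose k) *\<^sub>C \<beta> ((P ^^ k) u) ((Q ^^ (n - k)) v))"
proof (induction n)
  case (Suc n)
  let ?b = "\<lambda>k m. \<beta> ((P ^^ k) u) ((Q ^^ m) v)"
  have pw: "(P ^^ k) u \<in> S" "(Q ^^ k) v \<in> S'" for k
    by (induction k) (simp_all add: inv mem)
  have step: "T (?b k m) = ?b (Suc k) m + ?b k (Suc m)" for k m
    using der[OF pw] by simp
  have "(T ^^ Suc n) (\<beta> u v) = (\<Sum>k\<le>n. of_nat (n choose k) *\<^sub>C T (?b k (n - k)))"
    by (simp add: Suc clinear_sum[OF lin] clinear_scale[OF lin])
  also have "\<dots> = (\<Sum>k\<le>n. of_nat (n choose k) *\<^sub>C ?b (Suc k) (n - k))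
      + (\<Sum>k\<le>n. of_nat (n choose k) *\<^sub>C ?b k (Suc n - k))"
    unfolding step cscale_add_right sum.distrib by (simp add: Suc_diff_le)
  also have "(\<Sum>k\<le>n. of_nat (n choose k) *\<^sub>C ?b (Suc k) (n - k)) =
      (\<Sum>k\<le>n. of_nat (n choose k) *\<^sub>C ?b (Suc k) (Suc n - Suc k))"
    by simp
  also have "(\<Sum>k\<le>n. of_nat (n choose k) *\<^sub>C ?b k (Suc n - k)) =
      (\<Sum>k\<le>Suc n. of_nat (n choose k) *\<^sub>C ?b k (Suc n - k))"
    by (simp add: binomial_eq_0)
  also have "\<dots> = ?b 0 (Suc n) + (\<Sum>k\<le>n. of_nat (n choose Suc k) *\<^sub>C ?b (Suc k) (Suc n - Suc k))"
    by (subst sum.atMost_Suc_shift) (simp add: cscale_one)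
  also have "(\<Sum>k\<le>n. of_nat (n choose k) *\<^sub>C ?b (Suc k) (Suc n - Suc k)) + \<dots> =
      ?b 0 (Suc n) + (\<Sum>k\<le>n. of_nat (Suc n choose Suc k) *\<^sub>C ?b (Suc k) (Suc n - Suc k))"
    by (simp add: cscale_add_left sum.distrib)
  also have "\<dots> = (\<Sum>k\<le>Suc n. of_nat (Suc n choose k) *\<^sub>C ?b k (Suc n - k))"
    by (subst sum.atMost_Suc_shift) (simp add: cscale_one)
  finally show ?case .
qed (simp add: cscale_one)

lemma vanish_contr_pow: "contr T \<Longrightarrow> vanish m f \<Longrightarrow> vanish (m + n) ((T ^^ n) f)"
  by (induction n) (auto simp: contr_def)

lemma vanish_contr_pow0: "contr T \<Longrightarrow> vanish n ((T ^^ n) f)"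
  using vanish_contr_pow[of T 0 f n] by simp

lemma nonexp_pow: "nonexp T \<Longrightarrow> nonexp (T ^^ n)"
  unfolding nonexp_def by (auto simp: clinear_funpow) (induction n; auto)

text \<open>The operator \<open>\<phi>(T)\<close>.  At a word of length \<open>l\<close> the powers \<open>T\<^sup>n\<close> with \<open>n > l\<close> contribute nothing when \<open>T\<close> is
  contracting, so that the sum may be cut off at \<open>l\<close>.\<close>

definition fpsop :: "complex fps \<Rightarrow> (ncs \<Rightarrow> ncs) \<Rightarrow> ncs \<Rightarrow> ncs"
  where "fpsop \<phi> T f = Ncs (\<lambda>w. \<Sum>n\<le>length w. fps_nth \<phi> n * cf ((T ^^ n) f) w)"

definition fpspart :: "nat \<Rightarrow> complex fps \<Rightarrow> (ncs \<Rightarrow> ncs) \<Rightarrow> ncs \<Rightarrow> ncs"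
  where "fpspart N \<phi> T f = (\<Sum>n\<le>N. fps_nth \<phi> n *\<^sub>C (T ^^ n) f)"

lemma cf_fpsop:
  assumes "contr T" "length w \<le> N"
  shows "cf (fpsop \<phi> T f) w = (\<Sum>n\<le>N. fps_nth \<phi> n * cf ((T ^^ n) f) w)"
  unfolding fpsop_def ncs.sel
  by (rule sum.mono_neutral_left)
    (use assms vanish_contr_pow0[OF assms(1)] in \<open>auto simp: vanish_def\<close>)

lemma fpspart_approx: "contr T \<Longrightarrow> vanish (Suc N) (fpsop \<phi> T f - fpspart N \<phi> T f)"
  by (auto simp: vanish_def cf_fpsop fpspart_def)

lemma cf_nonexp_approx:
  assumes "nonexp T" "vanish (Suc N) (f - g)" "length w \<le> N"
  shows "cf (T f) w = cf (T g) w"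
proof -
  have "vanish (Suc N) (T (f - g))" using assms(1,2) by (auto simp: nonexp_def)
  then have "cf (T f - T g) w = 0"
    using assms by (auto simp: vanish_def nonexp_def clinear_diff)
  then show ?thesis by simp
qed

lemma clinear_fpsop: "clinear T \<Longrightarrow> clinear (fpsop \<phi> T)"
  using clinear_funpow[of T]
  by (auto simp: clinear_iff fpsop_def sum.distrib sum_distrib_left algebra_simps intro!: ncs_eqI)

lemma nonexp_fpsop:
  assumes "contr T"
  shows "nonexp (fpsop \<phi> T)"
  unfolding nonexp_def
proof (intro conjI allI impI)
  show "clinear (fpsop \<phi> T)" using assms by (auto simp: contr_def clinear_fpsop)
  fix n f assume "vanish n f"
  then have "vanish n ((T ^^ k) f)" for k
    using vanish_contr_pow[OF assms, of n f k] vanish_mono by fastforce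
  then show "vanish n (fpsop \<phi> T f)"
    by (auto simp: vanish_def fpsop_def)
qed

lemma contr_fpsop:
  assumes "contr T" "fps_nth \<phi> 0 = 0"
  shows "contr (fpsop \<phi> T)"
  unfolding contr_def
proof (intro conjI allI impI)
  show "clinear (fpsop \<phi> T)" using assms by (auto simp: contr_def clinear_fpsop)
  fix n f assume "vanish n f"
  then have *: "vanish (Suc n) ((T ^^ k) f)" if "k > 0" for k
    using vanish_contr_pow[OF assms(1), of n f k] vanish_mono that by fastforce
  have "fps_nth \<phi> k * cf ((T ^^ k) f) w = 0" if "length w < Suc n" for k w
    using that * assms(2) by (cases "k = 0") (auto simp: vanish_def)
  then show "vanish (Suc n) (fpsop \<phi> T f)"
    unfolding vanish_def fpsop_def by (auto intro!: sum.neutral)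
qed

text \<open>Evaluation at \<open>T\<close> is a ring homomorphism; with \<open>fpsop_compose\<close> it reduces identities between
  operators to identities between power series in one variable.\<close>

lemma fpsop_mult:
  assumes "contr T"
  shows "fpsop \<phi> T (fpsop \<psi> T f) = fpsop (\<phi> * \<psi>) T f"
proof (rule ncs_eqI)
  fix w :: "bool list"
  define N where "N = length w"
  define c where "c k = cf ((T ^^ k) f) w" for k
  have c0: "c k = 0" if "k > N" for k
    using vanish_contr_pow0[OF assms, of k f] that by (auto simp: vanish_def c_def N_def)
  have lin: "clinear (T ^^ n)" for n using assms by (auto simp: contr_def clinear_funpow)
  have "cf ((T ^^ n) (fpsop \<psi> T f)) w = (\<Sum>m\<le>N. fps_nth \<psi> m * c (n + m))" for n
  proof -
    have "cf ((T ^^ n) (fpsop \<psi> T f)) w = cf ((T ^^ n) (fpspart N \<psi> T f)) w"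
      by (rule cf_nonexp_approx[OF nonexp_pow[OF contr_nonexp[OF assms]] fpspart_approx[OF assms]])
        (simp add: N_def)
    then show ?thesis
      using lin[of n] by (simp add: fpspart_def clinear_sum clinear_scale c_def funpow_add)
  qed
  then have "cf (fpsop \<phi> T (fpsop \<psi> T f)) w =
      (\<Sum>n\<le>N. \<Sum>m\<le>N. fps_nth \<phi> n * fps_nth \<psi> m * c (n + m))"
    by (simp add: cf_fpsop[OF assms, of w N] N_def sum_distrib_left mult.assoc)
  also have "\<dots> = (\<Sum>(n, m)\<in>{..N} \<times> {..N}. fps_nth \<phi> n * fps_nth \<psi> m * c (n + m))"
    by (simp add: sum.cartesian_product)
  also have "\<dots> = (\<Sum>(n, m)\<in>{(n, m). n + m \<le> N}. fps_nth \<phi> n * fps_nth \<psi> m * c (n + m))"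
    by (rule sum.mono_neutral_right) (auto, metis c0 not_le)
  also have "\<dots> = (\<Sum>k\<le>N. \<Sum>i\<le>k. fps_nth \<phi> i * fps_nth \<psi> (k - i) * c (i + (k - i)))"
    by (rule sum.triangle_reindex_eq)
  also have "\<dots> = cf (fpsop (\<phi> * \<psi>) T f) w"
    by (simp add: cf_fpsop[OF assms, of w N] N_def fps_mult_nth sum_distrib_right c_def atMost_atLeast0)
  finally show "cf (fpsop \<phi> T (fpsop \<psi> T f)) w = cf (fpsop (\<phi> * \<psi>) T f) w" .
qed

lemma fpsop_one [simp]: "fpsop 1 T f = f"
proof (rule ncs_eqI)
  fix w
  have "cf (fpsop 1 T f) w = (\<Sum>n\<le>length w. if n = 0 then cf ((T ^^ n) f) w else 0)"
    unfolding fpsop_def ncs.sel by (rule sum.cong) auto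
  then show "cf (fpsop 1 T f) w = cf f w" by simp
qed

lemma fpsop_X:
  assumes "contr T"
  shows "fpsop fps_X T f = T f"
proof (rule ncs_eqI)
  fix w
  have "cf (fpsop fps_X T f) w = (\<Sum>n\<le>Suc (length w). if n = 1 then cf ((T ^^ n) f) w else 0)"
    unfolding cf_fpsop[OF assms le_SucI[OF order_refl]] by (rule sum.cong) auto
  then show "cf (fpsop fps_X T f) w = cf (T f) w" by (simp del: sum.atMost_Suc)
qed

lemma fpsop_add: "fpsop (\<phi> + \<psi>) T f = fpsop \<phi> T f + fpsop \<psi> T f"
  by (rule ncs_eqI) (simp add: fpsop_def algebra_simps sum.distrib)

lemma fpsop_diff: "fpsop (\<phi> - \<psi>) T f = fpsop \<phi> T f - fpsop \<psi> T f"
  by (rule ncs_eqI) (simp add: fpsop_def algebra_simps sum_subtractf)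

lemma fpsop_power: "contr T \<Longrightarrow> (fpsop \<phi> T ^^ n) f = fpsop (\<phi> ^ n) T f"
  by (induction n) (simp_all add: fpsop_mult)

lemma fpsop_compose:
  assumes "contr T" "fps_nth \<phi> 0 = 0"
  shows "fpsop \<psi> (fpsop \<phi> T) f = fpsop (\<psi> oo \<phi>) T f"
proof (rule ncs_eqI)
  fix w :: "bool list"
  define N where "N = length w"
  have "cf (fpsop \<psi> (fpsop \<phi> T) f) w =
      (\<Sum>n\<le>N. \<Sum>m\<le>N. fps_nth \<psi> n * (fps_nth (\<phi> ^ n) m * cf ((T ^^ m) f) w))"
    by (simp add: cf_fpsop[OF contr_fpsop[OF assms], of w N] cf_fpsop[OF assms(1), of w N] N_def
        fpsop_power[OF assms(1)] sum_distrib_left)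
  also have "\<dots> = (\<Sum>m\<le>N. (\<Sum>n\<le>N. fps_nth \<psi> n * fps_nth (\<phi> ^ n) m) * cf ((T ^^ m) f) w)"
    by (subst sum.swap) (simp add: sum_distrib_right mult.assoc)
  also have "\<dots> = (\<Sum>m\<le>N. fps_nth (\<psi> oo \<phi>) m * cf ((T ^^ m) f) w)"
  proof (rule sum.cong)
    fix m assume "m \<in> {..N}"
    have "(\<Sum>n\<le>N. fps_nth \<psi> n * fps_nth (\<phi> ^ n) m) = (\<Sum>n\<in>{0..m}. fps_nth \<psi> n * fps_nth (\<phi> ^ n) m)"
      by (rule sum.mono_neutral_right)
        (use \<open>m \<in> {..N}\<close> startsby_zero_power_prefix[OF assms(2)] in auto)
    then show "(\<Sum>n\<le>N. fps_nth \<psi> n * fps_nth (\<phi> ^ n) m) * cf ((T ^^ m) f) w =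
        fps_nth (\<psi> oo \<phi>) m * cf ((T ^^ m) f) w"
      by (simp add: fps_compose_nth)
  qed simp
  also have "\<dots> = cf (fpsop (\<psi> oo \<phi>) T f) w"
    by (simp add: cf_fpsop[OF assms(1), of w N] N_def)
  finally show "cf (fpsop \<psi> (fpsop \<phi> T) f) w = cf (fpsop (\<psi> oo \<phi>) T f) w" .
qed


section \<open>Exponentials of noncommutative power series\<close>

definition lmul :: "ncs \<Rightarrow> ncs \<Rightarrow> ncs" where "lmul u f = u * f"

definition comm :: "ncs \<Rightarrow> ncs \<Rightarrow> ncs" where "comm u f = u * f - f * u"

text \<open>Defined through left multiplication, so that the calculus of \<open>fpsop\<close> applies to exponentials and
  logarithms in the ring.\<close>

definition ncexp :: "ncs \<Rightarrow> ncs" where "ncexp u = fpsop (fps_exp 1) (lmul u) 1"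

lemma clinear_lmul: "clinear (lmul u)"
  unfolding clinear_iff lmul_def by (simp add: ring_distribs)

lemma clinear_comm: "clinear (comm u)"
  unfolding clinear_iff comm_def by (simp add: ring_distribs cvec.scale_right_diff_distrib)

lemma contr_lmul: "vanish (Suc 0) u \<Longrightarrow> contr (lmul u)"
  unfolding contr_def using vanish_times[of "Suc 0" u] by (simp add: clinear_lmul lmul_def)

lemma contr_comm: "vanish (Suc 0) u \<Longrightarrow> contr (comm u)"
  unfolding contr_def using vanish_times[of "Suc 0" u] vanish_times[of _ _ "Suc 0" u]
  by (auto simp: clinear_comm comm_def intro: vanish_diff)

lemma nonexp_rmul: "nonexp (\<lambda>f. f * u)"
  unfolding nonexp_def clinear_iff by (simp add: ring_distribs vanish_times_left)

lemma lmul_pow: "(lmul u ^^ n) f = u ^ n * f"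
  by (induction n) (simp_all add: lmul_def mult.assoc)

lemma fpsop_lmul_times:
  assumes "vanish (Suc 0) u"
  shows "fpsop \<phi> (lmul u) f * g = fpsop \<phi> (lmul u) (f * g)"
proof (rule ncs_eqI)
  fix w :: "bool list"
  have "cf (fpsop \<phi> (lmul u) f * g) w = cf (fpspart (length w) \<phi> (lmul u) f * g) w"
    using cf_nonexp_approx[OF nonexp_rmul fpspart_approx[OF contr_lmul[OF assms]] order_refl] .
  also have "\<dots> = cf (fpsop \<phi> (lmul u) (f * g)) w"
    by (simp add: fpspart_def lmul_pow sum_distrib_right fpsop_def mult.assoc)
  finally show "cf (fpsop \<phi> (lmul u) f * g) w = cf (fpsop \<phi> (lmul u) (f * g)) w" .
qed

lemma ncexp_times: "vanish (Suc 0) u \<Longrightarrow> ncexp u * g = fpsop (fps_exp 1) (lmul u) g"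
  by (simp add: ncexp_def fpsop_lmul_times)

lemma fps_exp_neg_fpsop:
  assumes "contr T"
  shows "fpsop (fps_exp 1) (\<lambda>f. - T f) f = fpsop (fps_exp (-1)) T f"
proof (rule ncs_eqI)
  fix w
  have lin: "T (- f) = - T f" for f using assms clinear_diff[of T 0 f] clinear_0[of T] by (simp add: contr_def)
  have "((\<lambda>f. - T f) ^^ n) f = ((-1) ^ n :: complex) *\<^sub>C (T ^^ n) f" for n
  proof (induction n)
    case (Suc n)
    have "T (((-1) ^ n :: complex) *\<^sub>C (T ^^ n) f) = ((-1) ^ n :: complex) *\<^sub>C T ((T ^^ n) f)"
      using assms by (simp add: contr_def clinear_scale)
    then show ?case using Suc by (simp add: cvec.scale_minus_left)
  qed (simp add: cscale_one)
  then show "cf (fpsop (fps_exp 1) (\<lambda>f. - T f) f) w = cf (fpsop (fps_exp (-1)) T f) w"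
    by (simp add: fpsop_def mult_ac)
qed

lemma ncexp_neg:
  assumes "vanish (Suc 0) u"
  shows "ncexp (- u) * ncexp u = 1" "ncexp u * ncexp (- u) = 1"
proof -
  have *: "vanish (Suc 0) (- u)" using assms by (simp add: vanish_def)
  have eq: "lmul (- u) = (\<lambda>f. - lmul u f)" by (auto simp: lmul_def)
  have "ncexp (- u) * f = fpsop (fps_exp (-1)) (lmul u) f" for f
    unfolding ncexp_times[OF *] eq by (rule fps_exp_neg_fpsop[OF contr_lmul[OF assms]])
  moreover from this[of 1] have "ncexp (- u) = fpsop (fps_exp (-1)) (lmul u) 1" by simp
  ultimately show "ncexp (- u) * ncexp u = 1" "ncexp u * ncexp (- u) = 1"
    unfolding ncexp_times[OF assms]
    by (simp_all add: ncexp_def[of u] fpsop_mult[OF contr_lmul[OF assms]] flip: fps_exp_add_mult)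
qed

lemma ncexp_right_cancel:
  assumes "vanish (Suc 0) u" "f * ncexp u = g * ncexp u"
  shows "f = g"
  by (metis assms mult.assoc mult.right_neutral ncexp_neg(2))

text \<open>Left multiplication by \<open>u\<close> satisfies \<open>u (f g) = [u, f] g + f (u g)\<close>.\<close>

lemma power_times_comm:
  "u ^ n * f = (\<Sum>k\<le>n. of_nat (n choose k) *\<^sub>C ((comm u ^^ k) f * u ^ (n - k)))"
proof -
  have "(lmul u ^^ n) (f * 1) =
      (\<Sum>k\<le>n. of_nat (n choose k) *\<^sub>C ((comm u ^^ k) f * (lmul u ^^ (n - k)) 1))"
    by (rule leibniz[where S = UNIV and S' = UNIV])
      (simp_all only: clinear_lmul UNIV_I, simp_all add: cbilinear_def clinear_iff ring_distribs,
       simp add: comm_def lmul_def ring_distribs mult.assoc)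
  then show ?thesis by (simp add: lmul_pow)
qed

lemma triangle_sum:
  fixes F :: "nat \<Rightarrow> nat \<Rightarrow> complex"
  assumes "\<And>k j. k + j > N \<Longrightarrow> F k j = 0"
  shows "(\<Sum>n\<le>N. \<Sum>k\<le>n. F k (n - k)) = (\<Sum>k\<le>N. \<Sum>j\<le>N. F k j)"
proof -
  have "(\<Sum>n\<le>N. \<Sum>k\<le>n. F k (n - k)) = (\<Sum>(k, j)\<in>{(k, j). k + j \<le> N}. F k j)"
    by (rule sum.triangle_reindex_eq[symmetric])
  also have "\<dots> = (\<Sum>(k, j)\<in>{..N} \<times> {..N}. F k j)"
    by (rule sum.mono_neutral_left) (auto, metis assms not_le)
  finally show ?thesis by (simp add: sum.cartesian_product)
qed

lemma cf_times_approx: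
  assumes "vanish (Suc N) (f - f')" "vanish (Suc N) (g - g')" "length w \<le> N"
  shows "cf (f * g) w = cf (f' * g') w"
proof -
  have "cf f (take i w) = cf f' (take i w)" "cf g (drop i w) = cf g' (drop i w)" for i
    using assms by (auto simp: vanish_def)
  then show ?thesis by (simp add: cf_times)
qed

text \<open>The identity \<open>e\<^sup>u f e\<^bsup>-u\<^esup> = e\<^bsup>ad u\<^esup> f\<close>, cleared of the inverse.\<close>

lemma ncexp_conj:
  assumes u: "vanish (Suc 0) u"
  shows "ncexp u * f = fpsop (fps_exp 1) (comm u) f * ncexp u"
proof (rule ncs_eqI)
  fix w :: "bool list"
  define N where "N = length w"
  define F where "F k j = cf ((comm u ^^ k) f * u ^ j) w / (fact k * fact j)" for k j
  have F0: "F k j = 0" if "k + j > N" for k j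
  proof -
    have "vanish j (u ^ j)" using vanish_contr_pow0[OF contr_lmul[OF u], of j 1] by (simp add: lmul_pow)
    then have "vanish (k + j) ((comm u ^^ k) f * u ^ j)"
      by (intro vanish_times vanish_contr_pow0 contr_comm u)
    then show ?thesis using that by (simp add: F_def vanish_def N_def)
  qed
  have "cf (ncexp u * f) w = (\<Sum>n\<le>N. cf (u ^ n * f) w / fact n)"
    by (simp add: ncexp_times[OF u] cf_fpsop[OF contr_lmul[OF u], of w N] N_def lmul_pow
        del: of_nat_fact) (simp add: of_nat_fact)
  also have "\<dots> = (\<Sum>n\<le>N. \<Sum>k\<le>n. F k (n - k))"
  proof (rule sum.cong)
    fix n
    have "of_nat (n choose k) / fact n = (1 / (fact k * fact (n - k)) :: complex)" if "k \<le> n" for k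
      using that by (simp add: binomial_fact)
    then have "of_nat (n choose k) * x / fact n = (x / (fact k * fact (n - k)) :: complex)"
      if "k \<le> n" for k x
      using that by (metis (no_types, lifting) mult.commute mult_1 times_divide_eq_left times_divide_eq_right)
    then show "cf (u ^ n * f) w / fact n = (\<Sum>k\<le>n. F k (n - k))"
      by (simp add: power_times_comm sum_divide_distrib F_def)
  qed simp
  also have "\<dots> = (\<Sum>k\<le>N. \<Sum>j\<le>N. F k j)" by (rule triangle_sum[OF F0])
  also have "\<dots> = cf (fpspart N (fps_exp 1) (comm u) f * fpspart N (fps_exp 1) (lmul u) 1) w"
    by (simp add: fpspart_def sum_product lmul_pow F_def mult_ac)
  also have "\<dots> = cf (fpsop (fps_exp 1) (comm u) f * ncexp u) w"
    unfolding ncexp_def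
    by (rule cf_times_approx[symmetric, OF fpspart_approx fpspart_approx])
      (simp_all add: contr_comm contr_lmul u N_def)
  finally show "cf (ncexp u * f) w = cf (fpsop (fps_exp 1) (comm u) f * ncexp u) w" .
qed

text \<open>The Euler derivation, which plays the role of \<open>d/dt\<close> in \<open>log(e\<^bsup>tX\<^esup> e\<^bsup>tY\<^esup>)\<close>.\<close>

definition degop :: "ncs \<Rightarrow> ncs" where "degop f = Ncs (\<lambda>w. of_nat (length w) * cf f w)"

lemma cf_degop [simp]: "cf (degop f) w = of_nat (length w) * cf f w"
  by (simp add: degop_def)

lemma degop_times: "degop (f * g) = degop f * g + f * degop g"
proof (rule ncs_eqI)
  fix w :: "bool list"
  have "of_nat (length w) * (x * y) =
      of_nat (length (take i w)) * x * y + x * (of_nat (length (drop i w)) * y :: complex)"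
    if "i \<le> length w" for i x y
    using that by (simp add: algebra_simps min_def of_nat_diff)
  then show "cf (degop (f * g)) w = cf (degop f * g + f * degop g) w"
    by (simp add: cf_times sum_distrib_left flip: sum.distrib)
qed

lemma vanish_degop_1: "vanish (Suc 0) (degop f)"
  by (simp add: vanish_def)

lemma degop_power:
  "degop (u ^ Suc n) =
    (\<Sum>k\<le>n. of_nat (Suc n choose Suc k) *\<^sub>C ((comm u ^^ k) (degop u) * u ^ (n - k)))"
proof (induction n)
  case (Suc n)
  let ?a = "\<lambda>k. (comm u ^^ k) (degop u)"
  have step: "u * (?a k * u ^ m) = ?a (Suc k) * u ^ m + ?a k * u ^ Suc m" for k m
    by (simp add: comm_def algebra_simps)
  have "degop (u ^ Suc (Suc n)) = degop u * u ^ Suc n + u * degop (u ^ Suc n)"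
    by (simp add: degop_times)
  also have "u * degop (u ^ Suc n) =
      (\<Sum>k\<le>n. of_nat (Suc n choose Suc k) *\<^sub>C (u * (?a k * u ^ (n - k))))"
    by (simp only: Suc sum_distrib_left ncs_scale_times)
  also have "\<dots> = (\<Sum>k\<le>n. of_nat (Suc n choose Suc k) *\<^sub>C (?a (Suc k) * u ^ (Suc n - Suc k)))
      + (\<Sum>k\<le>n. of_nat (Suc n choose Suc k) *\<^sub>C (?a k * u ^ (Suc n - k)))"
    unfolding step cscale_add_right sum.distrib by (simp add: Suc_diff_le)
  also have "(\<Sum>k\<le>n. of_nat (Suc n choose Suc k) *\<^sub>C (?a k * u ^ (Suc n - k))) =
      (\<Sum>k\<le>Suc n. of_nat (Suc n choose Suc k) *\<^sub>C (?a k * u ^ (Suc n - k)))"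
    by (simp add: binomial_eq_0)
  also have "\<dots> = of_nat (Suc n) *\<^sub>C (?a 0 * u ^ Suc n) +
      (\<Sum>k\<le>n. of_nat (Suc n choose Suc (Suc k)) *\<^sub>C (?a (Suc k) * u ^ (Suc n - Suc k)))"
    by (subst sum.atMost_Suc_shift) simp
  finally have "degop (u ^ Suc (Suc n)) =
      (?a 0 * u ^ Suc n + of_nat (Suc n) *\<^sub>C (?a 0 * u ^ Suc n)) +
      ((\<Sum>k\<le>n. of_nat (Suc n choose Suc k) *\<^sub>C (?a (Suc k) * u ^ (Suc n - Suc k))) +
      (\<Sum>k\<le>n. of_nat (Suc n choose Suc (Suc k)) *\<^sub>C (?a (Suc k) * u ^ (Suc n - Suc k))))"
    by simp
  also have "\<dots> = of_nat (Suc (Suc n)) *\<^sub>C (?a 0 * u ^ Suc n) +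
      (\<Sum>k\<le>n. of_nat (Suc (Suc n) choose Suc (Suc k)) *\<^sub>C (?a (Suc k) * u ^ (Suc n - Suc k)))"
    using binomial_Suc_Suc[of "Suc n"]
    by (simp add: cscale_add_left sum.distrib cscale_one cscale_two del: binomial_Suc_Suc)
  also have "\<dots> = (\<Sum>k\<le>Suc n. of_nat (Suc (Suc n) choose Suc k) *\<^sub>C (?a k * u ^ (Suc n - k)))"
    by (subst sum.atMost_Suc_shift) simp
  finally show ?case .
qed (simp add: cscale_one)

text \<open>The series \<open>(e\<^sup>x - 1)/x\<close>.\<close>

definition fps_exp1 :: "complex fps" where "fps_exp1 = Abs_fps (\<lambda>n. 1 / fact (Suc n))"

text \<open>Duhamel's formula for the derivative of an exponential.  The index shift comes from
  \<open>\<Delta>(u\<^bsup>n+1\<^esup>) = \<Sum>\<^sub>i u\<^sup>i \<Delta>(u) u\<^bsup>n-i\<^esup>\<close> after moving all \<open>u\<close> to the right.\<close>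

lemma degop_ncexp:
  assumes u: "vanish (Suc 0) u"
  shows "degop (ncexp u) = fpsop fps_exp1 (comm u) (degop u) * ncexp u"
proof (rule ncs_eqI)
  fix w :: "bool list"
  define N where "N = length w"
  define F where "F k j = cf ((comm u ^^ k) (degop u) * u ^ j) w / (fact (Suc k) * fact j)" for k j
  have F0: "F k j = 0" if "k + j \<ge> N" for k j
  proof -
    have "vanish j (u ^ j)" using vanish_contr_pow0[OF contr_lmul[OF u], of j 1] by (simp add: lmul_pow)
    then have "vanish ((Suc 0 + k) + j) ((comm u ^^ k) (degop u) * u ^ j)"
      by (intro vanish_times vanish_contr_pow contr_comm u vanish_degop_1)
    then show ?thesis using that by (simp add: F_def vanish_def N_def)
  qed
  have "cf (degop (ncexp u)) w = (\<Sum>n\<le>Suc N. cf (degop (u ^ n)) w / fact n)"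
    using cf_fpsop[OF contr_lmul[OF u], of w "Suc N" "fps_exp 1" 1]
    by (simp add: ncexp_def N_def lmul_pow sum_distrib_left del: of_nat_fact sum.atMost_Suc)
      (simp add: of_nat_fact)
  also have "\<dots> = (\<Sum>n\<le>N. cf (degop (u ^ Suc n)) w / fact (Suc n))"
    by (subst sum.atMost_Suc_shift) (simp add: cf_one del: power_Suc)
  also have "\<dots> = (\<Sum>n\<le>N. \<Sum>k\<le>n. F k (n - k))"
  proof (rule sum.cong)
    fix n
    have "of_nat (Suc n choose Suc k) / fact (Suc n) = (1 / (fact (Suc k) * fact (n - k)) :: complex)"
      if "k \<le> n" for k
      using that by (simp add: binomial_fact del: fact_Suc binomial_Suc_Suc)
    then have "of_nat (Suc n choose Suc k) * x / fact (Suc n) = (x / (fact (Suc k) * fact (n - k)) :: complex)"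
      if "k \<le> n" for k x
      using that by (metis (no_types, lifting) mult.commute mult_1 times_divide_eq_left times_divide_eq_right)
    then show "cf (degop (u ^ Suc n)) w / fact (Suc n) = (\<Sum>k\<le>n. F k (n - k))"
      unfolding degop_power F_def
      by (simp add: sum_divide_distrib del: fact_Suc binomial_Suc_Suc cf_degop)
  qed simp
  also have "\<dots> = (\<Sum>k\<le>N. \<Sum>j\<le>N. F k j)" by (rule triangle_sum) (simp add: F0)
  also have "\<dots> = cf (fpspart N fps_exp1 (comm u) (degop u) * fpspart N (fps_exp 1) (lmul u) 1) w"
    by (simp add: fpspart_def sum_product lmul_pow F_def fps_exp1_def mult_ac del: fact_Suc)
  also have "\<dots> = cf (fpsop fps_exp1 (comm u) (degop u) * ncexp u) w"
    unfolding ncexp_def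
    by (rule cf_times_approx[symmetric, OF fpspart_approx fpspart_approx])
      (simp_all add: contr_comm contr_lmul u N_def)
  finally show "cf (degop (ncexp u)) w = cf (fpsop fps_exp1 (comm u) (degop u) * ncexp u) w" .
qed


section \<open>The Baker-Campbell-Hausdorff series\<close>

text \<open>The series \<open>ln(1 + x)/x\<close>.\<close>

definition fps_ln1 :: "complex fps" where "fps_ln1 = Abs_fps (\<lambda>n. (- 1) ^ n / of_nat (Suc n))"

lemma fps_X_ln1: "fps_X * fps_ln1 = fps_ln 1"
  by (rule fps_ext) (simp add: fps_ln1_def fps_ln_nth)

lemma fps_X_exp1: "fps_X * fps_exp1 = fps_exp 1 - 1"
  by (rule fps_ext) (auto simp: fps_exp1_def field_simps not_less_eq Suc_diff_Suc simp flip: fact_Suc)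

text \<open>Substituting \<open>x = e\<^sup>z - 1\<close> in \<open>ln(1 + x)/x\<close> gives \<open>z/(e\<^sup>z - 1)\<close>.\<close>

lemma ln1_exp: "(fps_ln1 oo (fps_exp 1 - 1)) * fps_exp1 = 1"
proof -
  have "fps_X * ((fps_ln1 oo (fps_exp 1 - 1)) * fps_exp1) =
      (fps_exp 1 - 1) * (fps_ln1 oo (fps_exp 1 - 1))"
    by (simp add: mult_ac flip: fps_X_exp1)
  also have "\<dots> = (fps_X * fps_ln1) oo (fps_exp 1 - 1)"
    by (simp add: fps_compose_mult_distrib)
  also have "\<dots> = fps_X * 1"
    by (simp add: fps_X_ln1 fps_ln_fps_exp_inv fps_inv_fps_exp_compose)
  finally show ?thesis by (simp only: mult_cancel_left fps_X_neq_zero simp_thms)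
qed

lemma exp_ln: "fps_exp (1::complex) oo fps_ln 1 = 1 + fps_X"
proof -
  have "(fps_exp (1::complex) - 1) oo fps_ln 1 = fps_X"
    by (simp add: fps_ln_fps_exp_inv fps_inv_fps_exp_compose)
  then show ?thesis by (simp add: fps_compose_sub_distrib algebra_simps)
qed

definition nclog :: "ncs \<Rightarrow> ncs" where "nclog g = fpsop (fps_ln 1) (lmul (g - 1)) 1"

lemma vanish_nclog: "vanish (Suc 0) (g - 1) \<Longrightarrow> vanish (Suc 0) (nclog g)"
  using contr_fpsop[OF contr_lmul, of "g - 1" "fps_ln 1"] unfolding nclog_def contr_def
  using vanish_0 by (metis fps_ln_0)

lemma ncexp_nclog:
  assumes "vanish (Suc 0) (g - 1)"
  shows "ncexp (nclog g) = g"
proof -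
  have "lmul (nclog g) = fpsop (fps_ln 1) (lmul (g - 1))"
    using assms by (auto simp: nclog_def lmul_def[abs_def] fpsop_lmul_times[unfolded lmul_def[abs_def]])
  then have "ncexp (nclog g) = fpsop (1 + fps_X) (lmul (g - 1)) 1"
    by (simp add: ncexp_def fpsop_compose contr_lmul assms exp_ln)
  then show ?thesis
    by (simp add: fpsop_add fpsop_X contr_lmul assms) (simp add: lmul_def)
qed

definition ncvar :: "bool \<Rightarrow> ncs" where "ncvar b = Ncs (\<lambda>w. if w = [b] then 1 else 0)"

lemma vanish_ncvar: "vanish (Suc 0) (ncvar b)" by (simp add: vanish_def ncvar_def)

lemma degop_ncvar: "degop (ncvar b) = ncvar b" by (rule ncs_eqI) (simp add: ncvar_def)

definition bchs :: ncs where "bchs = nclog (ncexp (ncvar True) * ncexp (ncvar False))"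

lemma cf_ncexp_Nil: "cf (ncexp u) [] = 1"
  by (simp add: ncexp_def fpsop_def cf_one)

lemma vanish_exp_prod: "vanish (Suc 0) (ncexp u * ncexp v - 1)"
  by (simp add: vanish_def cf_times cf_ncexp_Nil cf_one)

lemma ncexp_bchs: "ncexp bchs = ncexp (ncvar True) * ncexp (ncvar False)"
  unfolding bchs_def by (rule ncexp_nclog[OF vanish_exp_prod])

lemma vanish_bchs: "vanish (Suc 0) bchs"
  unfolding bchs_def by (rule vanish_nclog[OF vanish_exp_prod])

lemma exp1_comm_self:
  assumes "comm u v = 0"
  shows "fpsop fps_exp1 (comm u) v = v"
proof (rule ncs_eqI)
  fix w
  have "(comm u ^^ n) v = (if n = 0 then v else 0)" for n
    by (induction n) (simp_all add: assms, simp add: comm_def)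
  then have "cf (fpsop fps_exp1 (comm u) v) w = (\<Sum>n\<le>length w. if n = 0 then cf v w else 0)"
    unfolding fpsop_def ncs.sel by (intro sum.cong) (auto simp: fps_exp1_def)
  then show "cf (fpsop fps_exp1 (comm u) v) w = cf v w" by simp
qed

abbreviation expad :: "bool \<Rightarrow> ncs \<Rightarrow> ncs" where "expad b \<equiv> fpsop (fps_exp 1) (comm (ncvar b))"

text \<open>Both sides are conjugation by \<open>e\<^sup>X e\<^sup>Y\<close>.\<close>

lemma exp_comm_bchs: "fpsop (fps_exp 1) (comm bchs) f = expad True (expad False f)"
proof (rule ncexp_right_cancel[OF vanish_bchs])
  have "fpsop (fps_exp 1) (comm bchs) f * ncexp bchs = ncexp bchs * f"
    by (simp add: ncexp_conj vanish_bchs)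
  also have "\<dots> = ncexp (ncvar True) * (expad False f * ncexp (ncvar False))"
    by (simp add: ncexp_bchs mult.assoc ncexp_conj[OF vanish_ncvar, of False f])
  also have "\<dots> = expad True (expad False f) * ncexp bchs"
    by (simp add: ncexp_bchs ncexp_conj[OF vanish_ncvar, of True "expad False f"] flip: mult.assoc)
  finally show "fpsop (fps_exp 1) (comm bchs) f * ncexp bchs =
    expad True (expad False f) * ncexp bchs" .
qed

lemma degop_ncexp_ncvar: "degop (ncexp (ncvar b)) = ncvar b * ncexp (ncvar b)"
  by (simp add: degop_ncexp vanish_ncvar degop_ncvar exp1_comm_self comm_def)

text \<open>Duhamel's formula for \<open>e\<^sup>Z\<close>, compared with the product rule for \<open>e\<^sup>X e\<^sup>Y\<close>.\<close>

lemma bchs_ode: "fpsop fps_exp1 (comm bchs) (degop bchs) = ncvar True + expad True (ncvar False)"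
proof (rule ncexp_right_cancel[OF vanish_bchs])
  have "fpsop fps_exp1 (comm bchs) (degop bchs) * ncexp bchs = degop (ncexp bchs)"
    by (simp add: degop_ncexp vanish_bchs)
  also have "\<dots> = (ncvar True + expad True (ncvar False)) * ncexp bchs"
    by (simp add: ncexp_bchs degop_times degop_ncexp_ncvar ring_distribs mult.assoc)
      (simp add: ncexp_conj[OF vanish_ncvar, of True "ncvar False"] flip: mult.assoc)
  finally show "fpsop fps_exp1 (comm bchs) (degop bchs) * ncexp bchs =
    (ncvar True + expad True (ncvar False)) * ncexp bchs" .
qed

text \<open>Solving \<open>bchs_ode\<close> for \<open>\<Delta>Z\<close>: the inverse of \<open>(e\<^sup>z - 1)/z\<close> is \<open>ln(1 + x)/x\<close> at
  \<open>x = e\<^sup>z - 1\<close>, and \<open>e\<^bsup>ad Z\<^esup>\<close> is known without knowing \<open>Z\<close>.\<close>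

lemma degop_bchs:
  "degop bchs = fpsop fps_ln1 (\<lambda>f. expad True (expad False f) - f)
     (ncvar True + expad True (ncvar False))"
proof -
  have c: "contr (comm bchs)" by (rule contr_comm[OF vanish_bchs])
  have "degop bchs = fpsop ((fps_ln1 oo (fps_exp 1 - 1)) * fps_exp1) (comm bchs) (degop bchs)"
    by (simp add: ln1_exp)
  also have "\<dots> = fpsop fps_ln1 (fpsop (fps_exp 1 - 1) (comm bchs))
      (fpsop fps_exp1 (comm bchs) (degop bchs))"
    by (simp add: fpsop_mult[OF c] fpsop_compose[OF c])
  also have "fpsop (fps_exp 1 - 1) (comm bchs) = (\<lambda>f. expad True (expad False f) - f)"
    by (auto simp: fpsop_diff exp_comm_bchs)
  finally show ?thesis by (simp add: bchs_ode)
qed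


section \<open>Dynkin's formula\<close>

lemma nested_br_Cons: "zs \<noteq> [] \<Longrightarrow> nested_br b (z # zs) = b z (nested_br b zs)"
  by (cases zs) auto

lemma nested_br_replicate:
  "zs \<noteq> [] \<Longrightarrow> nested_br b (replicate r z @ zs) = (b z ^^ r) (nested_br b zs)"
  by (induction r) (auto simp: nested_br_Cons)

abbreviation dynkin_word :: "'g \<Rightarrow> 'g \<Rightarrow> (nat \<times> nat) list \<Rightarrow> 'g list"
  where "dynkin_word x y rs \<equiv> concat (map (\<lambda>(r, s). replicate r x @ replicate s y) rs)"

abbreviation dynkin_degree :: "(nat \<times> nat) list \<Rightarrow> nat"
  where "dynkin_degree rs \<equiv> (\<Sum>(r, s)\<leftarrow>rs. r + s)"

abbreviation dynkin_weight :: "(nat \<times> nat) list \<Rightarrow> complex"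
  where "dynkin_weight rs \<equiv> (\<Prod>(r, s)\<leftarrow>rs. fact r * fact s)"

definition dynkin_index :: "nat \<Rightarrow> (nat \<times> nat) list set"
  where "dynkin_index n = {rs. rs \<noteq> [] \<and> (\<forall>(r, s)\<in>set rs. r + s > 0) \<and> dynkin_degree rs = n}"

definition dynkin_coeff :: "nat \<Rightarrow> (nat \<times> nat) list \<Rightarrow> complex"
  where "dynkin_coeff n rs =
    (- 1) ^ (length rs + 1) / of_nat (length rs) / (of_nat n * dynkin_weight rs)"

lemma bch_dynkin:
  "bch b x y = Sum_any (\<lambda>n. \<Sum>rs\<in>dynkin_index n. dynkin_coeff n rs *\<^sub>C nested_br b (dynkin_word x y rs))"
  unfolding bch_def dynkin_index_def dynkin_coeff_def ..

lemma length_dynkin_word: "length (dynkin_word x y rs) = dynkin_degree rs"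
  by (induction rs) auto

lemma set_dynkin_word: "set (dynkin_word x y rs) \<subseteq> {x, y}"
proof (induction rs)
  case (Cons p rs)
  have "set (replicate n z) \<subseteq> {z}" for n and z :: 'a by (induction n) auto
  then have "set (replicate (fst p) x @ replicate (snd p) y) \<subseteq> {x, y}"
    unfolding set_append by blast
  then show ?case using Cons by (simp add: case_prod_beta)
qed simp

lemma dynkin_word_map: "dynkin_word (f True) (f False) rs = map f (dynkin_word True False rs)"
  by (induction rs) auto

definition ncnest :: "(nat \<times> nat) list \<Rightarrow> ncs"
  where "ncnest rs = nested_br comm (dynkin_word (ncvar True) (ncvar False) rs)"

text \<open>Exponents are bounded by \<open>N\<close> to keep the sums finite; on words of length at most \<open>N\<close> larger
  exponents do not contribute.\<close>

definition pairs :: "nat \<Rightarrow> (nat \<times> nat) set"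
  where "pairs N = {..N} \<times> {..N} - {(0, 0)}"

definition pair_lists :: "nat \<Rightarrow> nat \<Rightarrow> (nat \<times> nat) list set"
  where "pair_lists N k = {rs. set rs \<subseteq> pairs N \<and> length rs = k}"

lemma finite_pairs: "finite (pairs N)" by (simp add: pairs_def)

lemma finite_pair_lists: "finite (pair_lists N k)"
  unfolding pair_lists_def by (rule finite_lists_length_eq[OF finite_pairs])

lemma pair_lists_Suc: "pair_lists N (Suc k) = (\<lambda>(p, rs). p # rs) ` (pairs N \<times> pair_lists N k)"
  unfolding pair_lists_def by (auto simp: length_Suc_conv image_iff)

lemma sum_pair_lists_Suc:
  "sum F (pair_lists N (Suc k)) = (\<Sum>p\<in>pairs N. \<Sum>rs\<in>pair_lists N k. F (p # rs))"
  unfolding pair_lists_Suc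
  by (subst sum.reindex) (auto simp: inj_on_def sum.cartesian_product intro!: sum.cong)

text \<open>The operator \<open>e\<^bsup>ad Z\<^esup> - 1\<close>, whose powers are summed in \<open>degop_bchs\<close>.  Each application of it
  prepends one block \<open>X\<^sup>r Y\<^sup>s\<close> to a nested commutator.\<close>

definition exp_step :: "ncs \<Rightarrow> ncs" where "exp_step f = expad True (expad False f) - f"

lemma exp_step_eq: "exp_step = fpsop (fps_exp 1 - 1) (comm bchs)"
  by (auto simp: exp_step_def fpsop_diff exp_comm_bchs)

lemma contr_exp_step: "contr exp_step"
  unfolding exp_step_eq by (rule contr_fpsop[OF contr_comm[OF vanish_bchs]]) simp

lemma vanish_trans: "vanish n (f - g) \<Longrightarrow> vanish n (g - h) \<Longrightarrow> vanish n (f - h)"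
  using vanish_add[of n "f - g" "g - h"] by simp

lemma nonexp_vanish: "nonexp T \<Longrightarrow> vanish n (f - g) \<Longrightarrow> vanish n (T f - T g)"
  by (metis clinear_diff nonexp_def)

lemma exp_step_approx:
  "vanish (Suc N) (exp_step f -
     (\<Sum>(r, s)\<in>pairs N. (1 / (fact r * fact s)) *\<^sub>C (comm (ncvar True) ^^ r) ((comm (ncvar False) ^^ s) f)))"
proof -
  let ?X = "comm (ncvar True)" and ?Y = "comm (ncvar False)"
  let ?t = "\<lambda>(r, s). (1 / (fact r * fact s)) *\<^sub>C (?X ^^ r) ((?Y ^^ s) f)"
  have lin: "clinear (?X ^^ r)" for r by (rule clinear_funpow[OF clinear_comm])
  have "fpspart N (fps_exp 1) ?X (fpspart N (fps_exp 1) ?Y f) = sum ?t ({..N} \<times> {..N})"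
    by (simp add: fpspart_def clinear_sum[OF lin] clinear_scale[OF lin] cvec.scale_sum_right
        sum.cartesian_product[symmetric])
  also have "\<dots> = sum ?t (pairs N) + f"
    by (simp add: pairs_def sum_diff1 cscale_one)
  finally have part: "fpspart N (fps_exp 1) ?X (fpspart N (fps_exp 1) ?Y f) = sum ?t (pairs N) + f" .
  have "vanish (Suc N) (expad True (expad False f) -
      fpspart N (fps_exp 1) ?X (fpspart N (fps_exp 1) ?Y f))"
    by (rule vanish_trans[OF nonexp_vanish[OF nonexp_fpsop fpspart_approx] fpspart_approx])
      (rule contr_comm[OF vanish_ncvar])+
  then show ?thesis by (simp add: part exp_step_def algebra_simps)
qed

lemma nested_br_comm_replicate:
  "nested_br comm (replicate n u) = (if n = 1 then u else 0)"
proof (induction n)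
  case (Suc n)
  then show ?case by (cases n) (auto simp: nested_br_Cons comm_def)
qed simp

lemma ncnest_single:
  "ncnest [(r, s)] =
    (if s = 0 then if r = 1 then ncvar True else 0
     else if s = 1 then (comm (ncvar True) ^^ r) (ncvar False) else 0)"
proof -
  have "(comm u ^^ n) 0 = 0" for u n
    by (rule clinear_0[OF clinear_funpow[OF clinear_comm]])
  then show ?thesis
    by (auto simp: ncnest_def nested_br_comm_replicate nested_br_replicate)
qed

text \<open>The innermost block: a commutator nested from \<open>X\<^sup>r Y\<^sup>s\<close> ends in \<open>[X, X]\<close> or \<open>[Y, Y]\<close> unless it is
  \<open>X\<close> itself or \<open>s = 1\<close>, so summing over all blocks still gives \<open>X + e\<^bsup>ad X\<^esup> Y\<close>.\<close>

lemma exp_start_approx: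
  assumes "N \<ge> 1"
  shows "vanish (Suc N) (ncvar True + expad True (ncvar False) -
     (\<Sum>(r, s)\<in>pairs N. (1 / (fact r * fact s)) *\<^sub>C ncnest [(r, s)]))"
proof -
  let ?X = "comm (ncvar True)"
  let ?t = "\<lambda>(r, s). (1 / (fact r * fact s)) *\<^sub>C ncnest [(r, s)]"
  \<comment> \<open>The surviving blocks are \<open>X\<close> and \<open>X\<^sup>r Y\<close>.\<close>
  have "sum ?t (pairs N) = sum ?t ({(1, 0)} \<union> {..N} \<times> {1})"
    using assms by (intro sum.mono_neutral_right) (auto simp: pairs_def ncnest_single split: if_splits)
  also have "\<dots> = ?t (1, 0) + sum ?t ({..N} \<times> {1})"
    by (subst sum.union_disjoint) auto
  also have "\<dots> = ncvar True + fpspart N (fps_exp 1) ?X (ncvar False)"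
    by (simp add: ncnest_single cscale_one fpspart_def sum.cartesian_product[symmetric])
  finally show ?thesis
    using fpspart_approx[OF contr_comm[OF vanish_ncvar], of N "fps_exp 1" True "ncvar False"] by simp
qed

lemma ncnest_Cons:
  assumes "dynkin_degree rs > 0"
  shows "ncnest ((r, s) # rs) =
    (comm (ncvar True) ^^ r) ((comm (ncvar False) ^^ s) (ncnest rs))"
proof -
  have "dynkin_word (ncvar True) (ncvar False) rs \<noteq> []"
    using assms length_dynkin_word[of "ncvar True" "ncvar False" rs]
    by (metis less_irrefl list.size(3))
  then show ?thesis by (simp add: ncnest_def nested_br_replicate)
qed

lemma exp_iterate_approx:
  assumes "N \<ge> 1"
  shows "vanish (Suc N) ((exp_step ^^ k) (ncvar True + expad True (ncvar False)) -
     (\<Sum>rs\<in>pair_lists N (Suc k). (1 / dynkin_weight rs) *\<^sub>C ncnest rs))"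
proof (induction k)
  case 0
  have "pair_lists N 0 = {[]}" by (auto simp: pair_lists_def)
  then show ?case
    using exp_start_approx[OF assms] by (simp add: sum_pair_lists_Suc case_prod_beta)
next
  case (Suc k)
  let ?X = "comm (ncvar True)" and ?Y = "comm (ncvar False)"
  let ?f = "\<Sum>rs\<in>pair_lists N (Suc k). (1 / dynkin_weight rs) *\<^sub>C ncnest rs"
  have lin: "clinear (?X ^^ r)" "clinear (?Y ^^ r)" for r
    by (rule clinear_funpow[OF clinear_comm])+
  have pos: "dynkin_degree rs > 0" if "rs \<in> pair_lists N (Suc k)" for rs
    using that by (auto simp: pair_lists_def pairs_def length_Suc_conv)
  have "(\<Sum>(r, s)\<in>pairs N. (1 / (fact r * fact s)) *\<^sub>C (?X ^^ r) ((?Y ^^ s) ?f)) =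
      (\<Sum>p\<in>pairs N. \<Sum>rs\<in>pair_lists N (Suc k). (1 / dynkin_weight (p # rs)) *\<^sub>C ncnest (p # rs))"
    by (intro sum.cong refl)
      (auto simp: clinear_sum[OF lin(1)] clinear_sum[OF lin(2)] clinear_scale[OF lin(1)]
        clinear_scale[OF lin(2)] cvec.scale_sum_right ncnest_Cons pos intro!: sum.cong)
  then have sum: "(\<Sum>(r, s)\<in>pairs N. (1 / (fact r * fact s)) *\<^sub>C (?X ^^ r) ((?Y ^^ s) ?f)) =
      (\<Sum>rs\<in>pair_lists N (Suc (Suc k)). (1 / dynkin_weight rs) *\<^sub>C ncnest rs)"
    by (subst sum_pair_lists_Suc)
  show ?case
    using vanish_trans[OF nonexp_vanish[OF contr_nonexp[OF contr_exp_step] Suc]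
        exp_step_approx[of N ?f]]
    by (simp add: sum)
qed

definition homog :: "nat \<Rightarrow> ncs \<Rightarrow> bool"
  where "homog n f \<longleftrightarrow> (\<forall>w. length w \<noteq> n \<longrightarrow> cf f w = 0)"

lemma homog_times:
  assumes "homog m f" "homog n g"
  shows "homog (m + n) (f * g)"
  unfolding homog_def cf_times
proof (intro allI impI sum.neutral ballI)
  fix w :: "bool list" and i assume "length w \<noteq> m + n" "i \<in> {..length w}"
  then have "length (take i w) \<noteq> m \<or> length (drop i w) \<noteq> n" by auto
  then show "cf f (take i w) * cf g (drop i w) = 0" using assms by (auto simp: homog_def)
qed

lemma homog_comm: "homog m f \<Longrightarrow> homog n g \<Longrightarrow> homog (m + n) (comm f g)"
  using homog_times[of m f n g] homog_times[of n g m f]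
  by (simp add: comm_def homog_def add.commute)

lemma homog_nested:
  "set zs \<subseteq> range ncvar \<Longrightarrow> homog (length zs) (nested_br comm zs)"
proof (induction zs)
  case (Cons z zs)
  then have z: "homog 1 z" by (auto simp: homog_def ncvar_def)
  show ?case
  proof (cases "zs = []")
    case False
    then show ?thesis using homog_comm[OF z] Cons by (simp add: nested_br_Cons)
  qed (use z in simp)
qed (simp add: homog_def)

lemma homog_ncnest: "homog (dynkin_degree rs) (ncnest rs)"
  using homog_nested[of "dynkin_word (ncvar True) (ncvar False) rs"]
  by (auto simp: ncnest_def length_dynkin_word)

lemma length_le_degree: "\<forall>(r, s)\<in>set rs. r + s > 0 \<Longrightarrow> length rs \<le> dynkin_degree rs"
  by (induction rs) auto

lemma member_le_degree: "(r, s) \<in> set rs \<Longrightarrow> r + s \<le> dynkin_degree rs"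
  by (induction rs) auto

text \<open>Every block has positive degree, so \<open>n\<close> bounds the number of blocks as well as the exponents.\<close>

lemma dynkin_index_sub: "dynkin_index n \<subseteq> (\<Union>k\<in>{..n}. pair_lists n (Suc k))"
proof
  fix rs assume "rs \<in> dynkin_index n"
  then have *: "rs \<noteq> []" "\<forall>(r, s)\<in>set rs. r + s > 0" "dynkin_degree rs = n"
    by (auto simp: dynkin_index_def)
  have "length rs \<le> n" using length_le_degree[of rs] * by simp
  moreover have "set rs \<subseteq> pairs n"
  proof (rule subsetI, clarify)
    fix r s assume rs: "(r, s) \<in> set rs"
    then have "r + s > 0" using *(2) by blast
    then show "(r, s) \<in> pairs n"
      using member_le_degree[OF rs] by (simp add: pairs_def *(3))
  qed
  moreover have "length rs = Suc (length rs - 1)" using *(1) by (cases rs) auto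
  ultimately show "rs \<in> (\<Union>k\<in>{..n}. pair_lists n (Suc k))"
    unfolding pair_lists_def by (intro UN_I[of "length rs - 1"]) auto
qed

text \<open>Dynkin's formula.  On words of length \<open>n\<close> the operator \<open>\<Delta>\<close> is multiplication by \<open>n\<close>, which is where the
  factor \<open>1/n\<close> in Dynkin's coefficients comes from.\<close>

lemma cf_bchs:
  "cf bchs w = (\<Sum>rs\<in>dynkin_index (length w). dynkin_coeff (length w) rs * cf (ncnest rs) w)"
proof (cases "length w = 0")
  case True
  have "dynkin_index 0 = {}"
    using dynkin_index_sub[of 0] by (auto simp: pair_lists_def pairs_def length_Suc_conv)
  then show ?thesis using vanish_bchs True by (simp add: vanish_def)
next
  case False
  define n where "n = length w"
  have n: "n \<ge> 1" using False unfolding n_def One_nat_def Suc_le_eq by (rule neq0_conv[THEN iffD1])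
  let ?c = "\<lambda>rs. (- 1) ^ (length rs + 1) / of_nat (length rs) / dynkin_weight rs"
  have "of_nat n * cf bchs w = cf (degop bchs) w" by (simp add: n_def)
  also have "\<dots> = cf (fpsop fps_ln1 exp_step (ncvar True + expad True (ncvar False))) w"
    by (simp add: degop_bchs exp_step_def[abs_def])
  also have "\<dots> = (\<Sum>k\<le>n. fps_nth fps_ln1 k *
      cf ((exp_step ^^ k) (ncvar True + expad True (ncvar False))) w)"
    by (rule cf_fpsop[OF contr_exp_step]) (simp add: n_def)
  also have "\<dots> = (\<Sum>k\<le>n. \<Sum>rs\<in>pair_lists n (Suc k). ?c rs * cf (ncnest rs) w)"
  proof (rule sum.cong)
    fix k
    have "cf ((exp_step ^^ k) (ncvar True + expad True (ncvar False))) w =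
        cf (\<Sum>rs\<in>pair_lists n (Suc k). (1 / dynkin_weight rs) *\<^sub>C ncnest rs) w"
      using exp_iterate_approx[OF n, of k, unfolded vanish_def, rule_format, of w]
      by (simp only: n_def lessI cf_simps(3) right_minus_eq simp_thms)
    moreover have "fps_nth fps_ln1 k * ((1 / dynkin_weight rs) * x) = ?c rs * x"
      if "rs \<in> pair_lists n (Suc k)" for rs x
      using that by (simp add: fps_ln1_def pair_lists_def)
    ultimately show "fps_nth fps_ln1 k * cf ((exp_step ^^ k) (ncvar True + expad True (ncvar False))) w =
        (\<Sum>rs\<in>pair_lists n (Suc k). ?c rs * cf (ncnest rs) w)"
      by (simp only: cf_sum cf_simps sum_distrib_left cong: sum.cong)
  qed simp
  also have "\<dots> = (\<Sum>rs\<in>(\<Union>k\<in>{..n}. pair_lists n (Suc k)). ?c rs * cf (ncnest rs) w)"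
    by (rule sum.UNION_disjoint[symmetric]) (simp_all add: finite_pair_lists, auto simp: pair_lists_def)
  \<comment> \<open>Nested commutators of a degree other than \<open>n\<close> have no coefficient at \<open>w\<close>.\<close>
  also have "\<dots> = (\<Sum>rs\<in>dynkin_index n. ?c rs * cf (ncnest rs) w)"
  proof (rule sum.mono_neutral_right[OF _ dynkin_index_sub])
    show "\<forall>rs\<in>(\<Union>k\<in>{..n}. pair_lists n (Suc k)) - dynkin_index n. ?c rs * cf (ncnest rs) w = 0"
    proof
      fix rs assume "rs \<in> (\<Union>k\<in>{..n}. pair_lists n (Suc k)) - dynkin_index n"
      then have *: "set rs \<subseteq> pairs n" "rs \<noteq> []" "rs \<notin> dynkin_index n"
        by (auto simp: pair_lists_def)
      have "\<forall>(r, s)\<in>set rs. r + s > 0" using *(1) by (auto simp: pairs_def)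
      then have "dynkin_degree rs \<noteq> length w"
        using *(2,3) unfolding dynkin_index_def n_def by blast
      then show "?c rs * cf (ncnest rs) w = 0"
        using homog_ncnest[of rs] by (simp add: homog_def)
    qed
  qed (simp add: finite_pair_lists)
  also have "\<dots> = of_nat n * (\<Sum>rs\<in>dynkin_index n. dynkin_coeff n rs * cf (ncnest rs) w)"
    unfolding sum_distrib_left by (rule sum.cong) (use n in \<open>simp_all add: dynkin_coeff_def\<close>)
  finally show ?thesis using n False by (simp add: n_def)
qed

lemma bchs_approx:
  "vanish N (bchs - (\<Sum>n<N. \<Sum>rs\<in>dynkin_index n. dynkin_coeff n rs *\<^sub>C ncnest rs))"
  unfolding vanish_def
proof (intro allI impI)
  fix w :: "bool list" assume w: "length w < N"
  have "cf (ncnest rs) w = 0" if "rs \<in> dynkin_index n" "n \<noteq> length w" for n rs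
    using that homog_ncnest[of rs] by (auto simp: homog_def dynkin_index_def)
  then have "(\<Sum>rs\<in>dynkin_index n. dynkin_coeff n rs * cf (ncnest rs) w) =
      (if n = length w then cf bchs w else 0)" for n
    using cf_bchs[of w] by simp
  then show "cf (bchs - (\<Sum>n<N. \<Sum>rs\<in>dynkin_index n. dynkin_coeff n rs *\<^sub>C ncnest rs)) w = 0"
    using w by simp
qed


section \<open>Exponentials of nilpotent operators\<close>

definition nexp :: "('v::cvector \<Rightarrow> 'v) \<Rightarrow> 'v \<Rightarrow> 'v"
  where "nexp T v = Sum_any (\<lambda>n. (1 / fact n) *\<^sub>C (T ^^ n) v)"

lemma nexp_eq:
  assumes "\<And>n. n \<ge> N \<Longrightarrow> (T ^^ n) v = 0"
  shows "nexp T v = (\<Sum>n<N. (1 / fact n) *\<^sub>C (T ^^ n) v)"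
  unfolding nexp_def
  by (rule Sum_any.expand_superset) (use assms in \<open>auto, metis not_le cvec.scale_zero_right\<close>)

lemma clinear_Sum_any:
  assumes "clinear F" "finite {n. g n \<noteq> 0}"
  shows "F (Sum_any g) = Sum_any (\<lambda>n. F (g n))"
proof -
  have "Sum_any (\<lambda>n. F (g n)) = (\<Sum>n | g n \<noteq> 0. F (g n))"
    using clinear_0[OF assms(1)] by (intro Sum_any.expand_superset[OF assms(2)]) auto
  then show ?thesis by (simp add: Sum_any.expand_set[of g] clinear_sum[OF assms(1)])
qed

lemma Sum_any_in_subspace: "cvec.subspace S \<Longrightarrow> (\<And>n. g n \<in> S) \<Longrightarrow> Sum_any g \<in> S"
  unfolding Sum_any.expand_set[of g] by (rule cvec.subspace_sum)

lemma nexp_fixed: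
  assumes "clinear T" "T v = 0"
  shows "nexp T v = v"
proof -
  have "(T ^^ n) v = 0" if n: "n \<ge> Suc 0" for n
  proof -
    obtain m where "n = Suc m" using Suc_le_D[OF n] by blast
    then show ?thesis
      using clinear_0[OF clinear_funpow[OF assms(1)], of m] assms(2) by (simp add: funpow_Suc_right del: funpow.simps)
  qed
  then have "nexp T v = (\<Sum>n<Suc 0. (1 / fact n) *\<^sub>C (T ^^ n) v)" by (rule nexp_eq)
  then show ?thesis by (simp add: cscale_one)
qed

text \<open>The exponential of a derivation is multiplicative.\<close>

lemma nexp_leibniz:
  fixes \<beta> :: "'u::cvector \<Rightarrow> 'v::cvector \<Rightarrow> 'w::cvector"
  assumes bil: "cbilinear \<beta>" and lin: "clinear T"
    and der: "\<And>u v. u \<in> S \<Longrightarrow> v \<in> S' \<Longrightarrow> T (\<beta> u v) = \<beta> (P u) v + \<beta> u (Q v)"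
    and inv: "\<And>u. u \<in> S \<Longrightarrow> P u \<in> S" "\<And>v. v \<in> S' \<Longrightarrow> Q v \<in> S'"
    and mem: "u \<in> S" "v \<in> S'"
    and nilP: "\<And>n. n \<ge> N \<Longrightarrow> (P ^^ n) u = 0" and nilQ: "\<And>n. n \<ge> N \<Longrightarrow> (Q ^^ n) v = 0"
  shows "nexp T (\<beta> u v) = \<beta> (nexp P u) (nexp Q v)"
proof -
  have lin1: "clinear (\<lambda>u. \<beta> u v)" and lin2: "clinear (\<beta> u)" for u v
    using bil by (auto simp: cbilinear_def)
  have P: "nexp P u = (\<Sum>n<N. (1 / fact n) *\<^sub>C (P ^^ n) u)" by (rule nexp_eq) (rule nilP)
  have Q: "nexp Q v = (\<Sum>n<N. (1 / fact n) *\<^sub>C (Q ^^ n) v)" by (rule nexp_eq) (rule nilQ)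
  let ?b = "\<lambda>k j. \<beta> ((P ^^ k) u) ((Q ^^ j) v)"
  let ?F = "\<lambda>k j. (1 / (fact k * fact j)) *\<^sub>C ?b k j"
  have b0: "?b k j = 0" if "k \<ge> N \<or> j \<ge> N" for k j
    using that nilP nilQ clinear_0[OF lin1] clinear_0[OF lin2] by auto
  have pw: "(T ^^ n) (\<beta> u v) = (\<Sum>k\<le>n. of_nat (n choose k) *\<^sub>C ?b k (n - k))" for n
    by (rule leibniz[OF bil lin der inv mem])
  \<comment> \<open>In \<open>T\<^sup>n (\<beta> u v)\<close> with \<open>n \<ge> 2 N\<close>, every term contains \<open>N\<close> factors \<open>P\<close> or \<open>N\<close> factors \<open>Q\<close>.\<close>
  have "(T ^^ n) (\<beta> u v) = 0" if "n \<ge> 2 * N" for n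
  proof -
    have "k \<ge> N \<or> n - k \<ge> N" for k using that by linarith
    then show ?thesis unfolding pw by (intro sum.neutral ballI) (simp add: b0)
  qed
  then have "nexp T (\<beta> u v) = (\<Sum>n<2 * N. (1 / fact n) *\<^sub>C (T ^^ n) (\<beta> u v))"
    by (rule nexp_eq)
  also have "\<dots> = (\<Sum>n<2 * N. \<Sum>k\<le>n. ?F k (n - k))"
  proof (intro sum.cong refl)
    fix n
    have "1 / fact n * of_nat (n choose k) = (1 / (fact k * fact (n - k)) :: complex)" if "k \<le> n" for k
      using that by (simp add: binomial_fact)
    then show "(1 / fact n) *\<^sub>C (T ^^ n) (\<beta> u v) = (\<Sum>k\<le>n. ?F k (n - k))"
      unfolding pw cvec.scale_sum_right cscale_cscale by (intro sum.cong refl) simp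
  qed
  also have "\<dots> = (\<Sum>(k, j)\<in>{(k, j). k + j < 2 * N}. ?F k j)"
    by (rule sum.triangle_reindex[symmetric])
  also have "\<dots> = (\<Sum>(k, j)\<in>{..<N} \<times> {..<N}. ?F k j)"
  proof (rule sum.mono_neutral_right)
    show "finite {(k, j). k + j < 2 * N}"
      by (rule finite_subset[of _ "{..<2 * N} \<times> {..<2 * N}"]) auto
    show "\<forall>p\<in>{(k, j). k + j < 2 * N} - {..<N} \<times> {..<N}. (case p of (k, j) \<Rightarrow> ?F k j) = 0"
      by (auto, (metis b0 not_less)+)
  qed auto
  also have "\<dots> = \<beta> (nexp P u) (nexp Q v)"
    unfolding P Q sum.cartesian_product[symmetric]
    by (subst sum.swap) (simp add: clinear_sum[OF lin1] clinear_sum[OF lin2] clinear_scale[OF lin1]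
        clinear_scale[OF lin2] cscale_cscale cvec.scale_sum_right mult.commute)
  finally show ?thesis .
qed

lemma nested_br_hom:
  assumes "F 0 = 0" "\<And>s t. F (b s t) = b' (F s) (F t)"
  shows "F (nested_br b zs) = nested_br b' (map F zs)"
proof (induction zs)
  case (Cons z zs)
  then show ?case by (cases zs) (auto simp: assms)
qed (simp add: assms)

text \<open>The innermost bracket of a nested bracket is zero; adjoining \<open>0\<close> to the letters lets the brackets
  around it be treated alike.\<close>

lemma nested_br_abelian:
  assumes "\<And>s t. s \<in> {0, x, y} \<Longrightarrow> t \<in> {0, x, y} \<Longrightarrow> b s t = 0"
  shows "set zs \<subseteq> {x, y} \<Longrightarrow> length zs \<noteq> 1 \<Longrightarrow> nested_br b zs = 0"
proof (induction zs)
  case (Cons z zs)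
  then have "zs \<noteq> []" by auto
  have "nested_br b zs \<in> {0, x, y}"
  proof (cases "length zs = 1")
    case True
    then obtain z' where "zs = [z']" by (cases zs) auto
    then show ?thesis using Cons.prems by auto
  next
    case False
    then show ?thesis using Cons by auto
  qed
  then have "b z (nested_br b zs) = 0" using Cons.prems assms[of z] by auto
  then show ?case using \<open>zs \<noteq> []\<close> by (simp add: nested_br_Cons)
qed simp

lemma bch_abelian:
  assumes "\<And>s t. s \<in> {0, x, y} \<Longrightarrow> t \<in> {0, x, y} \<Longrightarrow> b s t = 0"
  shows "bch b x y = x + y"
proof -
  have one: "dynkin_index (Suc 0) = {[(1, 0)], [(0, 1)]}"
  proof -
    have "rs \<in> {[(1, 0)], [(0, 1)]}" if "rs \<in> dynkin_index (Suc 0)" for rs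
    proof -
      have "length rs = 1"
        using that length_le_degree[of rs] by (cases rs) (auto simp: dynkin_index_def)
      then obtain r s where "rs = [(r, s)]" by (cases rs) auto
      then show ?thesis using that by (auto simp: dynkin_index_def)
    qed
    moreover have "{[(1, 0)], [(0, 1)]} \<subseteq> dynkin_index (Suc 0)" by (auto simp: dynkin_index_def)
    ultimately show ?thesis by blast
  qed
  have zero: "(\<Sum>rs\<in>dynkin_index n. dynkin_coeff n rs *\<^sub>C nested_br b (dynkin_word x y rs)) = 0"
    if "n \<noteq> 1" for n
  proof (intro sum.neutral ballI)
    fix rs assume "rs \<in> dynkin_index n"
    then have len: "length (dynkin_word x y rs) \<noteq> 1"
      unfolding length_dynkin_word using that by (simp add: dynkin_index_def)
    have "nested_br b (dynkin_word x y rs) = 0"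
    proof (rule nested_br_abelian[OF _ set_dynkin_word len])
      show "b s t = 0" if "s \<in> {0, x, y}" "t \<in> {0, x, y}" for s t using that by (rule assms)
    qed
    then show "dynkin_coeff n rs *\<^sub>C nested_br b (dynkin_word x y rs) = 0"
      by (simp only: cvec.scale_zero_right)
  qed
  have "bch b x y =
      (\<Sum>n\<in>{1}. \<Sum>rs\<in>dynkin_index n. dynkin_coeff n rs *\<^sub>C nested_br b (dynkin_word x y rs))"
    unfolding bch_dynkin
  proof (rule Sum_any.expand_superset)
    show "{n. (\<Sum>rs\<in>dynkin_index n. dynkin_coeff n rs *\<^sub>C nested_br b (dynkin_word x y rs)) \<noteq> 0} \<subseteq> {1}"
      using zero by blast
  qed simp
  then show ?thesis by (simp add: one dynkin_coeff_def cscale_one)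
qed

text \<open>Operators \<open>A\<close>, \<open>B\<close> of which all words of length at least \<open>N\<close> vanish.  They may be substituted for the letters of
  a noncommutative power series, and the substitution is multiplicative.\<close>

locale nilp_ops =
  fixes A B :: "'v::cvector \<Rightarrow> 'v" and N :: nat
  assumes linA: "clinear A" and linB: "clinear B"
    and nil: "length w \<ge> N \<Longrightarrow> foldr (\<lambda>b. if b then A else B) w v = 0"
begin

definition wop :: "bool list \<Rightarrow> 'v \<Rightarrow> 'v"
  where "wop w v = foldr (\<lambda>b. if b then A else B) w v"

lemma wop_Nil [simp]: "wop [] v = v" by (simp add: wop_def)

lemma wop_Cons: "wop (b # w) v = (if b then A else B) (wop w v)" by (simp add: wop_def)

lemma wop_append: "wop (u @ w) v = wop u (wop w v)" by (simp add: wop_def)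

lemma wop_0: "length w \<ge> N \<Longrightarrow> wop w v = 0" by (simp add: wop_def nil)

lemma clinear_wop: "clinear (wop w)"
proof (induction w)
  case Nil
  then show ?case by (simp add: clinear_iff)
next
  case (Cons b w)
  then show ?case using linA linB by (simp add: clinear_iff wop_Cons)
qed

definition ev :: "ncs \<Rightarrow> 'v \<Rightarrow> 'v"
  where "ev f v = (\<Sum>w | length w < N. cf f w *\<^sub>C wop w v)"

lemma finite_words: "finite {w :: bool list. length w < N}"
  using finite_lists_length_le[of "UNIV :: bool set" N] by (rule rev_finite_subset) auto

lemma ev_add: "ev (f + g) v = ev f v + ev g v"
  by (simp add: ev_def cscale_add_left sum.distrib)

lemma ev_diff: "ev (f - g) v = ev f v - ev g v"
  by (simp add: ev_def cvec.scale_left_diff_distrib sum_subtractf)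

lemma ev_scale: "ev (c *\<^sub>C f) v = c *\<^sub>C ev f v"
  by (simp add: ev_def cvec.scale_sum_right)

lemma ev_zero: "ev 0 v = 0"
  by (simp add: ev_def)

lemma ev_sum: "ev (sum F S) v = (\<Sum>i\<in>S. ev (F i) v)"
  by (induction S rule: infinite_finite_induct) (simp_all add: ev_add ev_zero)

lemma ev_vanish: "vanish N f \<Longrightarrow> ev f v = 0"
  by (simp add: ev_def vanish_def)

lemma ev_cong: "vanish N (f - g) \<Longrightarrow> ev f v = ev g v"
  using ev_vanish[of "f - g" v] by (simp add: ev_diff)

lemma ev_monom:
  assumes "\<And>w. cf f w = (if w = u then 1 else 0)"
  shows "ev f v = wop u v"
proof -
  have "ev f v = (\<Sum>w | length w < N. if w = u then wop w v else 0)"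
    unfolding ev_def by (rule sum.cong) (auto simp: assms cscale_one)
  then show ?thesis by (auto simp: finite_words wop_0 not_less)
qed

lemma ev_one: "ev 1 v = v"
  using ev_monom[of 1 "[]"] by (simp add: cf_one)

lemma ev_ncvar: "ev (ncvar b) v = (if b then A else B) v"
  using ev_monom[of "ncvar b" "[b]" v] by (simp add: ncvar_def wop_Cons)

lemma ev_times: "ev (f * g) v = ev f (ev g v)"
proof -
  let ?W = "{w :: bool list. length w < N}"
  let ?t = "\<lambda>(u, w). (cf f u * cf g w) *\<^sub>C wop (u @ w) v"
  have "ev f (ev g v) = (\<Sum>u\<in>?W. \<Sum>w\<in>?W. ?t (u, w))"
    by (simp add: ev_def clinear_sum[OF clinear_wop] clinear_scale[OF clinear_wop]
        cvec.scale_sum_right wop_append)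
  also have "\<dots> = sum ?t (?W \<times> ?W)" by (simp add: sum.cartesian_product)
  also have "\<dots> = sum ?t {(u, w). length (u @ w) < N}"
    by (rule sum.mono_neutral_right)
      (auto simp: finite_words, metis cvec.scale_zero_right length_append not_less wop_0)
  also have "\<dots> = (\<Sum>(w, i)\<in>Sigma ?W (\<lambda>w. {..length w}).
      (cf f (take i w) * cf g (drop i w)) *\<^sub>C wop w v)"
    by (rule sum.reindex_bij_witness[of _ "\<lambda>(w, i). (take i w, drop i w)" "\<lambda>(u, w). (u @ w, length u)"])
      auto
  also have "\<dots> = (\<Sum>w\<in>?W. \<Sum>i\<le>length w. (cf f (take i w) * cf g (drop i w)) *\<^sub>C wop w v)"
    by (rule sum.Sigma[symmetric]) (simp_all add: finite_words)
  also have "\<dots> = ev (f * g) v"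
    by (simp add: ev_def cf_times cvec.scale_sum_left)
  finally show ?thesis ..
qed

lemma ev_power: "ev (u ^ n) v = (ev u ^^ n) v"
  by (induction n) (simp_all add: ev_one ev_times)

text \<open>Identities between exponentials of series thus become identities between exponentials of
  nilpotent operators.\<close>

lemma ev_ncexp:
  assumes "vanish (Suc 0) u"
  shows "ev (ncexp u) v = nexp (ev u) v"
proof -
  have "vanish n (u ^ n)" for n
    using vanish_contr_pow0[OF contr_lmul[OF assms], of n 1] by (simp add: lmul_pow)
  then have "(ev u ^^ n) v = 0" if "n \<ge> Suc N" for n
    using that by (metis Suc_leD ev_power ev_vanish vanish_mono)
  then have "nexp (ev u) v = (\<Sum>n<Suc N. (1 / fact n) *\<^sub>C (ev u ^^ n) v)"
    by (rule nexp_eq)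
  moreover have "ev (ncexp u) v = ev (fpspart N (fps_exp 1) (lmul u) 1) v"
    unfolding ncexp_def
    by (rule ev_cong[OF vanish_mono[OF fpspart_approx[OF contr_lmul[OF assms]]]]) simp
  ultimately show ?thesis
    by (simp add: fpspart_def ev_sum ev_scale lmul_pow ev_power lessThan_Suc_atMost)
qed

lemma nexp_bchs: "nexp (ev bchs) v = nexp A (nexp B v)"
proof -
  have "ev (ncvar True) = A" "ev (ncvar False) = B" by (auto simp: ev_ncvar)
  then have "nexp A (nexp B v) = ev (ncexp (ncvar True) * ncexp (ncvar False)) v"
    by (simp add: ev_times ev_ncexp[OF vanish_ncvar])
  then show ?thesis by (simp add: ev_ncexp[OF vanish_bchs] flip: ncexp_bchs)
qed

lemma nexp_neg: "nexp (\<lambda>v. - A v) (nexp A v) = v"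
proof -
  have *: "vanish (Suc 0) (- ncvar True)" using vanish_ncvar by (simp add: vanish_def)
  have "ev (- ncvar True) = (\<lambda>v. - A v)" "ev (ncvar True) = A"
    using ev_diff[of 0 "ncvar True"] by (auto simp: ev_ncvar ev_zero)
  then have "nexp (\<lambda>v. - A v) (nexp A v) = ev (ncexp (- ncvar True) * ncexp (ncvar True)) v"
    by (simp add: ev_times ev_ncexp[OF vanish_ncvar] ev_ncexp[OF *])
  then show ?thesis by (simp add: ncexp_neg(1)[OF vanish_ncvar] ev_one)
qed

end

text \<open>A nilpotent representation of a nilpotent Lie algebra \<open>G\<close>.  As for \<open>K \<otimes> \<mm>\<^sub>A\<close> inside \<open>K \<otimes> A\<close>, the
  bracket \<open>b\<close> is total and \<open>G\<close> is a set closed under it.\<close>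

locale nilp_rep =
  fixes b :: "'g::cvector \<Rightarrow> 'g \<Rightarrow> 'g" and \<rho> :: "'g \<Rightarrow> 'v::cvector \<Rightarrow> 'v"
    and G :: "'g set" and N :: nat
  assumes lin_rep: "clinear (\<lambda>g. \<rho> g v)" and lin_op: "clinear (\<rho> g)"
    and closed: "g \<in> G \<Longrightarrow> h \<in> G \<Longrightarrow> b g h \<in> G"
    and rep: "g \<in> G \<Longrightarrow> h \<in> G \<Longrightarrow> \<rho> (b g h) v = \<rho> g (\<rho> h v) - \<rho> h (\<rho> g v)"
    and nil_op: "set gs \<subseteq> G \<Longrightarrow> length gs \<ge> N \<Longrightarrow> foldr \<rho> gs v = 0"
    and nil_br: "set gs \<subseteq> G \<Longrightarrow> length gs \<ge> N \<Longrightarrow> nested_br b gs = 0"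
begin

lemma nilp_ops: "x \<in> G \<Longrightarrow> y \<in> G \<Longrightarrow> nilp_ops (\<rho> x) (\<rho> y) N"
proof
  fix w :: "bool list" and v assume G: "x \<in> G" "y \<in> G" and w: "length w \<ge> N"
  let ?gs = "map (\<lambda>b. if b then x else y) w"
  have "foldr (\<lambda>b. if b then \<rho> x else \<rho> y) w v = foldr \<rho> ?gs v"
    by (induction w) simp_all
  also have "\<dots> = 0"
  proof (rule nil_op)
    show "set ?gs \<subseteq> G" using G by auto
    show "length ?gs \<ge> N" using w by simp
  qed
  finally show "foldr (\<lambda>b. if b then \<rho> x else \<rho> y) w v = 0" .
qed (use lin_op[of x] lin_op[of y] in \<open>simp_all add: clinear_iff\<close>)

lemma nested_in: "zs \<noteq> [] \<Longrightarrow> set zs \<subseteq> G \<Longrightarrow> nested_br b zs \<in> G"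
proof (induction zs)
  case (Cons z zs)
  then show ?case by (cases "zs = []") (auto simp: nested_br_Cons closed)
qed simp

lemma bch_terms:
  assumes "x \<in> G" "y \<in> G"
  shows "{n. (\<Sum>rs\<in>dynkin_index n. dynkin_coeff n rs *\<^sub>C nested_br b (dynkin_word x y rs)) \<noteq> 0}
    \<subseteq> {..<N}"
proof -
  have "nested_br b (dynkin_word x y rs) = 0" if "rs \<in> dynkin_index n" "n \<ge> N" for rs n
  proof (rule nil_br)
    show "set (dynkin_word x y rs) \<subseteq> G"
      by (rule subset_trans[OF set_dynkin_word]) (use assms in simp)
    show "length (dynkin_word x y rs) \<ge> N" using that by (simp add: length_dynkin_word dynkin_index_def)
  qed
  then have "(\<Sum>rs\<in>dynkin_index n. dynkin_coeff n rs *\<^sub>C nested_br b (dynkin_word x y rs)) = 0"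
    if "n \<ge> N" for n
    by (intro sum.neutral ballI) (simp only: that cvec.scale_zero_right)
  then show ?thesis unfolding lessThan_def using not_le by blast
qed

lemmas bch_finite = finite_subset[OF bch_terms finite_lessThan]

lemma bch_eq:
  assumes "x \<in> G" "y \<in> G"
  shows "bch b x y = (\<Sum>n<N. \<Sum>rs\<in>dynkin_index n. dynkin_coeff n rs *\<^sub>C nested_br b (dynkin_word x y rs))"
  unfolding bch_dynkin by (rule Sum_any.expand_superset[OF finite_lessThan bch_terms[OF assms]])

lemma bch_in:
  assumes "cvec.subspace G" "x \<in> G" "y \<in> G"
  shows "bch b x y \<in> G"
proof -
  have "nested_br b (dynkin_word x y rs) \<in> G" if "rs \<in> dynkin_index n" for rs n
  proof (cases "dynkin_word x y rs = []")
    case True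
    show ?thesis unfolding True using assms(1) by (simp add: cvec.subspace_0)
  next
    case False
    then show ?thesis
      by (intro nested_in subset_trans[OF set_dynkin_word]) (use assms in simp_all)
  qed
  then show ?thesis
    unfolding bch_eq[OF assms(2,3)]
    by (intro cvec.subspace_sum[OF assms(1)] cvec.subspace_scale[OF assms(1)])
qed

lemma bch_hom:
  assumes "x \<in> G" "y \<in> G" and F: "clinear F" "\<And>s t. F (b s t) = b' (F s) (F t)"
  shows "F (bch b x y) = bch b' (F x) (F y)"
proof -
  have "map F (dynkin_word x y rs) = dynkin_word (F x) (F y) rs" for rs
    by (induction rs) auto
  then have *: "F (nested_br b (dynkin_word x y rs)) = nested_br b' (dynkin_word (F x) (F y) rs)" for rs
    by (simp only: nested_br_hom[of F b b', OF clinear_0[OF F(1)] F(2)])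
  show ?thesis
    unfolding bch_dynkin
    by (subst clinear_Sum_any[OF F(1) bch_finite[OF assms(1,2)]])
      (simp only: clinear_sum[OF F(1)] clinear_scale[OF F(1)] *)
qed

text \<open>Substituting \<open>\<rho>(x)\<close>, \<open>\<rho>(y)\<close> for the letters turns commutators of series into values of \<open>\<rho>\<close> on
  brackets, hence \<open>log(e\<^sup>X e\<^sup>Y)\<close> into \<open>\<rho>(bch(x, y))\<close>.\<close>

theorem nexp_bch:
  assumes "x \<in> G" "y \<in> G"
  shows "nexp (\<rho> (bch b x y)) v = nexp (\<rho> x) (nexp (\<rho> y) v)"
proof -
  interpret nilp_ops "\<rho> x" "\<rho> y" N using assms by (rule nilp_ops)
  have nested: "ev (nested_br comm (map (\<lambda>b. ncvar b) zs)) v =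
      \<rho> (nested_br b (map (\<lambda>b. if b then x else y) zs)) v" for zs v
  proof (induction zs arbitrary: v)
    case Nil
    show ?case using clinear_0[OF lin_rep] by (simp add: ev_zero)
  next
    case (Cons z zs)
    have "nested_br b (map (\<lambda>b. if b then x else y) zs) \<in> G" if "zs \<noteq> []"
      using that assms by (intro nested_in) auto
    then show ?case
      using Cons assms
      by (cases "zs = []") (auto simp: nested_br_Cons comm_def ev_diff ev_times ev_ncvar rep)
  qed
  have "ev (ncnest rs) v = \<rho> (nested_br b (dynkin_word x y rs)) v" for rs v
  proof -
    have "dynkin_word x y rs = map (\<lambda>b. if b then x else y) (dynkin_word True False rs)"
      using dynkin_word_map[of "\<lambda>b. if b then x else y" rs] by (simp only: if_True if_False)
    then show ?thesis
      using nested[of "dynkin_word True False rs" v] unfolding ncnest_def dynkin_word_map[of ncvar]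
      by (simp only:)
  qed
  then have "ev bchs v = \<rho> (bch b x y) v" for v
    unfolding ev_cong[OF bchs_approx] bch_eq[OF assms]
    by (simp add: ev_sum ev_scale clinear_sum[OF lin_rep] clinear_scale[OF lin_rep])
  then have "ev bchs = \<rho> (bch b x y)" by auto
  then show ?thesis using nexp_bchs[of v] by simp
qed

lemma nexp_inverse: "x \<in> G \<Longrightarrow> nexp (\<rho> (- x)) (nexp (\<rho> x) v) = v"
proof -
  assume "x \<in> G"
  then interpret nilp_ops "\<rho> x" "\<rho> x" N by (intro nilp_ops)
  have "\<rho> (- x) = (\<lambda>v. - \<rho> x v)"
  proof
    fix v
    show "\<rho> (- x) v = - \<rho> x v"
      using clinear_diff[OF lin_rep[of v], of 0 x] clinear_0[OF lin_rep[of v]] by simp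
  qed
  then show ?thesis using nexp_neg by simp
qed

end


section \<open>Local Artinian algebras\<close>

lemma ideal_closed:
  assumes "is_ideal I"
  shows "0 \<in> I" "x \<in> I \<Longrightarrow> y \<in> I \<Longrightarrow> x + y \<in> I" "x \<in> I \<Longrightarrow> r * x \<in> I" "x \<in> I \<Longrightarrow> x * r \<in> I"
  using assms by (auto simp: is_ideal_def mult.commute)

lemma scale_one_times: "(c *\<^sub>C 1) * x = c *\<^sub>C (x :: 'a::calgebra)"
  by (simp add: cscale_mult_left)

lemma times_scale: "x * (c *\<^sub>C y) = c *\<^sub>C (x * y :: 'a::calgebra)"
  by (metis cscale_mult_left mult.commute)

lemma ideal_subspace: "is_ideal (I :: 'a::calgebra set) \<Longrightarrow> cvec.subspace I"
  unfolding cvec.subspace_def using ideal_closed[of I] scale_one_times by metis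

lemma exists_maximal_ideal:
  assumes J: "is_ideal J" and one: "1 \<notin> J"
  shows "\<exists>I. is_maximal_ideal I \<and> J \<subseteq> I"
proof -
  let ?A = "{I. is_ideal I \<and> J \<subseteq> I \<and> 1 \<notin> I}"
  have "\<exists>I\<in>?A. \<forall>X\<in>?A. I \<subseteq> X \<longrightarrow> X = I"
  proof (rule subset_Zorn_nonempty)
    show "?A \<noteq> {}" using assms by auto
    fix C assume C: "C \<noteq> {}" "subset.chain ?A C"
    have ideals: "I \<in> ?A" if "I \<in> C" for I using C(2) that by (auto simp: subset.chain_def)
    have chain: "I \<subseteq> I' \<or> I' \<subseteq> I" if "I \<in> C" "I' \<in> C" for I I'
      using C(2) that by (auto simp: subset.chain_def)
    have "is_ideal (\<Union>C)"
      unfolding is_ideal_def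
    proof (intro conjI ballI allI)
      show "0 \<in> \<Union>C" using C(1) ideals by (auto dest: ideal_closed(1))
      fix x assume "x \<in> \<Union>C"
      then obtain I where I: "I \<in> C" "x \<in> I" by auto
      then show "r * x \<in> \<Union>C" for r using ideals[OF I(1)] by (auto dest: ideal_closed(3))
      fix y assume "y \<in> \<Union>C"
      then obtain I' where I': "I' \<in> C" "y \<in> I'" by auto
      show "x + y \<in> \<Union>C"
        using chain[OF I(1) I'(1)] ideals[OF I(1)] ideals[OF I'(1)] I I'
        by (auto dest: ideal_closed(2))
    qed
    then show "\<Union>C \<in> ?A" using C(1) ideals by auto
  qed
  then obtain I where I: "is_ideal I" "J \<subseteq> I" "1 \<notin> I"
    and max: "\<And>X. is_ideal X \<Longrightarrow> J \<subseteq> X \<Longrightarrow> 1 \<notin> X \<Longrightarrow> I \<subseteq> X \<Longrightarrow> X = I"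
    by auto
  have "X = I \<or> X = UNIV" if X: "is_ideal X" "I \<subseteq> X" for X
  proof (cases "1 \<in> X")
    case True
    then have "x \<in> X" for x using ideal_closed(3)[OF X(1), of 1 x] by simp
    then show ?thesis by auto
  qed (use max X I in auto)
  then show ?thesis using I by (auto simp: is_maximal_ideal_def)
qed

primrec max_ideal_power :: "nat \<Rightarrow> 'a::calgebra set" where
  "max_ideal_power 0 = UNIV"
| "max_ideal_power (Suc n) = cvec.span {x * y | x y. x \<in> max_ideal \<and> y \<in> max_ideal_power n}"

context
  assumes art: "art TYPE('a::calgebra)"
begin

lemma maximal_max_ideal: "is_maximal_ideal (max_ideal :: 'a set)"
  using art theI'[of "is_maximal_ideal :: 'a set \<Rightarrow> bool"] unfolding art_def max_ideal_def by blast

lemma maximal_unique: "is_maximal_ideal I \<Longrightarrow> I = (max_ideal :: 'a set)"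
  using art maximal_max_ideal unfolding art_def by blast

lemma ideal_max_ideal: "is_ideal (max_ideal :: 'a set)"
  using maximal_max_ideal by (simp add: is_maximal_ideal_def)

lemma one_notin_max_ideal: "(1::'a) \<notin> max_ideal"
proof
  assume "(1::'a) \<in> max_ideal"
  then have "x \<in> max_ideal" for x :: 'a using ideal_closed(3)[OF ideal_max_ideal, of 1 x] by simp
  then show False using maximal_max_ideal by (auto simp: is_maximal_ideal_def)
qed

lemma subspace_max_ideal: "cvec.subspace (max_ideal :: 'a set)"
  by (rule ideal_subspace[OF ideal_max_ideal])

lemma unit_outside:
  assumes "(a::'a) \<notin> max_ideal"
  shows "\<exists>b. a * b = 1"
proof (rule ccontr)
  assume no: "\<nexists>b. a * b = 1"
  let ?J = "range (\<lambda>r. r * a)"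
  have "is_ideal ?J"
    unfolding is_ideal_def
  proof (intro conjI ballI allI)
    show "0 \<in> ?J" by (rule range_eqI[of _ _ 0]) simp
    fix x assume "x \<in> ?J"
    then obtain p where p: "x = p * a" by auto
    show "r * x \<in> ?J" for r unfolding p by (rule range_eqI[of _ _ "r * p"]) (simp add: mult.assoc)
    fix y assume "y \<in> ?J"
    then obtain q where q: "y = q * a" by auto
    show "x + y \<in> ?J" unfolding p q by (rule range_eqI[of _ _ "p + q"]) (simp add: ring_distribs)
  qed
  moreover have "1 \<notin> ?J" using no by (auto simp: mult.commute)
  ultimately obtain I where I: "is_maximal_ideal I" "?J \<subseteq> I" using exists_maximal_ideal by blast
  have "1 * a \<in> I" using I(2) by blast
  then show False using maximal_unique[OF I(1)] assms by simp
qed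

lemma residue: "\<exists>c. (a::'a) - c *\<^sub>C 1 \<in> max_ideal"
  using art by (simp add: art_def)

lemma scalar_notin_max_ideal: "c \<noteq> 0 \<Longrightarrow> c *\<^sub>C (1::'a) \<notin> max_ideal"
proof
  assume "c \<noteq> 0" "c *\<^sub>C (1::'a) \<in> max_ideal"
  then have "(1 / c) *\<^sub>C c *\<^sub>C (1::'a) \<in> max_ideal" using cvec.subspace_scale[OF subspace_max_ideal] by blast
  then show False using \<open>c \<noteq> 0\<close> one_notin_max_ideal by (simp add: cscale_one)
qed

lemma ideal_max_ideal_power: "is_ideal (max_ideal_power n :: 'a set)"
proof (induction n)
  case (Suc n)
  let ?S = "{x * y | x y :: 'a. x \<in> max_ideal \<and> y \<in> max_ideal_power n}"
  have "cvec.span ?S \<subseteq> {z. r * z \<in> cvec.span ?S}" for r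
  proof (rule cvec.span_minimal)
    have "r * (x * y) \<in> ?S" if "x \<in> max_ideal" "y \<in> max_ideal_power n" for x y
      using that ideal_closed(3)[OF Suc, of y r] mult.left_commute[of r x y] by blast
    then show "?S \<subseteq> {z. r * z \<in> cvec.span ?S}" using cvec.span_base by blast
    show "cvec.subspace {z. r * z \<in> cvec.span ?S}"
      by (auto simp: cvec.subspace_def cvec.span_zero ring_distribs times_scale
          intro: cvec.span_add cvec.span_scale)
  qed
  then show ?case by (auto simp: is_ideal_def cvec.span_zero intro: cvec.span_add)
qed (simp add: is_ideal_def)

lemma max_ideal_power_dec: "max_ideal_power (Suc n) \<subseteq> (max_ideal_power n :: 'a set)"
  unfolding max_ideal_power.simps
  by (rule cvec.span_minimal) (auto intro: ideal_closed[OF ideal_max_ideal_power]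
      ideal_subspace ideal_max_ideal_power)

lemma max_ideal_power_1: "max_ideal \<subseteq> (max_ideal_power (Suc 0) :: 'a set)"
proof
  fix x :: 'a assume "x \<in> max_ideal"
  then have "x * 1 \<in> max_ideal_power (Suc 0)" unfolding max_ideal_power.simps
    by (intro cvec.span_base) blast
  then show "x \<in> max_ideal_power (Suc 0)" by simp
qed

lemma wf_ideals: "wf {(I, J :: 'a set). is_ideal I \<and> is_ideal J \<and> I \<subset> J}"
  unfolding wf_iff_no_infinite_down_chain
proof
  assume "\<exists>f. \<forall>i. (f (Suc i), f i) \<in> {(I, J :: 'a set). is_ideal I \<and> is_ideal J \<and> I \<subset> J}"
  then obtain f :: "nat \<Rightarrow> 'a set"
    where "\<forall>i. (f (Suc i), f i) \<in> {(I, J). is_ideal I \<and> is_ideal J \<and> I \<subset> J}" by blast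
  then have f: "is_ideal (f i)" "f (Suc i) \<subset> f i" for i by auto
  have dcc: "\<forall>J::nat \<Rightarrow> 'a set. (\<forall>n. is_ideal (J n)) \<and> (\<forall>n. J (Suc n) \<subseteq> J n)
        \<longrightarrow> (\<exists>N. \<forall>n\<ge>N. J n = J N)"
    using art by (simp add: art_def)
  obtain N where "\<forall>n\<ge>N. f n = f N" using dcc[rule_format, of f] f by blast
  then have "f (Suc N) = f N" by (metis le_SucI order_refl)
  then show False using f(2)[of N] by simp
qed

text \<open>The powers of \<open>\<mm>\<close> stabilise at an ideal \<open>I\<close> with \<open>\<mm>I = I\<close>.  If \<open>I \<noteq> 0\<close>, a minimal ideal among those
  not annihilated by \<open>I\<close> is of the form \<open>a\<mm>\<close> with \<open>a\<close> in it, so \<open>a = az\<close> with \<open>z \<in> \<mm>\<close>; as \<open>1 - z\<close> is a unit,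
  \<open>a = 0\<close>.\<close>

lemma max_ideal_nilpotent: "\<exists>N. max_ideal_power N = {0 :: 'a}"
proof -
  have dcc: "\<forall>J::nat \<Rightarrow> 'a set. (\<forall>n. is_ideal (J n)) \<and> (\<forall>n. J (Suc n) \<subseteq> J n)
        \<longrightarrow> (\<exists>N. \<forall>n\<ge>N. J n = J N)"
    using art by (simp add: art_def)
  obtain N where N: "\<forall>n\<ge>N. max_ideal_power n = (max_ideal_power N :: 'a set)"
    using dcc[rule_format, of max_ideal_power] ideal_max_ideal_power max_ideal_power_dec by blast
  have stable: "max_ideal_power (Suc N) = (max_ideal_power N :: 'a set)"
    by (rule N[rule_format, OF le_SucI[OF order_refl]])
  define I where "I = (max_ideal_power N :: 'a set)"
  have "I = {0}"
  proof (rule ccontr)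
    assume "I \<noteq> {0}"
    then obtain y0 where "y0 \<in> I" "y0 \<noteq> 0"
      using ideal_closed(1)[OF ideal_max_ideal_power] unfolding I_def by blast
    let ?F = "{J :: 'a set. is_ideal J \<and> (\<exists>a\<in>J. \<exists>y\<in>I. a * y \<noteq> 0)}"
    have "is_ideal (UNIV :: 'a set)" by (simp add: is_ideal_def)
    moreover have "1 * y0 \<noteq> 0" using \<open>y0 \<noteq> 0\<close> by simp
    ultimately have "UNIV \<in> ?F" using \<open>y0 \<in> I\<close> by blast
    then obtain J where J: "J \<in> ?F"
      and min: "\<And>J'. (J', J) \<in> {(I, J :: 'a set). is_ideal I \<and> is_ideal J \<and> I \<subset> J} \<Longrightarrow> J' \<notin> ?F"
      by (rule wfE_min[OF wf_ideals]) blast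
    from J obtain a y where a: "a \<in> J" "y \<in> I" "a * y \<noteq> 0" and idJ: "is_ideal J" by auto
    let ?J = "(\<lambda>z. a * z) ` max_ideal"
    have id: "is_ideal ?J"
      unfolding is_ideal_def
    proof (intro conjI ballI allI)
      show "0 \<in> ?J" using ideal_closed(1)[OF ideal_max_ideal] by (intro image_eqI[of _ _ 0]) auto
      fix p assume "p \<in> ?J"
      then obtain z where z: "p = a * z" "z \<in> max_ideal" by auto
      show "r * p \<in> ?J" for r
        using ideal_closed(3)[OF ideal_max_ideal z(2)] by (intro image_eqI[of _ _ "r * z"]) (auto simp: z mult_ac)
      fix q assume "q \<in> ?J"
      then obtain z' where z': "q = a * z'" "z' \<in> max_ideal" by auto
      show "p + q \<in> ?J"
        using ideal_closed(2)[OF ideal_max_ideal z(2) z'(2)]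
        by (intro image_eqI[of _ _ "z + z'"]) (auto simp: z z' ring_distribs)
    qed
    \<comment> \<open>If \<open>a\<mm>\<close> annihilated \<open>I\<close>, then \<open>a\<close> would annihilate \<open>\<mm>I = I\<close>.\<close>
    have "\<exists>b\<in>?J. \<exists>y\<in>I. b * y \<noteq> 0"
    proof (rule ccontr)
      assume "\<not> (\<exists>b\<in>?J. \<exists>y\<in>I. b * y \<noteq> 0)"
      then have zero: "a * (x * y) = 0" if "x \<in> max_ideal" "y \<in> I" for x y
        using that by (auto simp: mult.assoc)
      have "cvec.span {x * y | x y. x \<in> max_ideal \<and> y \<in> I} \<subseteq> {z. a * z = 0}"
        by (rule cvec.span_minimal)
          (use zero in \<open>auto simp: cvec.subspace_def ring_distribs times_scale\<close>)
      then have "I \<subseteq> {z. a * z = 0}" using stable unfolding I_def by simp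
      then show False using a by auto
    qed
    then have "?J \<in> ?F" using id by blast
    moreover have "?J \<subseteq> J" using a(1) ideal_closed(4)[OF idJ] by blast
    ultimately have "?J = J" using min[of ?J] id idJ by blast
    then obtain z where z: "z \<in> max_ideal" "a = a * z" using a(1) by blast
    have "1 - z \<notin> max_ideal"
      using ideal_closed(2)[OF ideal_max_ideal, of "1 - z" z] z(1) one_notin_max_ideal by auto
    then obtain b where "(1 - z) * b = 1" using unit_outside by blast
    then have "a = a * (1 - z) * b" by (simp add: mult.assoc)
    also have "a * (1 - z) = 0" using z(2) by (simp add: ring_distribs)
    finally show False using a(3) by simp
  qed
  then show ?thesis by (auto simp: I_def)
qed

end

text \<open>If \<open>\<phi>(a)\<close> had a nonzero residue \<open>c\<close>, then the unit \<open>a - c\<close> would be mapped into the maximal ideal.\<close>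

lemma calg_hom_max_ideal:
  fixes \<phi> :: "'a::calgebra \<Rightarrow> 'b::calgebra"
  assumes "art TYPE('a)" "art TYPE('b)" "calg_hom \<phi>" "a \<in> max_ideal"
  shows "\<phi> a \<in> max_ideal"
proof (rule ccontr)
  have hom: "clinear \<phi>" "\<phi> 1 = 1" "\<And>x y. \<phi> (x * y) = \<phi> x * \<phi> y"
    using assms(3) by (auto simp: calg_hom_def)
  assume no: "\<phi> a \<notin> max_ideal"
  obtain c where c: "\<phi> a - c *\<^sub>C 1 \<in> max_ideal" using residue[OF assms(2)] by blast
  then have "c \<noteq> 0" using no by auto
  have "a - c *\<^sub>C 1 \<notin> max_ideal"
  proof
    assume "a - c *\<^sub>C 1 \<in> max_ideal"
    then have "a - (a - c *\<^sub>C 1) \<in> max_ideal"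
      using assms(4) cvec.subspace_diff[OF subspace_max_ideal[OF assms(1)]] by blast
    then show False using scalar_notin_max_ideal[OF assms(1) \<open>c \<noteq> 0\<close>] by simp
  qed
  then obtain b where "(a - c *\<^sub>C 1) * b = 1" using unit_outside[OF assms(1)] by blast
  then have "\<phi> (a - c *\<^sub>C 1) * \<phi> b = 1" using hom by metis
  then have "(\<phi> a - c *\<^sub>C 1) * \<phi> b = 1"
    by (simp add: clinear_diff[OF hom(1)] clinear_scale[OF hom(1)] hom(2))
  then have "1 \<in> (max_ideal :: 'b set)"
    using ideal_closed(4)[OF ideal_max_ideal[OF assms(2)] c, of "\<phi> b"] by simp
  then show False using one_notin_max_ideal[OF assms(2)] by simp
qed

lemma calg_hom_max_ideal_onto:
  fixes \<phi> :: "'a::calgebra \<Rightarrow> 'b::calgebra"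
  assumes "art TYPE('a)" "art TYPE('b)" "calg_hom \<phi>" "surj \<phi>" "b \<in> max_ideal"
  shows "\<exists>a\<in>max_ideal. \<phi> a = b"
proof -
  have hom: "clinear \<phi>" "\<phi> 1 = 1" using assms(3) by (auto simp: calg_hom_def)
  obtain a where a: "\<phi> a = b" using assms(4) by (metis surjD)
  obtain c where c: "a - c *\<^sub>C 1 \<in> max_ideal" using residue[OF assms(1)] by blast
  then have "b - c *\<^sub>C 1 \<in> max_ideal"
    using calg_hom_max_ideal[OF assms(1-3) c]
    by (simp add: clinear_diff[OF hom(1)] clinear_scale[OF hom(1)] hom(2) a)
  then have "b - (b - c *\<^sub>C 1) \<in> max_ideal"
    using assms(5) cvec.subspace_diff[OF subspace_max_ideal[OF assms(2)]] by blast
  then have "c = 0" using scalar_notin_max_ideal[OF assms(2), of c] by auto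
  then show ?thesis using a c by auto
qed

text \<open>The generator \<open>\<iota> 1\<close> of the kernel lies in \<open>\<mm>\<^sub>A\<close>: otherwise it would be a unit mapped to \<open>0\<close>.\<close>

lemma small_extension_socle:
  fixes \<iota> :: "complex \<Rightarrow> 'a::calgebra" and \<alpha> :: "'a \<Rightarrow> 'b::calgebra"
  assumes "art TYPE('a)" "art TYPE('b)" "small_extension \<iota> \<alpha>"
  shows "\<iota> 1 \<in> max_ideal" "a \<in> max_ideal \<Longrightarrow> a * \<iota> 1 = 0" "\<alpha> (\<iota> 1) = 0" "\<iota> z = z *\<^sub>C \<iota> 1" "\<iota> 1 \<noteq> 0"
    "\<alpha> a = 0 \<Longrightarrow> \<exists>z. a = z *\<^sub>C \<iota> 1"
proof -
  have hom: "\<alpha> 1 = 1" "\<And>x y. \<alpha> (x * y) = \<alpha> x * \<alpha> y" and lin: "clinear \<iota>" and inj: "inj \<iota>"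
    and ker: "range \<iota> = {a. \<alpha> a = 0}" and ann: "\<And>a k. a \<in> max_ideal \<Longrightarrow> \<alpha> k = 0 \<Longrightarrow> a * k = 0"
    using assms(3) by (auto simp: small_extension_def calg_hom_def)
  show \<alpha>\<iota>: "\<alpha> (\<iota> 1) = 0" using ker by auto
  show "a \<in> max_ideal \<Longrightarrow> a * \<iota> 1 = 0" by (rule ann[OF _ \<alpha>\<iota>])
  show sc: "\<iota> z = z *\<^sub>C \<iota> 1" for z using clinear_scale[OF lin, of z 1] by (simp add: cscale_complex_def)
  show "\<iota> 1 \<noteq> 0" using inj clinear_0[OF lin] by (metis inj_eq zero_neq_one)
  show "\<alpha> a = 0 \<Longrightarrow> \<exists>z. a = z *\<^sub>C \<iota> 1" using ker sc by (metis (mono_tags) mem_Collect_eq rangeE)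
  show "\<iota> 1 \<in> max_ideal"
  proof (rule ccontr)
    assume "\<iota> 1 \<notin> max_ideal"
    then obtain b where "\<iota> 1 * b = 1" using unit_outside[OF assms(1)] by blast
    then have "\<alpha> 1 = \<alpha> (\<iota> 1) * \<alpha> b" by (metis hom(2))
    then have "(1::'b) = 0" using \<alpha>\<iota> hom by simp
    then show False
      using one_notin_max_ideal[OF assms(2)] ideal_closed(1)[OF ideal_max_ideal[OF assms(2)]] by simp
  qed
qed

text \<open>Everything outside \<open>V\<close> is a unit of \<open>\<complex> \<oplus> V\<close>.\<close>

lemma max_ideal_triv: "(max_ideal :: 'v::cvector triv set) = {x. sca x = 0}"
proof -
  let ?M = "{x :: 'v triv. sca x = 0}"
  have M: "is_ideal ?M" by (auto simp: is_ideal_def zero_triv_def plus_triv_def times_triv_def)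
  have proper: "I \<subseteq> ?M" if I: "is_ideal I" "I \<noteq> UNIV" for I :: "'v triv set"
  proof
    fix x assume x: "x \<in> I"
    show "x \<in> ?M"
    proof (rule ccontr)
      assume "x \<notin> ?M"
      then have "sca x \<noteq> 0" by simp
      then have "Triv (1 / sca x) (- (1 / (sca x * sca x)) *\<^sub>C inf x) * x = 1"
        by (simp add: times_triv_def one_triv_def cscale_cscale cscale_one flip: cscale_add_left)
      then have "1 \<in> I" using ideal_closed(3)[OF I(1) x] by metis
      then have "y \<in> I" for y using ideal_closed(3)[OF I(1), of 1 y] by simp
      then show False using I(2) by auto
    qed
  qed
  have "1 \<notin> ?M" by (simp add: one_triv_def)
  then have neq: "?M \<noteq> UNIV" by blast
  have "is_maximal_ideal ?M" using M neq proper by (auto simp: is_maximal_ideal_def)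
  moreover have "I = ?M" if "is_maximal_ideal I" for I :: "'v triv set"
    using that proper[of I] M neq unfolding is_maximal_ideal_def by blast
  ultimately show ?thesis unfolding max_ideal_def by (rule the_equality)
qed


section \<open>Linear algebra of tensor products\<close>

lemma ptensor_simps:
  "(v + v') \<otimes> a = v \<otimes> a + v' \<otimes> a" "v \<otimes> (a + a') = v \<otimes> a + v \<otimes> a'"
  "(c *\<^sub>C v) \<otimes> a = c *\<^sub>C (v \<otimes> a)" "v \<otimes> (c *\<^sub>C a) = c *\<^sub>C (v \<otimes> a)"
  using cbilinear_ptensor unfolding cbilinear_def clinear_iff by blast+

lemma clinear_ptensor: "clinear (\<lambda>v. v \<otimes> a)" "clinear (\<lambda>a. v \<otimes> a)"
  by (simp_all add: clinear_iff ptensor_simps)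

lemma ptensor_diff: "(v - v') \<otimes> a = v \<otimes> a - v' \<otimes> a" "v \<otimes> (a - a') = v \<otimes> a - v \<otimes> a'"
  using clinear_diff[OF clinear_ptensor(1)] clinear_diff[OF clinear_ptensor(2)] by auto

lemma ptensor_minus: "(- v) \<otimes> a = - (v \<otimes> a)"
  using ptensor_diff(1)[of 0 v a] clinear_0[OF clinear_ptensor(1)[of a]] by simp

lemma ptensor_zero [simp]: "0 \<otimes> a = 0" "v \<otimes> 0 = 0"
  using clinear_0[OF clinear_ptensor(1)] clinear_0[OF clinear_ptensor(2)] by auto

lemma clinear_compose: "clinear f \<Longrightarrow> clinear g \<Longrightarrow> clinear (\<lambda>x. f (g x))"
  by (simp add: clinear_iff)

lemma clinear_plus: "clinear f \<Longrightarrow> clinear g \<Longrightarrow> clinear (\<lambda>x. f x + g x)"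
  by (simp add: clinear_iff cscale_add_right)

lemma clinear_minus: "clinear f \<Longrightarrow> clinear g \<Longrightarrow> clinear (\<lambda>x. f x - g x)"
  by (simp add: clinear_iff cvec.scale_right_diff_distrib)

lemma clinear_scaled: "clinear f \<Longrightarrow> clinear (\<lambda>x. c *\<^sub>C f x)"
  by (simp add: clinear_iff cscale_add_right cvec.scale_left_commute)

lemma clinear_neg: "clinear f \<Longrightarrow> clinear (\<lambda>x. - f x)"
  by (simp add: clinear_iff cvec.scale_minus_right)

lemma clinear_uminus: "clinear f \<Longrightarrow> f (- x) = - f x"
  using clinear_diff[of f 0 x] clinear_0[of f] by simp

lemma clinear_id: "clinear (\<lambda>x. x)"
  by (simp add: clinear_iff)

lemma clinear_zero: "clinear (\<lambda>x. 0)"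
  by (simp add: clinear_iff)

text \<open>The subspace \<open>V \<otimes> I\<close> of the tensor product; \<open>tgr K i\<close> is the case \<open>V = K\<^sup>i\<close>, \<open>I = \<mm>\<^sub>A\<close>.\<close>

definition tspan :: "'v::cvector set \<Rightarrow> 'a::cvector set \<Rightarrow> ('v, 'a) tensor set"
  where "tspan V I = cvec.span {v \<otimes> a | v a. v \<in> V \<and> a \<in> I}"

lemma subspace_tspan: "cvec.subspace (tspan V I)"
  by (simp add: tspan_def)

lemma tspan_pure: "v \<in> V \<Longrightarrow> a \<in> I \<Longrightarrow> v \<otimes> a \<in> tspan V I"
  unfolding tspan_def by (rule cvec.span_base) blast

lemma tspan_mono: "V \<subseteq> W \<Longrightarrow> I \<subseteq> J \<Longrightarrow> tspan V I \<subseteq> tspan W J"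
  unfolding tspan_def by (rule cvec.span_mono) blast

lemma tspan_map:
  assumes "t \<in> tspan V I" "clinear F" "cvec.subspace P"
    and "\<And>v a. v \<in> V \<Longrightarrow> a \<in> I \<Longrightarrow> F (v \<otimes> a) \<in> P"
  shows "F t \<in> P"
proof -
  have "tspan V I \<subseteq> {t. F t \<in> P}"
    unfolding tspan_def
  proof (rule cvec.span_minimal)
    show "cvec.subspace {t. F t \<in> P}"
      using assms(2,3) clinear_0[OF assms(2)] by (auto simp: cvec.subspace_def clinear_iff)
  qed (use assms(4) in blast)
  then show ?thesis using assms(1) by blast
qed

lemma tspan_eqI:
  assumes "t \<in> tspan V I" "clinear F" "clinear G"
    and "\<And>v a. v \<in> V \<Longrightarrow> a \<in> I \<Longrightarrow> F (v \<otimes> a) = G (v \<otimes> a)"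
  shows "F t = G t"
proof -
  have "F t - G t \<in> {0}"
    by (rule tspan_map[OF assms(1) clinear_minus[OF assms(2,3)]]) (auto simp: cvec.subspace_def assms(4))
  then show ?thesis by simp
qed

lemma tspan_map2:
  assumes "s \<in> tspan V I" "t \<in> tspan W J" "cbilinear \<beta>" "cvec.subspace P"
    and "\<And>v a w b. v \<in> V \<Longrightarrow> a \<in> I \<Longrightarrow> w \<in> W \<Longrightarrow> b \<in> J \<Longrightarrow> \<beta> (v \<otimes> a) (w \<otimes> b) \<in> P"
  shows "\<beta> s t \<in> P"
proof (rule tspan_map[OF assms(1), where F = "\<lambda>s. \<beta> s t"])
  show "clinear (\<lambda>s. \<beta> s t)" using assms(3) by (simp add: cbilinear_def)
  show "\<beta> (v \<otimes> a) t \<in> P" if "v \<in> V" "a \<in> I" for v a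
    by (rule tspan_map[OF assms(2) _ assms(4)]) (use assms(3,5) that in \<open>auto simp: cbilinear_def\<close>)
qed (rule assms(4))

lemma tspan_UNIV: "tspan UNIV UNIV = UNIV"
proof -
  have "t \<in> tspan UNIV UNIV" for t :: "('a, 'b) tensor"
  proof -
    obtain f where f: "t = abs_tensor f"
      by (metis Quotient3_abs_rep Quotient3_tensor)
    have "abs_tensor f \<in> tspan UNIV UNIV"
    proof (induction f rule: Poly_Mapping.update_induct)
      case const
      have "abs_tensor (0 :: ('a \<times> 'b) \<Rightarrow>\<^sub>0 complex) = 0" by (simp add: zero_tensor.abs_eq)
      then show ?case using cvec.subspace_0[OF subspace_tspan] by metis
    next
      case (update f p c)
      have "Poly_Mapping.update p c f = f + c *\<^sub>C Poly_Mapping.single p 1"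
        using update(1)
        by (intro poly_mapping_eqI)
          (auto simp: lookup_update lookup_add cscale_poly_mapping.rep_eq lookup_single
            cscale_complex_def in_keys_iff when_def)
      then have "abs_tensor (Poly_Mapping.update p c f) = abs_tensor f + c *\<^sub>C (fst p \<otimes> snd p)"
        by (simp add: plus_tensor.abs_eq cscale_tensor.abs_eq ptensor.abs_eq)
      then show ?case
        using update(3) cvec.subspace_add[OF subspace_tspan]
          cvec.subspace_scale[OF subspace_tspan tspan_pure[OF UNIV_I UNIV_I]] by metis
    qed
    then show ?thesis using f by simp
  qed
  then show ?thesis by blast
qed

lemma tensor_eqI:
  assumes "clinear F" "clinear G" "\<And>v a. F (v \<otimes> a) = G (v \<otimes> a)"
  shows "F t = G t"
  by (rule tspan_eqI[OF _ assms(1,2), of t UNIV UNIV]) (simp_all add: tspan_UNIV assms(3))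

lemma tspan_zero: "tspan V {0} = {0}"
proof -
  have "tspan V {0} \<subseteq> {0}"
    unfolding tspan_def by (rule cvec.span_minimal) (auto simp: cvec.subspace_def)
  then show ?thesis using cvec.subspace_0[OF subspace_tspan] by blast
qed

lemma cbilinear_tmap1: "clinear f \<Longrightarrow> cbilinear (\<lambda>v a. f v \<otimes> a)"
  by (simp add: cbilinear_def clinear_iff ptensor_simps)

lemma cbilinear_tmap2: "clinear \<phi> \<Longrightarrow> cbilinear (\<lambda>v a. v \<otimes> \<phi> a)"
  by (simp add: cbilinear_def clinear_iff ptensor_simps)

lemma tmap1_pure: "clinear f \<Longrightarrow> tmap1 f (v \<otimes> a) = f v \<otimes> a"
  unfolding tmap1_def by (rule tensor_lift_ptensor[OF cbilinear_tmap1])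

lemma tmap2_pure: "clinear \<phi> \<Longrightarrow> tmap2 \<phi> (v \<otimes> a) = v \<otimes> \<phi> a"
  unfolding tmap2_def by (rule tensor_lift_ptensor[OF cbilinear_tmap2])

lemma clinear_tmap1: "clinear f \<Longrightarrow> clinear (tmap1 f)"
  unfolding tmap1_def by (rule clinear_tensor_lift[OF cbilinear_tmap1])

lemma clinear_tmap2: "clinear \<phi> \<Longrightarrow> clinear (tmap2 \<phi>)"
  unfolding tmap2_def by (rule clinear_tensor_lift[OF cbilinear_tmap2])

lemma tmap2_compose:
  assumes "clinear \<phi>" "clinear \<psi>"
  shows "tmap2 \<phi> (tmap2 \<psi> t) = tmap2 (\<lambda>a. \<phi> (\<psi> a)) t"
  by (rule tensor_eqI) (simp_all add: assms clinear_compose clinear_tmap2 tmap2_pure)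

lemma tmap1_tmap2:
  assumes "clinear f" "clinear \<phi>"
  shows "tmap2 \<phi> (tmap1 f t) = tmap1 f (tmap2 \<phi> t)"
  by (rule tensor_eqI) (simp_all add: assms clinear_compose clinear_tmap1 clinear_tmap2 tmap1_pure tmap2_pure)

text \<open>The map \<open>id \<otimes> \<pi>\<close> for a linear form \<open>\<pi>\<close>.  It recovers \<open>h\<close> from \<open>h \<otimes> \<epsilon>\<close> as soon as \<open>\<pi>(\<epsilon>) = 1\<close>.\<close>

definition contract :: "('a::cvector \<Rightarrow> complex) \<Rightarrow> ('v::cvector, 'a) tensor \<Rightarrow> 'v"
  where "contract \<pi> = tensor_lift (\<lambda>v a. \<pi> a *\<^sub>C v)"

lemma cbilinear_contract: "clinear \<pi> \<Longrightarrow> cbilinear (\<lambda>v a. \<pi> a *\<^sub>C v)"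
  by (simp add: cbilinear_def clinear_iff cscale_add_right cscale_add_left cvec.scale_left_commute
      cscale_cscale cscale_complex_def mult.commute)

lemma clinear_contract: "clinear \<pi> \<Longrightarrow> clinear (contract \<pi>)"
  unfolding contract_def by (rule clinear_tensor_lift[OF cbilinear_contract])

lemma contract_pure: "clinear \<pi> \<Longrightarrow> contract \<pi> (v \<otimes> a) = \<pi> a *\<^sub>C v"
  unfolding contract_def by (rule tensor_lift_ptensor[OF cbilinear_contract])

lemma contract_in:
  assumes "clinear \<pi>" "cvec.subspace V" "t \<in> tspan V I"
  shows "contract \<pi> t \<in> V"
  by (rule tspan_map[OF assms(3) clinear_contract[OF assms(1)] assms(2)])
    (simp add: contract_pure assms(1) cvec.subspace_scale[OF assms(2)])

lemma clinear_tensor_lift_param: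
  assumes "\<And>x. cbilinear (\<gamma> x)" "\<And>w b. clinear (\<lambda>x. \<gamma> x w b)"
  shows "clinear (\<lambda>x. tensor_lift (\<gamma> x) t)"
  unfolding clinear_iff
proof (intro conjI allI)
  note lin = clinear_tensor_lift[OF assms(1)] and pure = tensor_lift_ptensor[OF assms(1)]
  fix x y c
  show "tensor_lift (\<gamma> (x + y)) t = tensor_lift (\<gamma> x) t + tensor_lift (\<gamma> y) t"
    by (rule tensor_eqI[OF lin clinear_plus[OF lin lin]])
      (unfold pure, rule clinear_add[OF assms(2)])
  show "tensor_lift (\<gamma> (c *\<^sub>C x)) t = c *\<^sub>C tensor_lift (\<gamma> x) t"
    by (rule tensor_eqI[OF lin clinear_scaled[OF lin]])
      (unfold pure, rule clinear_scale[OF assms(2)])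
qed


section \<open>The differential graded Lie algebra obtained by extending scalars\<close>

lemma tgr_tspan: "tgr K i = tspan (gr K i) max_ideal"
  by (simp add: tgr_def tspan_def)

lemma subspace_tgr: "cvec.subspace (tgr K i)"
  by (simp add: tgr_tspan subspace_tspan)

context dgla
begin

lemma clinear_br: "clinear (\<lambda>x. br K x y)" "clinear (br K x)"
  using cbilinear_br by (auto simp: cbilinear_def)

lemma clinear_tdf: "clinear (tdf K)"
  unfolding tdf_def by (rule clinear_tmap1[OF clinear_df])

lemma tdf_pure: "tdf K (v \<otimes> a) = df K v \<otimes> a"
  unfolding tdf_def by (rule tmap1_pure[OF clinear_df])

lemma cbilinear_br_mult: "cbilinear (\<lambda>w b. br K v w \<otimes> (a * b))" for a :: "'a::calgebra"
  by (simp add: cbilinear_def clinear_iff ptensor_simps ring_distribs times_scale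
      clinear_add[OF clinear_br(2)] clinear_scale[OF clinear_br(2)])

lemma cbilinear_tbr_inner:
  "cbilinear (\<lambda>v a. tensor_lift (\<lambda>w b. br K v w \<otimes> (a * b)) t)" for t :: "('v, 'a::calgebra) tensor"
  unfolding cbilinear_def
  by (intro conjI allI clinear_tensor_lift_param cbilinear_br_mult)
    (simp_all add: clinear_iff ptensor_simps ring_distribs cscale_mult_left
      clinear_add[OF clinear_br(1)] clinear_scale[OF clinear_br(1)])

lemma tbr_pure: "tbr K (v \<otimes> a) (w \<otimes> b) = br K v w \<otimes> (a * b)"
  unfolding tbr_def
  by (rule trans[OF tensor_lift_ptensor[OF cbilinear_tbr_inner]
        tensor_lift_ptensor[OF cbilinear_br_mult]])

lemma clinear_tbr1: "clinear (\<lambda>s. tbr K s t)"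
  unfolding tbr_def by (rule clinear_tensor_lift[OF cbilinear_tbr_inner])

lemma clinear_tbr2: "clinear (tbr K s)"
proof -
  have *: "clinear (\<lambda>t. tbr K (v \<otimes> a) t)" for v and a :: 'a
    by (simp add: tbr_def tensor_lift_ptensor[OF cbilinear_tbr_inner]
      clinear_tensor_lift[OF cbilinear_br_mult])
  show ?thesis
    unfolding clinear_iff
  proof (intro conjI allI)
    fix t t' :: "('v, 'a) tensor" and c
    show "tbr K s (t + t') = tbr K s t + tbr K s t'"
      by (rule tensor_eqI) (simp_all add: clinear_tbr1 clinear_plus clinear_add[OF *])
    show "tbr K s (c *\<^sub>C t) = c *\<^sub>C tbr K s t"
      by (rule tensor_eqI) (simp_all add: clinear_tbr1 clinear_scaled clinear_scale[OF *])
  qed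
qed

lemma cbilinear_tbr: "cbilinear (tbr K)"
  by (simp add: cbilinear_def clinear_tbr1 clinear_tbr2)

lemmas tbr_linear =
  clinear_add[OF clinear_tbr1] clinear_add[OF clinear_tbr2]
  clinear_diff[OF clinear_tbr1] clinear_diff[OF clinear_tbr2]
  clinear_scale[OF clinear_tbr1] clinear_scale[OF clinear_tbr2]
  clinear_uminus[OF clinear_tbr1] clinear_uminus[OF clinear_tbr2]
  clinear_0[OF clinear_tbr1] clinear_0[OF clinear_tbr2]

lemmas tdf_linear =
  clinear_add[OF clinear_tdf] clinear_diff[OF clinear_tdf] clinear_scale[OF clinear_tdf]
  clinear_uminus[OF clinear_tdf] clinear_0[OF clinear_tdf]

lemma tdf_tspan: "t \<in> tspan (gr K i) I \<Longrightarrow> tdf K t \<in> tspan (gr K (i + 1)) I"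
  by (erule tspan_map[OF _ clinear_tdf subspace_tspan]) (simp add: tdf_pure tspan_pure df_gr)

lemma tdf_tspan_UNIV: "t \<in> tspan UNIV I \<Longrightarrow> tdf K t \<in> tspan UNIV I"
  by (erule tspan_map[OF _ clinear_tdf subspace_tspan]) (simp add: tdf_pure tspan_pure)

lemma tdf_tdf: "tdf K (tdf K t) = 0"
  by (rule tensor_eqI) (simp_all add: clinear_compose clinear_tdf clinear_zero tdf_pure df_df)

lemma tbr_tspan:
  assumes "s \<in> tspan (gr K i) I" "t \<in> tspan (gr K j) J"
    and "\<And>a b. a \<in> I \<Longrightarrow> b \<in> J \<Longrightarrow> a * b \<in> I'"
  shows "tbr K s t \<in> tspan (gr K (i + j)) I'"
  by (rule tspan_map2[OF assms(1,2) cbilinear_tbr subspace_tspan])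
    (simp add: tbr_pure tspan_pure br_gr assms(3))

lemma tbr_tspan_UNIV:
  assumes "s \<in> tspan UNIV I" "t \<in> tspan UNIV J"
    and "\<And>a b. a \<in> I \<Longrightarrow> b \<in> J \<Longrightarrow> a * b \<in> I'"
  shows "tbr K s t \<in> tspan UNIV I'"
  by (rule tspan_map2[OF assms(1,2) cbilinear_tbr subspace_tspan])
    (simp add: tbr_pure tspan_pure assms(3))

lemma tbr_antisym:
  fixes s t :: "('v, 'a::calgebra) tensor"
  assumes s: "s \<in> tspan (gr K i) I" and t: "t \<in> tspan (gr K j) J"
  shows "tbr K s t = - ((- 1) powi (i * j) *\<^sub>C tbr K t s)"
proof (rule tspan_eqI[OF s])
  fix v and a :: 'a assume v: "v \<in> gr K i"
  show "tbr K (v \<otimes> a) t = - ((- 1) powi (i * j) *\<^sub>C tbr K t (v \<otimes> a))"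
  proof (rule tspan_eqI[OF t])
    fix w and b :: 'a assume w: "w \<in> gr K j"
    show "tbr K (v \<otimes> a) (w \<otimes> b) = - ((- 1) powi (i * j) *\<^sub>C tbr K (w \<otimes> b) (v \<otimes> a))"
      using br_antisym[OF v w] by (simp add: tbr_pure mult.commute[of b a] ptensor_simps ptensor_minus)
  qed (intro clinear_tbr1 clinear_tbr2 clinear_neg clinear_scaled)+
qed (intro clinear_tbr1 clinear_tbr2 clinear_neg clinear_scaled)+

lemma tbr_jacobi_homogeneous:
  fixes s t u :: "('v, 'a::calgebra) tensor"
  assumes s: "s \<in> tspan (gr K i) I" and t: "t \<in> tspan (gr K j) J" and u: "u \<in> tspan (gr K k) H"
  shows "tbr K s (tbr K t u) = tbr K (tbr K s t) u + (- 1) powi (i * j) *\<^sub>C tbr K t (tbr K s u)"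
proof -
  note lin = clinear_tbr1 clinear_tbr2 clinear_plus clinear_scaled
    clinear_compose[OF clinear_tbr1 clinear_tbr1] clinear_compose[OF clinear_tbr1 clinear_tbr2]
    clinear_compose[OF clinear_tbr2 clinear_tbr1] clinear_compose[OF clinear_tbr2 clinear_tbr2]
  show ?thesis
  proof (rule tspan_eqI[OF s])
    fix v and a :: 'a assume v: "v \<in> gr K i"
    show "tbr K (v \<otimes> a) (tbr K t u) =
      tbr K (tbr K (v \<otimes> a) t) u + (- 1) powi (i * j) *\<^sub>C tbr K t (tbr K (v \<otimes> a) u)"
    proof (rule tspan_eqI[OF t])
      fix w and b :: 'a assume w: "w \<in> gr K j"
      show "tbr K (v \<otimes> a) (tbr K (w \<otimes> b) u) =
        tbr K (tbr K (v \<otimes> a) (w \<otimes> b)) u + (- 1) powi (i * j) *\<^sub>C tbr K (w \<otimes> b) (tbr K (v \<otimes> a) u)"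
      proof (rule tspan_eqI[OF u])
        fix x and c :: 'a assume x: "x \<in> gr K k"
        show "tbr K (v \<otimes> a) (tbr K (w \<otimes> b) (x \<otimes> c)) =
          tbr K (tbr K (v \<otimes> a) (w \<otimes> b)) (x \<otimes> c) +
          (- 1) powi (i * j) *\<^sub>C tbr K (w \<otimes> b) (tbr K (v \<otimes> a) (x \<otimes> c))"
          using br_jacobi[OF v w x]
          by (simp add: tbr_pure mult.assoc mult.left_commute[of b a c] ptensor_simps)
      qed (intro lin)+
    qed (intro lin)+
  qed (intro lin)+
qed

lemma tdf_tbr_homogeneous:
  fixes s t :: "('v, 'a::calgebra) tensor"
  assumes s: "s \<in> tspan (gr K i) I" and t: "t \<in> tspan (gr K j) J"
  shows "tdf K (tbr K s t) = tbr K (tdf K s) t + (- 1) powi i *\<^sub>C tbr K s (tdf K t)"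
proof -
  note lin = clinear_tbr1 clinear_tbr2 clinear_plus clinear_scaled clinear_tdf
    clinear_compose[OF clinear_tdf clinear_tbr1] clinear_compose[OF clinear_tdf clinear_tbr2]
    clinear_compose[OF clinear_tbr1 clinear_tdf] clinear_compose[OF clinear_tbr2 clinear_tdf]
  show ?thesis
  proof (rule tspan_eqI[OF s])
    fix v and a :: 'a assume v: "v \<in> gr K i"
    show "tdf K (tbr K (v \<otimes> a) t) =
      tbr K (tdf K (v \<otimes> a)) t + (- 1) powi i *\<^sub>C tbr K (v \<otimes> a) (tdf K t)"
    proof (rule tspan_eqI[OF t])
      fix w and b :: 'a assume w: "w \<in> gr K j"
      show "tdf K (tbr K (v \<otimes> a) (w \<otimes> b)) =
        tbr K (tdf K (v \<otimes> a)) (w \<otimes> b) + (- 1) powi i *\<^sub>C tbr K (v \<otimes> a) (tdf K (w \<otimes> b))"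
        using df_br[OF v w] by (simp add: tbr_pure tdf_pure ptensor_simps)
    qed (intro lin)+
  qed (intro lin)+
qed

lemma homogeneous_span: "cvec.span (\<Union>i. gr K i) = UNIV"
proof -
  have "v \<in> cvec.span (\<Union>i. gr K i)" for v
  proof -
    obtain f where f: "\<forall>i. f i \<in> gr K i" "finite {i. f i \<noteq> 0}" "v = Sum_any f"
      using direct_sum by blast
    have "Sum_any f = sum f {i. f i \<noteq> 0}" by (rule Sum_any.expand_set)
    then show ?thesis
      using f by (auto intro!: cvec.span_sum intro: cvec.span_base)
  qed
  then show ?thesis by blast
qed

text \<open>Identities that need no sign depending on the last argument extend from homogeneous arguments to
  arbitrary ones, since \<open>K\<close> is the sum of its graded pieces.\<close>

lemma homogeneous_eqI:
  fixes F G :: "('v, 'a::cvector) tensor \<Rightarrow> 'u::cvector"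
  assumes "clinear F" "clinear G" "\<And>i t. t \<in> tspan (gr K i) UNIV \<Longrightarrow> F t = G t"
  shows "F t = G t"
proof (rule tensor_eqI[OF assms(1,2)])
  fix v and a :: 'a
  have "cvec.span (\<Union>i. gr K i) \<subseteq> {v. F (v \<otimes> a) = G (v \<otimes> a)}"
  proof (rule cvec.span_minimal)
    show "(\<Union>i. gr K i) \<subseteq> {v. F (v \<otimes> a) = G (v \<otimes> a)}"
      using assms(3) tspan_pure by blast
    show "cvec.subspace {v. F (v \<otimes> a) = G (v \<otimes> a)}"
      using assms(1,2)
      by (auto simp: cvec.subspace_def ptensor_simps clinear_add clinear_scale clinear_0)
  qed
  then show "F (v \<otimes> a) = G (v \<otimes> a)" by (auto simp: homogeneous_span)
qed

lemma tbr_jacobi: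
  fixes s t u :: "('v, 'a::calgebra) tensor"
  assumes "s \<in> tspan (gr K i) I" "t \<in> tspan (gr K j) J"
  shows "tbr K s (tbr K t u) = tbr K (tbr K s t) u + (- 1) powi (i * j) *\<^sub>C tbr K t (tbr K s u)"
  by (rule homogeneous_eqI[OF _ _ tbr_jacobi_homogeneous[OF assms]])
    (intro clinear_plus clinear_scaled clinear_tbr2 clinear_compose[OF clinear_tbr2 clinear_tbr2])+

lemma tdf_tbr:
  fixes s t :: "('v, 'a::calgebra) tensor"
  assumes "s \<in> tspan (gr K i) I"
  shows "tdf K (tbr K s t) = tbr K (tdf K s) t + (- 1) powi i *\<^sub>C tbr K s (tdf K t)"
  by (rule homogeneous_eqI[OF _ _ tdf_tbr_homogeneous[OF assms]])
    (intro clinear_plus clinear_scaled clinear_tbr2 clinear_tdf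
      clinear_compose[OF clinear_tbr2 clinear_tdf] clinear_compose[OF clinear_tdf clinear_tbr2])+

end

lemma tmap2_tspan:
  assumes "t \<in> tspan V I" "clinear \<phi>" "\<And>a. a \<in> I \<Longrightarrow> \<phi> a \<in> J"
  shows "tmap2 \<phi> t \<in> tspan V J"
  by (rule tspan_map[OF assms(1) clinear_tmap2[OF assms(2)] subspace_tspan])
    (simp add: tmap2_pure assms tspan_pure)

lemma tmap2_tspan_onto:
  assumes "t \<in> tspan V J" "clinear \<phi>" "\<And>b. b \<in> J \<Longrightarrow> \<exists>a\<in>I. \<phi> a = b"
  shows "\<exists>s\<in>tspan V I. tmap2 \<phi> s = t"
proof -
  have "cvec.subspace (tmap2 \<phi> ` tspan V I)"
    unfolding cvec.subspace_def
  proof (intro conjI ballI allI)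
    note lin = clinear_tmap2[OF assms(2)]
    show "0 \<in> tmap2 \<phi> ` tspan V I"
      by (rule image_eqI[of _ _ 0]) (simp_all add: clinear_0[OF lin] cvec.subspace_0[OF subspace_tspan])
    fix x assume "x \<in> tmap2 \<phi> ` tspan V I"
    then obtain s where s: "x = tmap2 \<phi> s" "s \<in> tspan V I" by auto
    show "c *\<^sub>C x \<in> tmap2 \<phi> ` tspan V I" for c
      by (rule image_eqI[of _ _ "c *\<^sub>C s"])
        (simp_all add: s clinear_scale[OF lin] cvec.subspace_scale[OF subspace_tspan])
    fix y assume "y \<in> tmap2 \<phi> ` tspan V I"
    then obtain s' where s': "y = tmap2 \<phi> s'" "s' \<in> tspan V I" by auto
    show "x + y \<in> tmap2 \<phi> ` tspan V I"
      by (rule image_eqI[of _ _ "s + s'"])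
        (simp_all add: s s' clinear_add[OF lin] cvec.subspace_add[OF subspace_tspan])
  qed
  moreover have "v \<otimes> b \<in> tmap2 \<phi> ` tspan V I" if "v \<in> V" "b \<in> J" for v b
  proof -
    obtain a where "a \<in> I" "\<phi> a = b" using assms(3)[OF \<open>b \<in> J\<close>] by blast
    then show ?thesis
      by (intro image_eqI[of _ _ "v \<otimes> a"]) (simp_all add: tmap2_pure assms(2) tspan_pure that)
  qed
  ultimately have "t \<in> tmap2 \<phi> ` tspan V I"
    by (rule tspan_map[OF assms(1) clinear_id])
  then show ?thesis by blast
qed

lemma tmap2_tdf:
  assumes "dgla K" "clinear \<phi>"
  shows "tmap2 \<phi> (tdf K t) = tdf K (tmap2 \<phi> t)"
  unfolding tdf_def by (rule tmap1_tmap2[OF dgla.clinear_df[OF assms(1)] assms(2)])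

lemma tmap2_tbr:
  assumes "dgla K" "calg_hom \<phi>"
  shows "tmap2 \<phi> (tbr K s t) = tbr K (tmap2 \<phi> s) (tmap2 \<phi> t)"
proof -
  interpret dgla K by fact
  have \<phi>: "clinear \<phi>" "\<And>x y. \<phi> (x * y) = \<phi> x * \<phi> y" using assms(2) by (auto simp: calg_hom_def)
  note lin = clinear_compose[OF clinear_tmap2[OF \<phi>(1)] clinear_tbr1]
    clinear_compose[OF clinear_tmap2[OF \<phi>(1)] clinear_tbr2]
    clinear_compose[OF clinear_tbr1 clinear_tmap2[OF \<phi>(1)]]
    clinear_compose[OF clinear_tbr2 clinear_tmap2[OF \<phi>(1)]]
  show ?thesis
  proof (rule tensor_eqI[OF lin(1,3)])
    fix v a
    show "tmap2 \<phi> (tbr K (v \<otimes> a) t) = tbr K (tmap2 \<phi> (v \<otimes> a)) (tmap2 \<phi> t)"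
      by (rule tensor_eqI[OF lin(2,4)]) (simp add: tbr_pure tmap2_pure \<phi>)
  qed
qed

lemma tmap1_tdf:
  assumes "dgla L" "dgla M" "dgla_hom L M \<chi>"
  shows "tmap1 \<chi> (tdf L t) = tdf M (tmap1 \<chi> t)"
proof -
  have \<chi>: "clinear \<chi>" "\<And>x. \<chi> (df L x) = df M (\<chi> x)" using assms(3) by (auto simp: dgla_hom_def)
  show ?thesis
    by (rule tensor_eqI)
      (simp_all add: clinear_compose clinear_tmap1 \<chi> dgla.clinear_tdf assms(1,2) dgla.tdf_pure tmap1_pure)
qed

lemma tmap1_tbr:
  assumes "dgla L" "dgla M" "dgla_hom L M \<chi>"
  shows "tmap1 \<chi> (tbr L s t) = tbr M (tmap1 \<chi> s) (tmap1 \<chi> t)"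
proof -
  interpret L: dgla L by fact
  interpret M: dgla M by fact
  have \<chi>: "clinear \<chi>" "\<And>x y. \<chi> (br L x y) = br M (\<chi> x) (\<chi> y)"
    using assms(3) by (auto simp: dgla_hom_def)
  note lin = clinear_compose[OF clinear_tmap1[OF \<chi>(1)] L.clinear_tbr1]
    clinear_compose[OF clinear_tmap1[OF \<chi>(1)] L.clinear_tbr2]
    clinear_compose[OF M.clinear_tbr1 clinear_tmap1[OF \<chi>(1)]]
    clinear_compose[OF M.clinear_tbr2 clinear_tmap1[OF \<chi>(1)]]
  show ?thesis
  proof (rule tensor_eqI[OF lin(1,3)])
    fix v and a :: 'c
    show "tmap1 \<chi> (tbr L (v \<otimes> a) t) = tbr M (tmap1 \<chi> (v \<otimes> a)) (tmap1 \<chi> t)"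
      by (rule tensor_eqI[OF lin(2,4)]) (simp add: L.tbr_pure M.tbr_pure tmap1_pure \<chi>)
  qed
qed

lemma tmap1_tgr:
  assumes "dgla_hom L M \<chi>" "t \<in> tgr L i"
  shows "tmap1 \<chi> t \<in> tgr M i"
proof -
  have \<chi>: "clinear \<chi>" "\<And>x. x \<in> gr L i \<Longrightarrow> \<chi> x \<in> gr M i" using assms(1) by (auto simp: dgla_hom_def)
  show ?thesis
    unfolding tgr_tspan
    by (rule tspan_map[OF assms(2)[unfolded tgr_tspan] clinear_tmap1[OF \<chi>(1)] subspace_tspan])
      (simp add: tmap1_pure \<chi> tspan_pure)
qed


section \<open>The gauge action\<close>

text \<open>The operator \<open>\<rho>(a)\<close>: bracketing \<open>w + t\<delta>\<close> with \<open>a\<close>, where \<open>\<delta>\<close> is a formal element with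
  \<open>[\<delta>, -] = d\<close>.\<close>

definition gauge_op ::
    "'v::cvector dgl \<Rightarrow> ('v, 'a::calgebra) tensor \<Rightarrow> ('v, 'a) tensor \<times> complex \<Rightarrow> ('v, 'a) tensor \<times> complex"
  where "gauge_op K a u = (tbr K a (fst u) - snd u *\<^sub>C tdf K a, 0)"

text \<open>The bracket of \<open>w + t\<delta>\<close> and \<open>w' + t'\<delta>\<close>, with \<open>[\<delta>, \<delta>] = 0\<close>; half its diagonal value at
  \<open>w + \<delta>\<close> is the curvature of \<open>w\<close>.\<close>

definition curv_form ::
    "'v::cvector dgl \<Rightarrow> ('v, 'a::calgebra) tensor \<times> complex \<Rightarrow> ('v, 'a) tensor \<times> complex \<Rightarrow> ('v, 'a) tensor"
  where "curv_form K u u' = tbr K (fst u) (fst u') + snd u' *\<^sub>C tdf K (fst u) + snd u *\<^sub>C tdf K (fst u')"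

lemma pair_scale [simp]: "c *\<^sub>C (x, y) = (c *\<^sub>C x, c *\<^sub>C y)" "fst (c *\<^sub>C p) = c *\<^sub>C fst p" "snd (c *\<^sub>C p) = c *\<^sub>C snd p"
  by (simp_all add: cscale_prod_def)

lemma foldr_replicate: "foldr f (replicate n x) v = (f x ^^ n) v"
  by (induction n) simp_all

lemma tgr_tspan_UNIV: "t \<in> tgr K i \<Longrightarrow> t \<in> tspan UNIV max_ideal"
  unfolding tgr_tspan using tspan_mono by blast

lemma tgr_homogeneous: "t \<in> tgr K i \<Longrightarrow> t \<in> tspan (gr K i) UNIV"
  unfolding tgr_tspan using tspan_mono by blast

context dgla
begin

lemma cbilinear_gauge_op: "clinear (gauge_op K a)" "clinear (\<lambda>a. gauge_op K a u)"
  unfolding clinear_iff gauge_op_def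
  by (auto simp: tbr_linear tdf_linear cscale_add_left cscale_add_right cscale_complex_def
      cvec.scale_right_diff_distrib cscale_cscale mult.commute)

lemma cbilinear_curv_form: "cbilinear (curv_form K)"
  unfolding cbilinear_def clinear_iff curv_form_def
  by (auto simp: tbr_linear tdf_linear cscale_add_left cscale_add_right cscale_complex_def
      cscale_cscale mult.commute)

lemma curv_eq: "curv K w = (1 / 2) *\<^sub>C curv_form K (w, 1) (w, 1)"
proof -
  have "tdf K w = (1 / 2) *\<^sub>C (tdf K w + tdf K w)"
    by (simp add: cscale_cscale cscale_one flip: cscale_two)
  then show ?thesis by (simp add: curv_def curv_form_def cscale_one cscale_add_right add_ac)
qed

lemma tbr_tgr:
  assumes "art TYPE('a::calgebra)" "s \<in> tgr K i" "t \<in> tgr K j"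
  shows "tbr K s t \<in> (tgr K (i + j) :: ('v, 'a) tensor set)"
  using assms(2,3) unfolding tgr_tspan
  by (rule tbr_tspan) (rule ideal_closed(3)[OF ideal_max_ideal[OF assms(1)]])

lemma tdf_tgr: "t \<in> tgr K i \<Longrightarrow> tdf K t \<in> tgr K (i + 1)"
  unfolding tgr_tspan by (rule tdf_tspan)

lemma tbr_self_degree_0:
  assumes "a \<in> tspan (gr K 0) I"
  shows "tbr K a a = 0"
proof -
  have "tbr K a a = - tbr K a a"
    using tbr_antisym[OF assms assms] by (simp add: cscale_one)
  then have "tbr K a a + tbr K a a = 0" by (metis add.right_inverse)
  then have "(1 / 2) *\<^sub>C 2 *\<^sub>C tbr K a a = 0" by (simp only: cscale_two cvec.scale_zero_right)
  then show ?thesis by (simp add: cscale_cscale cscale_one)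
qed

text \<open>The Jacobi identity kills \<open>[[y, y], y]\<close>, and the rest is the derivation rule.\<close>

lemma bianchi:
  assumes y: "y \<in> tspan (gr K 1) I"
  shows "tdf K (curv K y) = tbr K (curv K y) y"
proof -
  have yy: "tbr K y y \<in> tspan (gr K (1 + 1)) UNIV" by (rule tbr_tspan[OF y y]) simp
  have dy: "tdf K y \<in> tspan (gr K (1 + 1)) I" by (rule tdf_tspan[OF y])
  \<comment> \<open>For \<open>T = [[y, y], y]\<close>, the Jacobi identity and antisymmetry give \<open>- T = T + T\<close>.\<close>
  have "tbr K y (tbr K y y) = tbr K (tbr K y y) y - tbr K y (tbr K y y)"
    using tbr_jacobi[OF y y, of y] by (simp add: cscale_one cvec.scale_minus_left)
  moreover have "tbr K y (tbr K y y) = - tbr K (tbr K y y) y"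
    using tbr_antisym[OF y yy] by (simp add: cscale_one)
  ultimately have e: "- tbr K (tbr K y y) y = tbr K (tbr K y y) y + tbr K (tbr K y y) y"
    by simp
  have "3 *\<^sub>C tbr K (tbr K y y) y = tbr K (tbr K y y) y + - tbr K (tbr K y y) y"
    using cscale_add_left[of 1 2 "tbr K (tbr K y y) y"] unfolding e by (simp add: cscale_two cscale_one)
  then have "3 *\<^sub>C tbr K (tbr K y y) y = 0" by simp
  then have "(1 / 3) *\<^sub>C 3 *\<^sub>C tbr K (tbr K y y) y = 0" by (simp only: cvec.scale_zero_right)
  then have cubic: "tbr K (tbr K y y) y = 0" by (simp add: cscale_cscale cscale_one)
  have "tdf K (tbr K y y) = tbr K (tdf K y) y - tbr K y (tdf K y)"
    using tdf_tbr[OF y, of y] by (simp add: cscale_one cvec.scale_minus_left)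
  also have "tbr K y (tdf K y) = - tbr K (tdf K y) y"
    using tbr_antisym[OF y dy] by (simp add: cscale_one)
  finally have "tdf K (tbr K y y) = 2 *\<^sub>C tbr K (tdf K y) y" by (simp add: cscale_two)
  then show ?thesis
    by (simp add: curv_def tdf_linear tdf_tdf tbr_linear cubic cscale_cscale cscale_one)
qed

text \<open>The second component of \<open>\<rho>(a) \<rho>(b)\<close> is zero, so that the affine part of the commutator is
  \<open>-t([a, db] - [b, da]) = -t d[a, b]\<close>.\<close>

lemma gauge_op_bracket:
  assumes a: "a \<in> tspan (gr K 0) I" and b: "b \<in> tspan (gr K 0) I"
  shows "gauge_op K (tbr K a b) u = gauge_op K a (gauge_op K b u) - gauge_op K b (gauge_op K a u)"
proof -
  have "tbr K b (tdf K a) = - tbr K (tdf K a) b"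
    using tbr_antisym[OF b tdf_tspan[OF a]] by (simp add: cscale_one)
  then have d: "tdf K (tbr K a b) = tbr K a (tdf K b) - tbr K b (tdf K a)"
    using tdf_tbr[OF a, of b] by (simp add: cscale_one)
  have "tbr K (tbr K a b) w = tbr K a (tbr K b w) - tbr K b (tbr K a w)" for w
    using tbr_jacobi[OF a b, of w] by (simp add: cscale_one)
  then show ?thesis
    by (simp add: gauge_op_def d tbr_linear cvec.scale_right_diff_distrib algebra_simps)
qed

lemma curv_form_derivation:
  assumes a: "a \<in> tspan (gr K 0) I" and u: "fst u \<in> tspan (gr K 1) UNIV" and u': "fst u' \<in> tspan (gr K 1) UNIV"
  shows "tbr K a (curv_form K u u') = curv_form K (gauge_op K a u) u' + curv_form K u (gauge_op K a u')"
proof -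
  obtain w t w' t' where [simp]: "u = (w, t)" "u' = (w', t')" by (metis surj_pair)
  have w: "w \<in> tspan (gr K 1) UNIV" using u by simp
  have da: "tdf K a \<in> tspan (gr K (0 + 1)) I" by (rule tdf_tspan[OF a])
  have sym: "tbr K w (tdf K a) = tbr K (tdf K a) w"
    using tbr_antisym[OF w da] by (simp add: cscale_one cvec.scale_minus_left)
  have jac: "tbr K a (tbr K w w') = tbr K (tbr K a w) w' + tbr K w (tbr K a w')"
    using tbr_jacobi[OF a w, of w'] by (simp add: cscale_one)
  have leib: "tdf K (tbr K a z) = tbr K (tdf K a) z + tbr K a (tdf K z)" for z
    using tdf_tbr[OF a, of z] by (simp add: cscale_one)
  show ?thesis
    by (simp add: curv_form_def gauge_op_def tbr_linear tdf_linear tdf_tdf leib jac sym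
        cscale_add_right cvec.scale_right_diff_distrib cvec.scale_left_commute[of t'] algebra_simps)
qed

lemma gauge_op_pow: "(gauge_op K a ^^ Suc n) (w, 1) = ((tbr K a ^^ n) (tbr K a w - tdf K a), 0)"
  by (induction n) (simp_all add: gauge_op_def cscale_one)

context
  assumes art: "art TYPE('a::calgebra)"
begin

lemma tbr_filtration:
  assumes "a \<in> tspan UNIV max_ideal" "w \<in> tspan UNIV (max_ideal_power n)"
  shows "tbr K a w \<in> (tspan UNIV (max_ideal_power (Suc n)) :: ('v, 'a) tensor set)"
  by (rule tbr_tspan_UNIV[OF assms]) (auto intro: cvec.span_base)

lemma tspan_max_ideal_power_1:
  "a \<in> tspan UNIV max_ideal \<Longrightarrow> a \<in> (tspan UNIV (max_ideal_power (Suc 0)) :: ('v, 'a) tensor set)"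
  using tspan_mono[OF subset_refl max_ideal_power_1[OF art], of UNIV] by blast

lemma tspan_nilpotent:
  obtains N where "\<And>n t. n \<ge> N \<Longrightarrow> t \<in> (tspan UNIV (max_ideal_power n) :: ('v, 'a) tensor set) \<Longrightarrow> t = 0"
proof -
  obtain N where N: "max_ideal_power N = {0 :: 'a}" using max_ideal_nilpotent[OF art] by blast
  have "max_ideal_power n \<subseteq> (max_ideal_power N :: 'a set)" if "n \<ge> N" for n
    using that by (rule lift_Suc_antimono_le[where f = max_ideal_power, rotated])
      (rule max_ideal_power_dec[OF art])
  then have "tspan UNIV (max_ideal_power n :: 'a set) \<subseteq> tspan (UNIV :: 'v set) {0}" if "n \<ge> N" for n
    using that N by (intro tspan_mono) auto
  then have "t = 0" if "n \<ge> N" "t \<in> tspan UNIV (max_ideal_power n)" for n and t :: "('v, 'a) tensor"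
    using that unfolding tspan_zero by blast
  then show thesis by (rule that)
qed

lemma gauge_op_foldr:
  assumes "set gs \<subseteq> tspan UNIV max_ideal" "gs \<noteq> []"
  shows "foldr (gauge_op K) gs u \<in> (tspan UNIV (max_ideal_power (length gs)) :: ('v, 'a) tensor set) \<times> {0}"
  using assms
proof (induction gs)
  case (Cons g gs)
  then have g: "g \<in> tspan UNIV max_ideal" by simp
  let ?u = "foldr (gauge_op K) gs u"
  have "fst ?u \<in> tspan UNIV (max_ideal_power (length gs))"
    using Cons by (cases "gs = []") (auto simp: tspan_UNIV)
  then have 1: "tbr K g (fst ?u) \<in> tspan UNIV (max_ideal_power (length (g # gs)))"
    using tbr_filtration[OF g] by simp
  have 2: "snd ?u *\<^sub>C tdf K g \<in> tspan UNIV (max_ideal_power (length (g # gs)))"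
  proof (cases "gs = []")
    case True
    then show ?thesis
      using cvec.subspace_scale[OF subspace_tspan tspan_max_ideal_power_1[OF tdf_tspan_UNIV[OF g]]]
      by (simp del: max_ideal_power.simps)
  next
    case False
    then have "snd ?u = 0" using Cons by auto
    then show ?thesis by (simp add: cvec.subspace_0[OF subspace_tspan] del: max_ideal_power.simps)
  qed
  have "foldr (gauge_op K) (g # gs) u = (tbr K g (fst ?u) - snd ?u *\<^sub>C tdf K g, 0)"
    by (simp only: foldr_Cons o_apply gauge_op_def[of K g])
  then show ?case
    using cvec.subspace_diff[OF subspace_tspan 1 2] by (simp del: max_ideal_power.simps)
qed simp

lemma nested_tbr_filtration:
  assumes "set gs \<subseteq> tspan UNIV max_ideal" "gs \<noteq> []"
  shows "nested_br (tbr K) gs \<in> (tspan UNIV (max_ideal_power (length gs)) :: ('v, 'a) tensor set)"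
  using assms
proof (induction gs)
  case (Cons g gs)
  then show ?case
    using tspan_max_ideal_power_1 tbr_filtration[of g]
    by (cases "gs = []") (simp_all add: nested_br_Cons del: max_ideal_power.simps)
qed simp

text \<open>A word in the operators \<open>\<rho>(a)\<close> raises the power of \<open>\<mm>\<^sub>A\<close> by its length; only on the component \<open>t\<close>
  does the first letter contribute through \<open>da\<close> instead of a bracket.\<close>

lemma gauge_rep: "\<exists>N. nilp_rep (tbr K) (gauge_op K) (tgr K 0 :: ('v, 'a) tensor set) N"
proof -
  obtain N where N: "\<And>n t. n \<ge> N \<Longrightarrow> t \<in> (tspan UNIV (max_ideal_power n) :: ('v, 'a) tensor set) \<Longrightarrow> t = 0"
    by (rule tspan_nilpotent) blast
  have sub: "set gs \<subseteq> tspan UNIV max_ideal" if "set gs \<subseteq> tgr K 0" for gs :: "('v, 'a) tensor list"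
    using that tgr_tspan_UNIV by blast
  \<comment> \<open>The successor excludes the empty word, which does not lower the component \<open>t\<close> to \<open>0\<close>.\<close>
  have "nilp_rep (tbr K) (gauge_op K) (tgr K 0 :: ('v, 'a) tensor set) (Suc N)"
    unfolding nilp_rep_def
  proof (intro conjI allI impI)
    fix g h :: "('v, 'a) tensor" and u :: "('v, 'a) tensor \<times> complex"
    assume gh: "g \<in> tgr K 0" "h \<in> tgr K 0"
    show "tbr K g h \<in> tgr K 0" using tbr_tgr[OF art gh] by simp
    show "gauge_op K (tbr K g h) u = gauge_op K g (gauge_op K h u) - gauge_op K h (gauge_op K g u)"
      using gh unfolding tgr_tspan by (rule gauge_op_bracket)
  next
    fix gs :: "('v, 'a) tensor list" and u :: "('v, 'a) tensor \<times> complex"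
    assume gs: "set gs \<subseteq> tgr K 0" "length gs \<ge> Suc N"
    then have "gs \<noteq> []" by auto
    have len: "length gs \<ge> N" using gs(2) by simp
    show "foldr (gauge_op K) gs u = 0"
      using gauge_op_foldr[OF sub[OF gs(1)] \<open>gs \<noteq> []\<close>, of u] N[OF len] by (auto simp: zero_prod_def)
    show "nested_br (tbr K) gs = 0"
      by (rule N[OF len nested_tbr_filtration[OF sub[OF gs(1)] \<open>gs \<noteq> []\<close>]])
  qed (rule cbilinear_gauge_op)+
  then show ?thesis ..
qed

lemma gauge_op_nilpotent:
  assumes "a \<in> tgr K 0"
  obtains N where "\<And>n u. n \<ge> N \<Longrightarrow> (gauge_op K a ^^ n) u = (0 :: ('v, 'a) tensor \<times> complex)"
proof -
  obtain N where "nilp_rep (tbr K) (gauge_op K) (tgr K 0 :: ('v, 'a) tensor set) N"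
    using gauge_rep by blast
  then interpret nilp_rep "tbr K" "gauge_op K" "tgr K 0 :: ('v, 'a) tensor set" N .
  have "(gauge_op K a ^^ n) u = 0" if "n \<ge> N" for n u
    unfolding foldr_replicate[symmetric] by (rule nil_op) (use that assms in auto)
  then show thesis by (rule that)
qed

lemma gauge_terms_finite:
  assumes "a \<in> tgr K 0"
  shows "finite {n. (1 / fact (n + 1)) *\<^sub>C (tbr K a ^^ n) (tbr K a w - tdf K a) \<noteq> (0 :: ('v, 'a) tensor)}"
proof -
  obtain N where N: "\<And>n u. n \<ge> N \<Longrightarrow> (gauge_op K a ^^ n) u = (0 :: ('v, 'a) tensor \<times> complex)"
    by (rule gauge_op_nilpotent[OF assms]) blast
  have "(tbr K a ^^ n) (tbr K a w - tdf K a) = 0" if "n \<ge> N" for n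
    using N[of "Suc n" "(w, 1)"] that unfolding gauge_op_pow by (simp add: zero_prod_def)
  then have "{n. (1 / fact (n + 1)) *\<^sub>C (tbr K a ^^ n) (tbr K a w - tdf K a) \<noteq> 0} \<subseteq> {..<N}"
    by (auto simp: not_le[symmetric])
  then show ?thesis by (rule finite_subset) simp
qed

lemma gauge_nexp:
  fixes w :: "('v, 'a) tensor"
  assumes "a \<in> tgr K 0"
  shows "nexp (gauge_op K a) (w, 1) = (gauge K a w, 1)"
proof -
  obtain N where N: "\<And>n u. n \<ge> N \<Longrightarrow> (gauge_op K a ^^ n) u = (0 :: ('v, 'a) tensor \<times> complex)"
    by (rule gauge_op_nilpotent[OF assms]) blast
  have z: "(tbr K a ^^ n) (tbr K a w - tdf K a) = 0" if "n \<ge> N" for n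
    using N[of "Suc n" "(w, 1)"] that unfolding gauge_op_pow by (simp add: zero_prod_def)
  have "nexp (gauge_op K a) (w, 1) = (\<Sum>n<Suc N. (1 / fact n) *\<^sub>C (gauge_op K a ^^ n) (w, 1))"
    by (rule nexp_eq) (simp add: N)
  also have "\<dots> = (w, 1) + (\<Sum>n<N. (1 / fact (Suc n)) *\<^sub>C (gauge_op K a ^^ Suc n) (w, 1))"
    by (subst sum.lessThan_Suc_shift) (simp add: cscale_one del: funpow.simps)
  also have "\<dots> = (w, 1) + (\<Sum>n<N. ((1 / fact (n + 1)) *\<^sub>C (tbr K a ^^ n) (tbr K a w - tdf K a), 0))"
    unfolding gauge_op_pow by (simp add: cscale_complex_def)
  also have "\<dots> = (w + (\<Sum>n<N. (1 / fact (n + 1)) *\<^sub>C (tbr K a ^^ n) (tbr K a w - tdf K a)), 1)"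
    by (simp add: prod_eq_iff fst_sum snd_sum)
  also have "(\<Sum>n<N. (1 / fact (n + 1)) *\<^sub>C (tbr K a ^^ n) (tbr K a w - tdf K a)) =
      Sum_any (\<lambda>n. (1 / fact (n + 1)) *\<^sub>C (tbr K a ^^ n) (tbr K a w - tdf K a))"
    by (rule Sum_any.expand_superset[symmetric]) (use z in \<open>auto simp: not_le[symmetric]\<close>)
  finally show ?thesis by (simp add: gauge_def)
qed

lemma gauge_bch:
  fixes w :: "('v, 'a) tensor"
  assumes "a \<in> tgr K 0" "b \<in> tgr K 0"
  shows "bch (tbr K) a b \<in> tgr K 0"
    and "gauge K (bch (tbr K) a b) w = gauge K a (gauge K b w)"
proof -
  obtain N where "nilp_rep (tbr K) (gauge_op K) (tgr K 0 :: ('v, 'a) tensor set) N"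
    using gauge_rep by blast
  then interpret nilp_rep "tbr K" "gauge_op K" "tgr K 0 :: ('v, 'a) tensor set" N .
  show in_tgr: "bch (tbr K) a b \<in> tgr K 0"
    by (rule bch_in[OF subspace_tgr assms])
  show "gauge K (bch (tbr K) a b) w = gauge K a (gauge K b w)"
    using nexp_bch[OF assms, of "(w, 1)"]
    by (simp add: gauge_nexp assms in_tgr)
qed

lemma gauge_inverse:
  fixes w :: "('v, 'a) tensor"
  assumes "a \<in> tgr K 0"
  shows "gauge K (- a) (gauge K a w) = w"
proof -
  obtain N where "nilp_rep (tbr K) (gauge_op K) (tgr K 0 :: ('v, 'a) tensor set) N"
    using gauge_rep by blast
  then interpret nilp_rep "tbr K" "gauge_op K" "tgr K 0 :: ('v, 'a) tensor set" N .
  show ?thesis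
    using nexp_inverse[OF assms, of "(w, 1)"]
    by (simp add: gauge_nexp assms cvec.subspace_neg[OF subspace_tgr])
qed

lemma bch_map:
  assumes "a \<in> tgr K 0" "b \<in> tgr K 0"
    and "clinear F" "\<And>s t. F (tbr K s t) = \<beta> (F s) (F t)"
  shows "F (bch (tbr K) a b) = bch \<beta> (F a) (F (b :: ('v, 'a) tensor))"
proof -
  obtain N where "nilp_rep (tbr K) (gauge_op K) (tgr K 0 :: ('v, 'a) tensor set) N"
    using gauge_rep by blast
  then interpret nilp_rep "tbr K" "gauge_op K" "tgr K 0 :: ('v, 'a) tensor set" N .
  show ?thesis by (rule bch_hom[OF assms])
qed

lemma gauge_map:
  fixes F :: "('v, 'a) tensor \<Rightarrow> ('w::cvector, 'b::calgebra) tensor"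
  assumes "a \<in> tgr K 0" and F: "clinear F" "\<And>s t. F (tbr K s t) = tbr K' (F s) (F t)"
    "\<And>t. F (tdf K t) = tdf K' (F t)"
  shows "F (gauge K a w) = gauge K' (F a) (F w)"
proof -
  have "F ((tbr K a ^^ n) t) = (tbr K' (F a) ^^ n) (F t)" for n t
    by (induction n) (simp_all add: F(2))
  then show ?thesis
    unfolding gauge_def clinear_add[OF F(1)] clinear_Sum_any[OF F(1) gauge_terms_finite[OF assms(1)]]
    by (simp add: clinear_scale[OF F(1)] clinear_diff[OF F(1)] F(2,3))
qed

lemma gauge_tgr:
  assumes a: "a \<in> tgr K 0" and w: "w \<in> tgr K 1"
  shows "gauge K a w \<in> (tgr K 1 :: ('v, 'a) tensor set)"
proof -
  have br: "tbr K a t \<in> tgr K 1" if "t \<in> tgr K 1" for t using tbr_tgr[OF art a that] by simp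
  have "tdf K a \<in> tgr K 1" using tdf_tgr[OF a] by simp
  then have "tbr K a w - tdf K a \<in> tgr K 1"
    using cvec.subspace_diff[OF subspace_tgr br[OF w]] by blast
  then have "(tbr K a ^^ n) (tbr K a w - tdf K a) \<in> tgr K 1" for n
    by (induction n) (simp_all add: br)
  then show ?thesis
    unfolding gauge_def
    by (intro cvec.subspace_add[OF subspace_tgr] w Sum_any_in_subspace[OF subspace_tgr]
        cvec.subspace_scale[OF subspace_tgr])
qed

text \<open>The exponential of the action of \<open>a\<close> is multiplicative for \<open>curv_form\<close>, by \<open>curv_form_derivation\<close>.\<close>

lemma curv_gauge:
  assumes a: "a \<in> tgr K 0" and w: "w \<in> tspan (gr K 1) UNIV"
  shows "curv K (gauge K a w) = nexp (tbr K a) (curv K (w :: ('v, 'a) tensor))"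
proof -
  obtain N where N: "\<And>n u. n \<ge> N \<Longrightarrow> (gauge_op K a ^^ n) u = (0 :: ('v, 'a) tensor \<times> complex)"
    by (rule gauge_op_nilpotent[OF a]) blast
  let ?S = "{u :: ('v, 'a) tensor \<times> complex. fst u \<in> tspan (gr K 1) UNIV}"
  have ah: "a \<in> tspan (gr K 0) UNIV" by (rule tgr_homogeneous[OF a])
  have inv: "gauge_op K a u \<in> ?S" if "u \<in> ?S" for u
  proof -
    have "tbr K a (fst u) \<in> tspan (gr K (0 + 1)) UNIV"
      by (rule tbr_tspan[OF ah]) (use that in auto)
    moreover have "tdf K a \<in> tspan (gr K (0 + 1)) UNIV" by (rule tdf_tspan[OF ah])
    ultimately show ?thesis
      by (simp add: gauge_op_def cvec.subspace_diff[OF subspace_tspan] cvec.subspace_scale[OF subspace_tspan])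
  qed
  let ?B = "\<lambda>(u :: ('v, 'a) tensor \<times> complex) u'. (1 / 2) *\<^sub>C curv_form K u u'"
  have "nexp (tbr K a) (?B (w, 1) (w, 1)) = ?B (nexp (gauge_op K a) (w, 1)) (nexp (gauge_op K a) (w, 1))"
  proof (rule nexp_leibniz[where \<beta> = ?B and S = ?S and S' = ?S and N = N])
    show "cbilinear ?B" using cbilinear_curv_form unfolding cbilinear_def by (intro conjI allI clinear_scaled) blast+
    show "tbr K a (?B u u') = ?B (gauge_op K a u) u' + ?B u (gauge_op K a u')" if "u \<in> ?S" "u' \<in> ?S" for u u'
      using curv_form_derivation[OF ah, of u u'] that by (simp add: tbr_linear cscale_add_right)
  qed (use inv w N clinear_tbr2 in auto)
  then show ?thesis by (simp add: curv_eq gauge_nexp[OF a])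
qed

end

lemma gauge_central:
  assumes "tbr K a w = 0" "tdf K a = 0"
  shows "gauge K a w = w"
  using clinear_0[OF clinear_funpow[OF clinear_tbr2[of a]]] by (simp add: gauge_def assms)

end


section \<open>The suspended mapping cone\<close>

lemma coset_eq_iff:
  assumes D: "clinear D" and S: "cvec.subspace S"
  shows "{z + D b | b. b \<in> S} = {z' + D b | b. b \<in> S} \<longleftrightarrow> (\<exists>b\<in>S. z - z' = D b)"
proof
  assume eq: "{z + D b | b. b \<in> S} = {z' + D b | b. b \<in> S}"
  have "z = z + D 0" by (simp add: clinear_0[OF D])
  then have "z \<in> {z' + D b | b. b \<in> S}" unfolding eq[symmetric] using cvec.subspace_0[OF S] by blast
  then obtain b where "b \<in> S" "z = z' + D b" by blast
  then show "\<exists>b\<in>S. z - z' = D b" by (intro bexI[of _ b]) simp_all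
next
  assume "\<exists>b\<in>S. z - z' = D b"
  then obtain b where b: "b \<in> S" "z - z' = D b" by blast
  have eq: "z = z' + D b" using b(2) by (simp add: algebra_simps)
  have "\<exists>c\<in>S. z + D a = z' + D c" if "a \<in> S" for a
    using that b(1)
    by (intro bexI[of _ "b + a"]) (simp_all add: eq clinear_add[OF D] cvec.subspace_add[OF S] add.assoc)
  moreover have "\<exists>c\<in>S. z' + D a = z + D c" if "a \<in> S" for a
    using that b(1)
    by (intro bexI[of _ "a - b"]) (simp_all add: eq clinear_diff[OF D] cvec.subspace_diff[OF S])
  ultimately show "{z + D b | b. b \<in> S} = {z' + D b | b. b \<in> S}" by blast
qed

locale dgla_morphism = L: dgla L + M: dgla M
  for L :: "'l::cvector dgl" and M :: "'m::cvector dgl" +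
  fixes \<chi> :: "'l \<Rightarrow> 'm"
  assumes hom: "dgla_hom L M \<chi>"
begin

lemma clinear_hom: "clinear \<chi>"
  using hom by (simp add: dgla_hom_def)

lemma hom_gr: "x \<in> gr L i \<Longrightarrow> \<chi> x \<in> gr M i"
  using hom by (simp add: dgla_hom_def)

lemmas hom_tdf = tmap1_tdf[OF L.dgla_axioms M.dgla_axioms hom]
lemmas hom_tbr = tmap1_tbr[OF L.dgla_axioms M.dgla_axioms hom]
lemmas hom_tgr = tmap1_tgr[OF hom]

lemma subspace_cone: "cvec.subspace (cone L M i)"
  using L.subspace_gr[of i] M.subspace_gr[of "i - 1"]
  by (auto simp: cone_def cvec.subspace_def zero_prod_def)

lemma clinear_cone_df: "clinear (cone_df L M \<chi>)"
  unfolding clinear_iff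
  by (auto simp: cone_df_def clinear_add[OF L.clinear_df] clinear_add[OF M.clinear_df]
      clinear_add[OF clinear_hom] clinear_scale[OF L.clinear_df] clinear_scale[OF M.clinear_df]
      clinear_scale[OF clinear_hom] cvec.scale_right_diff_distrib)

lemma cone_class_self: "z \<in> cone_class L M \<chi> i z"
proof -
  have "z = z + cone_df L M \<chi> 0" by (simp add: clinear_0[OF clinear_cone_df])
  then show ?thesis unfolding cone_class_def using cvec.subspace_0[OF subspace_cone] by blast
qed

lemma cone_class_eq_iff:
  "cone_class L M \<chi> i z = cone_class L M \<chi> i z' \<longleftrightarrow> (\<exists>b\<in>cone L M (i - 1). z - z' = cone_df L M \<chi> b)"
  unfolding cone_class_def by (rule coset_eq_iff[OF clinear_cone_df subspace_cone])

lemma coh_scale_class: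
  "coh_scale L M \<chi> i c (cone_class L M \<chi> i z) = cone_class L M \<chi> i (c *\<^sub>C z)"
proof -
  have "cone_class L M \<chi> i (c *\<^sub>C x) = cone_class L M \<chi> i (c *\<^sub>C z)" if "x \<in> cone_class L M \<chi> i z" for x
  proof -
    obtain b where b: "b \<in> cone L M (i - 1)" "x = z + cone_df L M \<chi> b"
      using \<open>x \<in> cone_class L M \<chi> i z\<close> by (auto simp: cone_class_def)
    then show ?thesis
      unfolding cone_class_eq_iff
      by (intro bexI[of _ "c *\<^sub>C b"])
        (simp_all add: cscale_add_right clinear_scale[OF clinear_cone_df] cvec.subspace_scale[OF subspace_cone])
  qed
  then show ?thesis unfolding coh_scale_def using cone_class_self by blast
qed

lemma coh_add_class:
  "coh_add (cone_class L M \<chi> i z) (cone_class L M \<chi> i z') = cone_class L M \<chi> i (z + z')"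
proof (intro equalityI subsetI)
  fix x assume "x \<in> coh_add (cone_class L M \<chi> i z) (cone_class L M \<chi> i z')"
  then obtain b b' where "b \<in> cone L M (i - 1)" "b' \<in> cone L M (i - 1)"
    "x = (z + cone_df L M \<chi> b) + (z' + cone_df L M \<chi> b')"
    unfolding coh_add_def cone_class_def by blast
  then have "b + b' \<in> cone L M (i - 1)" "x = (z + z') + cone_df L M \<chi> (b + b')"
    by (simp_all add: clinear_add[OF clinear_cone_df] cvec.subspace_add[OF subspace_cone])
  then show "x \<in> cone_class L M \<chi> i (z + z')" unfolding cone_class_def by blast
next
  fix x assume "x \<in> cone_class L M \<chi> i (z + z')"
  then obtain b where b: "b \<in> cone L M (i - 1)" "x = (z + cone_df L M \<chi> b) + z'"
    unfolding cone_class_def by (auto simp: add_ac)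
  then have "z + cone_df L M \<chi> b \<in> cone_class L M \<chi> i z" unfolding cone_class_def by blast
  then show "x \<in> coh_add (cone_class L M \<chi> i z) (cone_class L M \<chi> i z')"
    unfolding coh_add_def using b(2) cone_class_self by blast
qed

end


section \<open>Tensors over a small extension\<close>

lemma small_extension_splitting:
  fixes \<iota> :: "complex \<Rightarrow> 'a::calgebra" and \<alpha> :: "'a \<Rightarrow> 'b::calgebra"
  assumes art: "art TYPE('a)" "art TYPE('b)" and ext: "small_extension \<iota> \<alpha>"
  obtains \<sigma> \<pi> where "clinear \<sigma>" "clinear \<pi>" "\<pi> (\<iota> 1) = 1" "\<And>a. a = \<sigma> (\<alpha> a) + \<pi> a *\<^sub>C \<iota> 1"
proof -
  note soc = small_extension_socle[OF art ext]
  have \<alpha>: "clinear \<alpha>" "surj \<alpha>" using ext by (auto simp: small_extension_def calg_hom_def)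
  interpret BA: vector_space_pair "cscale :: complex \<Rightarrow> 'a \<Rightarrow> 'a" "cscale :: complex \<Rightarrow> 'b \<Rightarrow> 'b" ..
  interpret AC: vector_space_pair "cscale :: complex \<Rightarrow> 'a \<Rightarrow> 'a" "cscale :: complex \<Rightarrow> complex \<Rightarrow> complex" ..
  obtain \<sigma> where \<sigma>: "clinear \<sigma>" "\<alpha> \<circ> \<sigma> = id"
    using BA.linear_surjective_right_inverse[OF \<alpha>] by blast
  have "\<not> cvec.dependent {\<iota> 1}" using soc(5) by (simp add: cvec.dependent_single)
  then obtain f :: "'a \<Rightarrow> complex" where f: "clinear f" "f (\<iota> 1) = 1"
    using AC.linear_independent_extend[of "{\<iota> 1}" "\<lambda>_. 1"] by auto
  define \<pi> where "\<pi> a = f (a - \<sigma> (\<alpha> a))" for a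
  show thesis
  proof
    show "clinear \<sigma>" by (rule \<sigma>(1))
    show "clinear \<pi>"
      unfolding \<pi>_def by (intro clinear_compose[OF f(1)] clinear_minus clinear_id clinear_compose[OF \<sigma>(1) \<alpha>(1)])
    show "\<pi> (\<iota> 1) = 1" by (simp add: \<pi>_def soc(3) f(2) clinear_0[OF \<sigma>(1)])
    fix a
    have "\<alpha> (\<sigma> b) = b" for b using \<sigma>(2) by (metis comp_apply id_apply)
    then have "\<alpha> (a - \<sigma> (\<alpha> a)) = 0" by (simp add: clinear_diff[OF \<alpha>(1)])
    then obtain z where z: "a - \<sigma> (\<alpha> a) = z *\<^sub>C \<iota> 1" using soc(6) by blast
    then have "\<pi> a = z" by (simp add: \<pi>_def clinear_scale[OF f(1)] f(2) cscale_complex_def)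
    then show "a = \<sigma> (\<alpha> a) + \<pi> a *\<^sub>C \<iota> 1" using z by (simp add: algebra_simps)
  qed
qed

context
  fixes \<iota> :: "complex \<Rightarrow> 'a::calgebra" and \<alpha> :: "'a \<Rightarrow> 'b::calgebra"
  assumes artA: "art TYPE('a)" and artB: "art TYPE('b)" and ext: "small_extension \<iota> \<alpha>"
begin

lemma ext_hom: "calg_hom \<alpha>" "clinear \<alpha>" "surj \<alpha>"
  using ext by (auto simp: small_extension_def calg_hom_def)

lemmas socle = small_extension_socle[OF artA artB ext]

text \<open>A linear splitting of \<open>A \<rightarrow> B\<close> writes every tensor over \<open>A\<close> as one coming from \<open>B\<close> plus a
  multiple of \<open>\<iota> 1\<close>, compatibly with the first factor.\<close>

lemma tensor_kernel:
  assumes t: "t \<in> tspan V I" and V: "cvec.subspace V" and ker: "tmap2 \<alpha> t = 0"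
  shows "\<exists>h\<in>V. t = h \<otimes> \<iota> 1"
proof -
  obtain \<sigma> \<pi> where split: "clinear \<sigma>" "clinear \<pi>" "\<pi> (\<iota> 1) = 1" "\<And>a. a = \<sigma> (\<alpha> a) + \<pi> a *\<^sub>C \<iota> 1"
    by (rule small_extension_splitting[OF artA artB ext]) (rule that)
  have "t = tmap2 \<sigma> (tmap2 \<alpha> t) + contract \<pi> t \<otimes> \<iota> 1"
  proof (rule tensor_eqI[where F = "\<lambda>t. t"])
    show "clinear (\<lambda>t. tmap2 \<sigma> (tmap2 \<alpha> t) + contract \<pi> t \<otimes> \<iota> 1)"
      by (intro clinear_plus clinear_compose[OF clinear_tmap2 clinear_tmap2]
          clinear_compose[OF clinear_ptensor(1) clinear_contract] split ext_hom)
    fix v a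
    show "v \<otimes> a = tmap2 \<sigma> (tmap2 \<alpha> (v \<otimes> a)) + contract \<pi> (v \<otimes> a) \<otimes> \<iota> 1"
      by (subst split(4)[of a])
        (simp add: tmap2_pure split(1,2) ext_hom contract_pure ptensor_simps)
  qed (rule clinear_id)
  then have "t = contract \<pi> t \<otimes> \<iota> 1" by (simp add: ker clinear_0[OF clinear_tmap2[OF split(1)]])
  moreover have "contract \<pi> t \<in> V" by (rule contract_in[OF split(2) V t])
  ultimately show ?thesis by blast
qed

lemma socle_tensor_inject: "h \<otimes> \<iota> 1 = h' \<otimes> \<iota> 1 \<longleftrightarrow> h = h'"
proof
  assume eq: "h \<otimes> \<iota> 1 = h' \<otimes> \<iota> 1"
  obtain \<sigma> \<pi> where split: "clinear \<sigma>" "clinear \<pi>" "\<pi> (\<iota> 1) = 1" "\<And>a. a = \<sigma> (\<alpha> a) + \<pi> a *\<^sub>C \<iota> 1"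
    by (rule small_extension_splitting[OF artA artB ext]) (rule that)
  have "contract \<pi> (h \<otimes> \<iota> 1) = contract \<pi> (h' \<otimes> \<iota> 1)" using eq by simp
  then show "h = h'" by (simp add: contract_pure split cscale_one)
qed simp

lemma socle_tensor_zero: "h \<otimes> \<iota> 1 = 0 \<longleftrightarrow> h = 0"
  using socle_tensor_inject[of h 0] by simp

lemma socle_tgr: "h \<in> gr K i \<Longrightarrow> h \<otimes> \<iota> 1 \<in> tgr K i"
  unfolding tgr_tspan by (rule tspan_pure[OF _ socle(1)])

lemma tmap2_socle: "tmap2 \<alpha> (h \<otimes> \<iota> 1) = 0"
  by (simp add: tmap2_pure ext_hom socle(3))

lemma tgr_lift: "t \<in> tgr K i \<Longrightarrow> \<exists>s\<in>tgr K i. tmap2 \<alpha> s = t"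
  unfolding tgr_tspan
  by (erule tmap2_tspan_onto[OF _ ext_hom(2)]) (rule calg_hom_max_ideal_onto[OF artA artB ext_hom(1,3)])

lemma tbr_socle:
  assumes "dgla K" "s \<in> tspan UNIV max_ideal"
  shows "tbr K s (h \<otimes> \<iota> 1) = 0" "tbr K (h \<otimes> \<iota> 1) s = 0"
proof -
  interpret dgla K by fact
  show "tbr K s (h \<otimes> \<iota> 1) = 0"
    by (rule tspan_eqI[OF assms(2) clinear_tbr1 clinear_zero]) (simp add: tbr_pure socle(2))
  show "tbr K (h \<otimes> \<iota> 1) s = 0"
    by (rule tspan_eqI[OF assms(2) clinear_tbr2 clinear_zero]) (simp add: tbr_pure mult.commute[of "\<iota> 1"] socle(2))
qed

lemma curv_perturb:
  assumes "dgla K" "y \<in> tgr K i"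
  shows "curv K (y + u \<otimes> \<iota> 1) = curv K y + df K u \<otimes> \<iota> 1"
proof -
  interpret dgla K by fact
  have "tbr K (u \<otimes> \<iota> 1) (u \<otimes> \<iota> 1) = 0" by (simp add: tbr_pure socle(2)[OF socle(1)])
  then show ?thesis
    using tbr_socle[OF assms(1) tgr_tspan_UNIV[OF assms(2)]]
    by (simp add: curv_def tdf_linear tbr_linear tdf_pure)
qed

text \<open>Brackets with \<open>v \<otimes> \<iota> 1\<close> and \<open>u \<otimes> \<iota> 1\<close> vanish, so that in the series defining the gauge action only the
  term \<open>-dv\<close> with \<open>n = 0\<close> is new.\<close>

lemma gauge_perturb:
  assumes K: "dgla K" and p: "p \<in> tgr K 0" and w: "w \<in> tgr K 1"
  shows "gauge K (p + v \<otimes> \<iota> 1) (w + u \<otimes> \<iota> 1) = gauge K p w + (u - df K v) \<otimes> \<iota> 1"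
proof -
  interpret dgla K by fact
  let ?e = "\<lambda>z. z \<otimes> \<iota> 1"
  define X where "X = tbr K p w - tdf K p"
  have br: "tbr K p t \<in> tgr K 1" if "t \<in> tgr K 1" for t using tbr_tgr[OF artA p that] by simp
  have X: "X \<in> tgr K 1"
    unfolding X_def using cvec.subspace_diff[OF subspace_tgr br[OF w]] tdf_tgr[OF p] by simp
  have ee: "tbr K (?e v) (?e z) = 0" for z by (simp add: tbr_pure socle(2)[OF socle(1)])
  have pe: "tbr K p (?e z) = 0" for z by (rule tbr_socle(1)[OF K tgr_tspan_UNIV[OF p]])
  have ve: "tbr K (?e v) t = 0" if "t \<in> tgr K 1" for t by (rule tbr_socle(2)[OF K tgr_tspan_UNIV[OF that]])
  have start: "tbr K (p + ?e v) (w + ?e u) - tdf K (p + ?e v) = X - ?e (df K v)"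
    by (simp add: X_def tbr_linear tdf_linear tdf_pure ee pe ve[OF w])
  have Xn: "(tbr K p ^^ n) X \<in> tgr K 1" for n by (induction n) (simp_all add: X br)
  have pw: "(tbr K (p + ?e v) ^^ n) (X - ?e (df K v)) = (tbr K p ^^ n) X + (if n = 0 then - ?e (df K v) else 0)" for n
  proof (induction n)
    case (Suc n)
    then show ?case by (simp add: tbr_linear ee pe ve[OF Xn])
  qed simp
  let ?g = "\<lambda>n. (1 / fact (n + 1)) *\<^sub>C (tbr K p ^^ n) X"
  let ?d = "\<lambda>n::nat. if n = 0 then - ?e (df K v) else 0"
  have "(1 / fact (n + 1)) *\<^sub>C (tbr K (p + ?e v) ^^ n) (X - ?e (df K v)) = ?g n + ?d n" for n
    by (simp add: pw cscale_add_right cscale_one)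
  then have "Sum_any (\<lambda>n. (1 / fact (n + 1)) *\<^sub>C (tbr K (p + ?e v) ^^ n) (X - ?e (df K v))) =
      Sum_any (\<lambda>n. ?g n + ?d n)" by (simp only:)
  also have "\<dots> = Sum_any ?g + Sum_any ?d"
  proof (rule Sum_any.distrib)
    show "finite {n. ?g n \<noteq> 0}" using gauge_terms_finite[OF artA p, of w] by (simp add: X_def)
    show "finite {n. ?d n \<noteq> 0}" by (rule finite_subset[of _ "{0}"]) auto
  qed
  also have "Sum_any ?d = - ?e (df K v)" by (simp add: Sum_any.delta)
  finally have "Sum_any (\<lambda>n. (1 / fact (n + 1)) *\<^sub>C (tbr K (p + ?e v) ^^ n) (X - ?e (df K v))) =
      Sum_any ?g - ?e (df K v)" by simp
  then show ?thesis
    by (simp only: gauge_def start X_def[symmetric] ptensor_diff) (simp add: algebra_simps)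
qed

end


section \<open>The obstruction class\<close>

lemma curv_map:
  assumes "dgla K" "calg_hom \<phi>"
  shows "tmap2 \<phi> (curv K x) = curv K (tmap2 \<phi> x)"
proof -
  have "clinear \<phi>" using assms(2) by (simp add: calg_hom_def)
  then show ?thesis
    by (simp add: curv_def clinear_add[OF clinear_tmap2] clinear_scale[OF clinear_tmap2]
        tmap2_tdf[OF assms(1)] tmap2_tbr[OF assms])
qed

lemma gauge_tmap2:
  fixes \<phi> :: "'a::calgebra \<Rightarrow> 'b::calgebra"
  assumes "dgla K" "art TYPE('a)" "calg_hom \<phi>" "a \<in> tgr K 0"
  shows "tmap2 \<phi> (gauge K a w) = gauge K (tmap2 \<phi> a) (tmap2 \<phi> w)"
proof -
  have \<phi>: "clinear \<phi>" using assms(3) by (simp add: calg_hom_def)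
  show ?thesis
    by (rule dgla.gauge_map[OF assms(1,2,4) clinear_tmap2[OF \<phi>] tmap2_tbr[OF assms(1,3)] tmap2_tdf[OF assms(1) \<phi>]])
qed

lemma curv_tgr:
  assumes "dgla K" "art TYPE('a::calgebra)" "y \<in> tgr K 1"
  shows "curv K y \<in> (tgr K 2 :: ('v::cvector, 'a) tensor set)"
proof -
  have "tdf K y \<in> tgr K 2" using dgla.tdf_tgr[OF assms(1,3)] by simp
  moreover have "tbr K y y \<in> tgr K 2" using dgla.tbr_tgr[OF assms(1,2,3,3)] by simp
  ultimately show ?thesis
    unfolding curv_def by (intro cvec.subspace_add[OF subspace_tgr] cvec.subspace_scale[OF subspace_tgr])
qed

context dgla_morphism
begin

lemma MC_map_in:
  fixes \<phi> :: "'a::calgebra \<Rightarrow> 'b::calgebra"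
  assumes "art TYPE('a)" "art TYPE('b)" "calg_hom \<phi>" "xq \<in> MC L M \<chi>"
  shows "MC_map \<phi> xq \<in> MC L M \<chi>"
proof -
  obtain x q where xq: "xq = (x, q)" by (cases xq)
  then have x: "x \<in> tgr L 1" and q: "q \<in> tgr M 0" and "curv L x = 0" "gauge M q (tmap1 \<chi> x) = 0"
    using assms(4) by (auto simp: MC_def)
  have \<phi>: "clinear \<phi>" using assms(3) by (simp add: calg_hom_def)
  have in_tgr: "tmap2 \<phi> t \<in> tgr K i" if "t \<in> tgr K i" for t :: "('k::cvector, 'a) tensor" and K i
    using that unfolding tgr_tspan
    by (rule tmap2_tspan[OF _ \<phi>]) (rule calg_hom_max_ideal[OF assms(1-3)])
  have "curv L (tmap2 \<phi> x) = 0"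
    using curv_map[OF L.dgla_axioms assms(3), of x] \<open>curv L x = 0\<close> by (simp add: clinear_0[OF clinear_tmap2[OF \<phi>]])
  moreover have "gauge M (tmap2 \<phi> q) (tmap1 \<chi> (tmap2 \<phi> x)) = 0"
    using gauge_tmap2[OF M.dgla_axioms assms(1,3) q, of "tmap1 \<chi> x"] \<open>gauge M q (tmap1 \<chi> x) = 0\<close>
    by (simp add: clinear_0[OF clinear_tmap2[OF \<phi>]] tmap1_tmap2[OF clinear_hom \<phi>])
  ultimately show ?thesis
    using in_tgr[OF x] in_tgr[OF q] by (simp add: xq MC_def MC_map_def)
qed

lemma act_zero:
  assumes "a \<in> tgr M 0"
  shows "act L M \<chi> 0 0 (x, a) = (x, a)"
proof -
  have aa: "tbr M a a = 0" by (rule M.tbr_self_degree_0[OF tgr_homogeneous[OF assms]])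
  have "bch (tbr M) 0 a = 0 + a" "bch (tbr M) a 0 = a + 0"
    by (rule bch_abelian; auto simp: M.tbr_linear aa)+
  moreover have "gauge L 0 x = x" by (rule L.gauge_central) (simp_all add: L.tbr_linear L.tdf_linear)
  ultimately show ?thesis
    by (simp add: act_def M.tdf_linear clinear_0[OF clinear_tmap1[OF clinear_hom]])
qed

lemma act_tgr:
  fixes l :: "('l, 'a::calgebra) tensor"
  assumes art: "art TYPE('a)" and "l \<in> tgr L 0" "m \<in> tgr M (- 1)" "x \<in> tgr L 1" "a \<in> tgr M 0"
  shows "act L M \<chi> l m (x, a) \<in> tgr L 1 \<times> tgr M 0"
proof -
  have "tdf M m \<in> tgr M 0" using M.tdf_tgr[OF assms(3)] by simp
  moreover have "- tmap1 \<chi> l \<in> tgr M 0" by (rule cvec.subspace_neg[OF subspace_tgr hom_tgr[OF assms(2)]])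
  ultimately show ?thesis
    using assms by (simp add: act_def L.gauge_tgr[OF art] M.gauge_bch(1)[OF art])
qed

lemma MC_map_act:
  fixes \<phi> :: "'a::calgebra \<Rightarrow> 'b::calgebra"
  assumes art: "art TYPE('a)" and hom\<phi>: "calg_hom \<phi>"
    and l: "l \<in> tgr L 0" and m: "m \<in> tgr M (- 1)" and a: "a \<in> tgr M 0"
  shows "MC_map \<phi> (act L M \<chi> l m (x, a)) = act L M \<chi> (tmap2 \<phi> l) (tmap2 \<phi> m) (MC_map \<phi> (x, a))"
proof -
  have \<phi>: "clinear \<phi>" using hom\<phi> by (simp add: calg_hom_def)
  have dm: "tdf M m \<in> tgr M 0" using M.tdf_tgr[OF m] by simp
  have \<chi>l: "- tmap1 \<chi> l \<in> tgr M 0" by (rule cvec.subspace_neg[OF subspace_tgr hom_tgr[OF l]])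
  note bch = M.bch_map[OF art _ _ clinear_tmap2[OF \<phi>] tmap2_tbr[OF M.dgla_axioms hom\<phi>]]
  show ?thesis
    by (simp add: MC_map_def act_def gauge_tmap2[OF L.dgla_axioms art hom\<phi> l]
        bch[OF dm a] bch[OF M.gauge_bch(1)[OF art dm a] \<chi>l] tmap2_tdf[OF M.dgla_axioms \<phi>]
        clinear_uminus[OF clinear_tmap2[OF \<phi>]] tmap1_tmap2[OF clinear_hom \<phi>])
qed

context
  fixes \<iota> :: "complex \<Rightarrow> 'a::calgebra" and \<alpha> :: "'a \<Rightarrow> 'b::calgebra"
  assumes artA: "art TYPE('a)" and artB: "art TYPE('b)" and ext: "small_extension \<iota> \<alpha>"
begin

lemmas ext_facts = artA artB ext

lemma lift_exists: "xq \<in> MC L M \<chi> \<Longrightarrow> \<exists>yp. is_lift L M \<alpha> xq yp"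
proof -
  assume "xq \<in> MC L M \<chi>"
  then obtain x q where xq: "xq = (x, q)" "x \<in> tgr L 1" "q \<in> tgr M 0" by (auto simp: MC_def)
  obtain y p where "y \<in> tgr L 1" "tmap2 \<alpha> y = x" "p \<in> tgr M 0" "tmap2 \<alpha> p = q"
    using tgr_lift[OF ext_facts xq(2)] tgr_lift[OF ext_facts xq(3)] by blast
  then show ?thesis by (intro exI[of _ "(y, p)"]) (simp add: is_lift_def MC_map_def xq(1))
qed

lemma obstruction_pair_ex1:
  assumes xq: "xq \<in> MC L M \<chi>" and lift: "is_lift L M \<alpha> xq yp"
  shows "\<exists>!hr. obstruction_pair L M \<chi> \<iota> yp hr"
proof -
  note \<alpha> = ext_hom[OF ext_facts]
  obtain y p where yp: "yp = (y, p)" by (cases yp)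
  then have y: "y \<in> tgr L 1" and p: "p \<in> tgr M 0" and mc: "(tmap2 \<alpha> y, tmap2 \<alpha> p) \<in> MC L M \<chi>"
    using lift xq by (auto simp: is_lift_def MC_map_def)
  have "tmap2 \<alpha> (curv L y) = 0"
    using mc by (simp add: curv_map[OF L.dgla_axioms \<alpha>(1)] MC_def)
  then obtain h where h: "h \<in> gr L 2" "curv L y = h \<otimes> \<iota> 1"
    using tensor_kernel[OF ext_facts curv_tgr[OF L.dgla_axioms artA y, unfolded tgr_tspan] L.subspace_gr] by blast
  have \<chi>y: "tmap1 \<chi> y \<in> tgr M 1" by (rule hom_tgr[OF y])
  have "tmap2 \<alpha> (gauge M p (tmap1 \<chi> y)) = 0"
    using mc by (simp add: gauge_tmap2[OF M.dgla_axioms artA \<alpha>(1) p] MC_def tmap1_tmap2[OF clinear_hom \<alpha>(2)])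
  then obtain r where r: "r \<in> gr M 1" "gauge M p (tmap1 \<chi> y) = r \<otimes> \<iota> 1"
    using tensor_kernel[OF ext_facts M.gauge_tgr[OF artA p \<chi>y, unfolded tgr_tspan] M.subspace_gr] by blast
  show ?thesis
  proof (rule ex1I[of _ "(h, r)"])
    show "obstruction_pair L M \<chi> \<iota> yp (h, r)" using h r by (simp add: obstruction_pair_def yp)
    fix hr assume "obstruction_pair L M \<chi> \<iota> yp hr"
    then show "hr = (h, r)"
      using h(2) r(2) by (auto simp: obstruction_pair_def yp socle_tensor_inject[OF ext_facts])
  qed
qed

lemma obstruction_pair_cone: "obstruction_pair L M \<chi> \<iota> yp hr \<Longrightarrow> hr \<in> cone L M 2"
  by (auto simp: obstruction_pair_def cone_def)

text \<open>The first component of \<open>\<delta>(h, r)\<close> vanishes by the Bianchi identity, the second because the gauge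
  transformation by \<open>p\<close> fixes the curvature \<open>\<chi>(h) \<otimes> \<iota> 1\<close> of \<open>\<chi>(y)\<close>.\<close>

lemma obstruction_pair_closed:
  assumes lift: "is_lift L M \<alpha> xq yp" and pair: "obstruction_pair L M \<chi> \<iota> yp hr"
  shows "cone_df L M \<chi> hr = 0"
proof -
  obtain y p h r where yp: "yp = (y, p)" "hr = (h, r)" by (metis surj_pair)
  have y: "y \<in> tgr L 1" and p: "p \<in> tgr M 0" using lift by (auto simp: is_lift_def yp)
  have h: "curv L y = h \<otimes> \<iota> 1" and r: "gauge M p (tmap1 \<chi> y) = r \<otimes> \<iota> 1"
    using pair by (auto simp: obstruction_pair_def yp)
  have "df L h \<otimes> \<iota> 1 = tdf L (curv L y)" by (simp add: h L.tdf_pure)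
  also have "\<dots> = tbr L (curv L y) y" by (rule L.bianchi[OF tgr_homogeneous[OF y]])
  also have "\<dots> = 0" by (simp add: h tbr_socle[OF ext_facts L.dgla_axioms tgr_tspan_UNIV[OF y]])
  finally have dh: "df L h = 0" by (simp add: socle_tensor_zero[OF ext_facts])
  have curv\<chi>: "curv M (tmap1 \<chi> y) = \<chi> h \<otimes> \<iota> 1"
  proof -
    have "curv M (tmap1 \<chi> y) = tmap1 \<chi> (curv L y)"
      by (simp add: curv_def hom_tdf hom_tbr clinear_add[OF clinear_tmap1[OF clinear_hom]]
          clinear_scale[OF clinear_tmap1[OF clinear_hom]])
    then show ?thesis by (simp add: h tmap1_pure[OF clinear_hom])
  qed
  have "curv M (r \<otimes> \<iota> 1) = nexp (tbr M p) (\<chi> h \<otimes> \<iota> 1)"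
    using M.curv_gauge[OF artA p tgr_homogeneous[OF hom_tgr[OF y]]] by (simp add: r curv\<chi>)
  also have "\<dots> = \<chi> h \<otimes> \<iota> 1"
    by (rule nexp_fixed[OF M.clinear_tbr2]) (rule tbr_socle[OF ext_facts M.dgla_axioms tgr_tspan_UNIV[OF p]])
  also have "curv M (r \<otimes> \<iota> 1) = df M r \<otimes> \<iota> 1"
    by (simp add: curv_def M.tdf_pure M.tbr_pure socle(2)[OF ext_facts socle(1)[OF ext_facts]])
  finally have "df M r = \<chi> h" by (simp add: socle_tensor_inject[OF ext_facts])
  then show ?thesis by (simp add: yp cone_df_def dh zero_prod_def)
qed

text \<open>Two lifts of the same point differ by some \<open>(u, v) \<otimes> \<iota> 1\<close>, and conversely any such change of a lift is
  again a lift; hence the pairs attained by the lifts form one coset of the coboundaries.\<close>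

lemma obstruction_pair_perturb:
  assumes y: "y \<in> tgr L 1" and p: "p \<in> tgr M 0" and u: "u \<in> gr L 1" and v: "v \<in> gr M 0"
    and pair: "obstruction_pair L M \<chi> \<iota> (y, p) hr"
  shows "obstruction_pair L M \<chi> \<iota> (y + u \<otimes> \<iota> 1, p + v \<otimes> \<iota> 1) (hr + cone_df L M \<chi> (u, v))"
proof -
  obtain h r where hr: "hr = (h, r)" by (cases hr)
  have "tmap1 \<chi> (y + u \<otimes> \<iota> 1) = tmap1 \<chi> y + \<chi> u \<otimes> \<iota> 1"
    by (simp add: clinear_add[OF clinear_tmap1[OF clinear_hom]] tmap1_pure[OF clinear_hom])
  moreover have "df L u \<in> gr L 2" "df M v \<in> gr M 1" using L.df_gr[OF u] M.df_gr[OF v] by simp_all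
  ultimately show ?thesis
    using pair hom_gr[OF u]
    by (simp add: obstruction_pair_def hr cone_df_def curv_perturb[OF ext_facts L.dgla_axioms y]
        gauge_perturb[OF ext_facts M.dgla_axioms p hom_tgr[OF y]] ptensor_simps
        cvec.subspace_add[OF L.subspace_gr] cvec.subspace_add[OF M.subspace_gr]
        cvec.subspace_diff[OF M.subspace_gr])
qed

lemma obstruction_independent:
  assumes xq: "xq \<in> MC L M \<chi>"
    and lift: "is_lift L M \<alpha> xq yp" and pair: "obstruction_pair L M \<chi> \<iota> yp hr"
    and lift': "is_lift L M \<alpha> xq yp'" and pair': "obstruction_pair L M \<chi> \<iota> yp' hr'"
  shows "cone_class L M \<chi> 2 hr = cone_class L M \<chi> 2 hr'"
proof -
  note \<alpha> = ext_hom[OF ext_facts]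
  obtain y p y' p' where yp: "yp = (y, p)" "yp' = (y', p')" by (metis surj_pair)
  have y: "y \<in> tgr L 1" "y' \<in> tgr L 1" and p: "p \<in> tgr M 0" "p' \<in> tgr M 0"
    and eq: "tmap2 \<alpha> y = tmap2 \<alpha> y'" "tmap2 \<alpha> p = tmap2 \<alpha> p'"
    using lift lift' by (auto simp: is_lift_def MC_map_def yp)
  have "y - y' \<in> tgr L 1" "p - p' \<in> tgr M 0" using y p by (auto intro: cvec.subspace_diff[OF subspace_tgr])
  moreover have "tmap2 \<alpha> (y - y') = 0" "tmap2 \<alpha> (p - p') = 0"
    using eq by (simp_all add: clinear_diff[OF clinear_tmap2[OF \<alpha>(2)]])
  ultimately obtain u v where u: "u \<in> gr L 1" "y - y' = u \<otimes> \<iota> 1" and v: "v \<in> gr M 0" "p - p' = v \<otimes> \<iota> 1"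
    unfolding tgr_tspan using tensor_kernel[OF ext_facts] L.subspace_gr M.subspace_gr by metis
  have "yp = (y' + u \<otimes> \<iota> 1, p' + v \<otimes> \<iota> 1)" using u(2) v(2) by (simp add: yp flip: u(2) v(2))
  then have "obstruction_pair L M \<chi> \<iota> yp (hr' + cone_df L M \<chi> (u, v))"
    using obstruction_pair_perturb[OF y(2) p(2) u(1) v(1)] pair' by (simp add: yp)
  then have "hr = hr' + cone_df L M \<chi> (u, v)" using obstruction_pair_ex1[OF xq lift] pair by blast
  then show ?thesis
    unfolding cone_class_eq_iff using u(1) v(1) by (intro bexI[of _ "(u, v)"]) (simp_all add: cone_def)
qed

lemma obstruction_pair_zero:
  assumes "y \<in> tgr L 1" "p \<in> tgr M 0"
  shows "obstruction_pair L M \<chi> \<iota> (y, p) 0 \<longleftrightarrow> (y, p) \<in> MC L M \<chi>"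
  using assms cvec.subspace_0[OF L.subspace_gr] cvec.subspace_0[OF M.subspace_gr]
  by (simp add: obstruction_pair_def MC_def zero_prod_def)

lemma obstruction_vanishes_iff:
  assumes xq: "xq \<in> MC L M \<chi>"
    and lift: "is_lift L M \<alpha> xq yp" and pair: "obstruction_pair L M \<chi> \<iota> yp hr"
  shows "cone_class L M \<chi> 2 hr = cone_class L M \<chi> 2 0 \<longleftrightarrow> (\<exists>z\<in>MC L M \<chi>. MC_map \<alpha> z = xq)"
proof
  note \<alpha> = ext_hom[OF ext_facts]
  obtain y p where yp: "yp = (y, p)" by (cases yp)
  have y: "y \<in> tgr L 1" and p: "p \<in> tgr M 0" and mc: "MC_map \<alpha> (y, p) = xq"
    using lift by (auto simp: is_lift_def yp)
  assume "cone_class L M \<chi> 2 hr = cone_class L M \<chi> 2 0"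
  then obtain u v where u: "u \<in> gr L 1" and v: "v \<in> gr M 0" and hr: "hr = cone_df L M \<chi> (u, v)"
    unfolding cone_class_eq_iff by (auto simp: cone_def)
  have uv: "- u \<in> gr L 1" "- v \<in> gr M 0" using u v cvec.subspace_neg[OF L.subspace_gr] cvec.subspace_neg[OF M.subspace_gr] by blast+
  let ?y = "y + (- u) \<otimes> \<iota> 1" and ?p = "p + (- v) \<otimes> \<iota> 1"
  have "cone_df L M \<chi> (- u, - v) = - hr"
    using clinear_uminus[OF clinear_cone_df, of "(u, v)"] by (simp add: hr)
  then have "obstruction_pair L M \<chi> \<iota> (?y, ?p) 0"
    using obstruction_pair_perturb[OF y p uv, of hr] pair by (simp add: yp)
  moreover have in_tgr: "?y \<in> tgr L 1" "?p \<in> tgr M 0"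
    using y p uv socle_tgr[OF ext_facts] by (auto intro!: cvec.subspace_add[OF subspace_tgr])
  ultimately have "(?y, ?p) \<in> MC L M \<chi>" by (simp add: obstruction_pair_zero)
  moreover have "MC_map \<alpha> (?y, ?p) = xq"
    using mc by (simp add: MC_map_def clinear_add[OF clinear_tmap2[OF \<alpha>(2)]] tmap2_socle[OF ext_facts])
  ultimately show "\<exists>z\<in>MC L M \<chi>. MC_map \<alpha> z = xq" by blast
next
  assume "\<exists>z\<in>MC L M \<chi>. MC_map \<alpha> z = xq"
  then obtain y p where z: "(y, p) \<in> MC L M \<chi>" "MC_map \<alpha> (y, p) = xq" by auto
  then have in_tgr: "y \<in> tgr L 1" "p \<in> tgr M 0" by (auto simp: MC_def)
  then have "is_lift L M \<alpha> xq (y, p)" using z(2) by (simp add: is_lift_def)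
  moreover have "obstruction_pair L M \<chi> \<iota> (y, p) 0" using z(1) by (simp add: obstruction_pair_zero in_tgr)
  ultimately show "cone_class L M \<chi> 2 hr = cone_class L M \<chi> 2 0"
    using obstruction_independent[OF xq lift pair] by blast
qed

text \<open>The factors \<open>e\<^bsup>-\<chi>(l)\<^esup>\<close> and \<open>e\<^bsup>\<chi>(l)\<^esup>\<close> cancel, and \<open>e\<^bsup>dm\<^esup>\<close> fixes \<open>r \<otimes> \<iota> 1\<close> because \<open>d(dm) = 0\<close> and
  brackets with \<open>\<iota> 1\<close> vanish.\<close>

lemma obstruction_pair_act:
  assumes l: "l \<in> tgr L 0" and m: "m \<in> tgr M (- 1)" and y: "y \<in> tgr L 1" and p: "p \<in> tgr M 0"
    and pair: "obstruction_pair L M \<chi> \<iota> (y, p) hr"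
  shows "obstruction_pair L M \<chi> \<iota> (act L M \<chi> l m (y, p)) hr"
proof -
  obtain h r where hr: "hr = (h, r)" by (cases hr)
  have h: "h \<in> gr L 2" "curv L y = h \<otimes> \<iota> 1" and r: "r \<in> gr M 1" "gauge M p (tmap1 \<chi> y) = r \<otimes> \<iota> 1"
    using pair by (auto simp: obstruction_pair_def hr)
  have dm: "tdf M m \<in> tgr M 0" using M.tdf_tgr[OF m] by simp
  have \<chi>l: "tmap1 \<chi> l \<in> tgr M 0" by (rule hom_tgr[OF l])
  have n\<chi>l: "- tmap1 \<chi> l \<in> tgr M 0" by (rule cvec.subspace_neg[OF subspace_tgr \<chi>l])
  have "curv L (gauge L l y) = nexp (tbr L l) (h \<otimes> \<iota> 1)"
    using L.curv_gauge[OF artA l tgr_homogeneous[OF y]] by (simp add: h)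
  also have "\<dots> = h \<otimes> \<iota> 1"
    by (rule nexp_fixed[OF L.clinear_tbr2]) (rule tbr_socle[OF ext_facts L.dgla_axioms tgr_tspan_UNIV[OF l]])
  finally have curv: "curv L (gauge L l y) = h \<otimes> \<iota> 1" .
  have "tmap1 \<chi> (gauge L l y) = gauge M (tmap1 \<chi> l) (tmap1 \<chi> y)"
    by (rule L.gauge_map[OF artA l clinear_tmap1[OF clinear_hom] hom_tbr hom_tdf])
  then have "gauge M (bch (tbr M) (bch (tbr M) (tdf M m) p) (- tmap1 \<chi> l)) (tmap1 \<chi> (gauge L l y)) =
      gauge M (tdf M m) (r \<otimes> \<iota> 1)"
    by (simp add: M.gauge_bch[OF artA] dm p n\<chi>l M.gauge_inverse[OF artA \<chi>l] r(2))
  also have "\<dots> = r \<otimes> \<iota> 1"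
    by (rule M.gauge_central)
      (simp_all add: M.tdf_tdf tbr_socle[OF ext_facts M.dgla_axioms tgr_tspan_UNIV[OF dm]])
  finally show ?thesis using curv h(1) r(1) by (simp add: obstruction_pair_def hr act_def)
qed

text \<open>Equality of classes yields group elements over \<open>B\<close>; their lifts to \<open>A\<close> transport a lift of one point to a lift of
  the other.\<close>

lemma obstruction_def_class:
  assumes xq: "xq \<in> MC L M \<chi>" and xq': "xq' \<in> MC L M \<chi>"
    and same: "def_class L M \<chi> xq' = def_class L M \<chi> xq"
    and lift: "is_lift L M \<alpha> xq yp" and pair: "obstruction_pair L M \<chi> \<iota> yp hr"
    and lift': "is_lift L M \<alpha> xq' yp'" and pair': "obstruction_pair L M \<chi> \<iota> yp' hr'"
  shows "cone_class L M \<chi> 2 hr' = cone_class L M \<chi> 2 hr"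
proof -
  note \<alpha> = ext_hom[OF ext_facts]
  \<comment> \<open>A class contains its base point because \<open>(0, 0)\<close> acts trivially.\<close>
  have "act L M \<chi> 0 0 xq' = xq'" using xq' act_zero by (auto simp: MC_def)
  then have "xq' = act L M \<chi> 0 0 xq'" "0 \<in> tgr L 0" "0 \<in> tgr M (- 1)"
    by (simp_all add: cvec.subspace_0[OF subspace_tgr])
  then have "xq' \<in> def_class L M \<chi> xq'" unfolding def_class_def by blast
  then obtain l m where lm: "l \<in> tgr L 0" "m \<in> tgr M (- 1)" "xq' = act L M \<chi> l m xq"
    unfolding same by (auto simp: def_class_def)
  obtain y p where yp: "yp = (y, p)" by (cases yp)
  have y: "y \<in> tgr L 1" and p: "p \<in> tgr M 0" and mc: "MC_map \<alpha> (y, p) = xq"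
    using lift by (auto simp: is_lift_def yp)
  obtain l' m' where l': "l' \<in> tgr L 0" "tmap2 \<alpha> l' = l" and m': "m' \<in> tgr M (- 1)" "tmap2 \<alpha> m' = m"
    using tgr_lift[OF ext_facts lm(1)] tgr_lift[OF ext_facts lm(2)] by blast
  have "is_lift L M \<alpha> xq' (act L M \<chi> l' m' (y, p))"
    using act_tgr[OF artA l'(1) m'(1) y p] MC_map_act[OF artA \<alpha>(1) l'(1) m'(1) p, of y]
    by (simp add: is_lift_def lm(3) l'(2) m'(2) mc)
  moreover have "obstruction_pair L M \<chi> \<iota> (act L M \<chi> l' m' (y, p)) hr"
    using obstruction_pair_act[OF l'(1) m'(1) y p] pair by (simp add: yp)
  ultimately show ?thesis using obstruction_independent[OF xq' lift' pair'] by blast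
qed

lemma obstruction_eq:
  assumes xq: "xq \<in> MC L M \<chi>" and lift: "is_lift L M \<alpha> xq yp" and pair: "obstruction_pair L M \<chi> \<iota> yp hr"
  shows "obstruction L M \<chi> \<iota> \<alpha> (def_class L M \<chi> xq) = cone_class L M \<chi> 2 hr"
  unfolding obstruction_def
proof (rule the_equality)
  show "\<exists>xq' yp' hr'. xq' \<in> MC L M \<chi> \<and> def_class L M \<chi> xq' = def_class L M \<chi> xq \<and>
     is_lift L M \<alpha> xq' yp' \<and> obstruction_pair L M \<chi> \<iota> yp' hr' \<and>
     cone_class L M \<chi> 2 hr = cone_class L M \<chi> 2 hr'"
    using assms by blast
  fix \<omega>
  assume "\<exists>xq' yp' hr'. xq' \<in> MC L M \<chi> \<and> def_class L M \<chi> xq' = def_class L M \<chi> xq \<and>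
     is_lift L M \<alpha> xq' yp' \<and> obstruction_pair L M \<chi> \<iota> yp' hr' \<and> \<omega> = cone_class L M \<chi> 2 hr'"
  then show "\<omega> = cone_class L M \<chi> 2 hr"
    using obstruction_def_class[OF xq _ _ lift pair] by blast
qed

lemma obstruction_witness:
  assumes "xq \<in> MC L M \<chi>"
  obtains yp hr where "is_lift L M \<alpha> xq yp" "obstruction_pair L M \<chi> \<iota> yp hr"
    "obstruction L M \<chi> \<iota> \<alpha> (def_class L M \<chi> xq) = cone_class L M \<chi> 2 hr"
proof -
  obtain yp where lift: "is_lift L M \<alpha> xq yp" using lift_exists[OF assms] by blast
  obtain hr where pair: "obstruction_pair L M \<chi> \<iota> yp hr"
    using obstruction_pair_ex1[OF assms lift] by blast
  show thesis by (rule that[OF lift pair obstruction_eq[OF assms lift pair]])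
qed

lemma obstruction_in_cohomology:
  assumes "\<xi> \<in> Def L M \<chi>"
  shows "obstruction L M \<chi> \<iota> \<alpha> \<xi> \<in> cone_coh L M \<chi> 2"
proof -
  obtain xq where xq: "xq \<in> MC L M \<chi>" "\<xi> = def_class L M \<chi> xq" using assms by (auto simp: Def_def)
  obtain yp hr where w: "is_lift L M \<alpha> xq yp" "obstruction_pair L M \<chi> \<iota> yp hr"
    "obstruction L M \<chi> \<iota> \<alpha> (def_class L M \<chi> xq) = cone_class L M \<chi> 2 hr"
    by (rule obstruction_witness[OF xq(1)]) (rule that)
  then show ?thesis
    using obstruction_pair_closed[OF w(1,2)] obstruction_pair_cone[OF w(2)]
    by (simp add: cone_coh_def xq(2))
qed

lemma obstruction_zero_iff:
  assumes "\<xi> \<in> Def L M \<chi>"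
  shows "obstruction L M \<chi> \<iota> \<alpha> \<xi> = cone_class L M \<chi> 2 0 \<longleftrightarrow>
    (\<exists>z\<in>MC L M \<chi>. def_class L M \<chi> (MC_map \<alpha> z) = \<xi>)"
proof
  note \<alpha> = ext_hom[OF ext_facts]
  obtain xq where xq: "xq \<in> MC L M \<chi>" "\<xi> = def_class L M \<chi> xq" using assms by (auto simp: Def_def)
  obtain yp hr where w: "is_lift L M \<alpha> xq yp" "obstruction_pair L M \<chi> \<iota> yp hr"
    "obstruction L M \<chi> \<iota> \<alpha> (def_class L M \<chi> xq) = cone_class L M \<chi> 2 hr"
    by (rule obstruction_witness[OF xq(1)]) (rule that)
  assume "obstruction L M \<chi> \<iota> \<alpha> \<xi> = cone_class L M \<chi> 2 0"
  then show "\<exists>z\<in>MC L M \<chi>. def_class L M \<chi> (MC_map \<alpha> z) = \<xi>"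
    using obstruction_vanishes_iff[OF xq(1) w(1,2)] w(3) xq(2) by auto
next
  note \<alpha> = ext_hom[OF ext_facts]
  assume "\<exists>z\<in>MC L M \<chi>. def_class L M \<chi> (MC_map \<alpha> z) = \<xi>"
  then obtain z where z: "z \<in> MC L M \<chi>" "\<xi> = def_class L M \<chi> (MC_map \<alpha> z)" by blast
  have mc: "MC_map \<alpha> z \<in> MC L M \<chi>" by (rule MC_map_in[OF artA artB \<alpha>(1) z(1)])
  obtain yp hr where w: "is_lift L M \<alpha> (MC_map \<alpha> z) yp" "obstruction_pair L M \<chi> \<iota> yp hr"
    "obstruction L M \<chi> \<iota> \<alpha> (def_class L M \<chi> (MC_map \<alpha> z)) = cone_class L M \<chi> 2 hr"
    by (rule obstruction_witness[OF mc]) (rule that)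
  then show "obstruction L M \<chi> \<iota> \<alpha> \<xi> = cone_class L M \<chi> 2 0"
    using obstruction_vanishes_iff[OF mc w(1,2)] z by auto
qed

end

text \<open>Over the second extension \<open>h \<otimes> \<phi>(\<iota> 1) = ch \<otimes> \<iota>' 1\<close>.\<close>

lemma obstruction_natural:
  fixes \<iota> :: "complex \<Rightarrow> 'a::calgebra" and \<alpha> :: "'a \<Rightarrow> 'b::calgebra"
    and \<iota>' :: "complex \<Rightarrow> 'c::calgebra" and \<alpha>' :: "'c \<Rightarrow> 'd::calgebra"
  assumes art: "art TYPE('a)" "art TYPE('b)" "art TYPE('c)" "art TYPE('d)"
    and ext: "small_extension \<iota> \<alpha>" and ext': "small_extension \<iota>' \<alpha>'"
    and mor: "small_extension_hom c \<phi> \<psi> \<iota> \<alpha> \<iota>' \<alpha>'"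
    and xq: "xq \<in> MC L M \<chi>"
  shows "obstruction L M \<chi> \<iota>' \<alpha>' (def_class L M \<chi> (MC_map \<psi> xq)) =
    coh_scale L M \<chi> 2 c (obstruction L M \<chi> \<iota> \<alpha> (def_class L M \<chi> xq))"
proof -
  note mor' = mor[unfolded small_extension_hom_def]
  have \<phi>: "calg_hom \<phi>" "clinear \<phi>" using mor'[THEN conjunct1] by (simp_all add: calg_hom_def)
  have \<psi>: "calg_hom \<psi>" "clinear \<psi>"
    using mor'[THEN conjunct2, THEN conjunct1] by (simp_all add: calg_hom_def)
  have \<iota>: "\<phi> (\<iota> z) = \<iota>' (c * z)" for z
    by (rule mor'[THEN conjunct2, THEN conjunct2, THEN conjunct1, THEN spec])
  have sq: "\<psi> (\<alpha> a) = \<alpha>' (\<phi> a)" for a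
    by (rule mor'[THEN conjunct2, THEN conjunct2, THEN conjunct2, THEN spec])
  note \<alpha> = ext_hom[OF art(1,2) ext] and \<alpha>' = ext_hom[OF art(3,4) ext']
  obtain yp hr where w: "is_lift L M \<alpha> xq yp" "obstruction_pair L M \<chi> \<iota> yp hr"
    "obstruction L M \<chi> \<iota> \<alpha> (def_class L M \<chi> xq) = cone_class L M \<chi> 2 hr"
    by (rule obstruction_witness[OF art(1,2) ext xq]) (rule that)
  obtain y p h r where yp: "yp = (y, p)" "hr = (h, r)" by (metis surj_pair)
  have y: "y \<in> tgr L 1" and p: "p \<in> tgr M 0" and mc: "MC_map \<alpha> (y, p) = xq"
    using w(1) by (auto simp: is_lift_def yp)
  have h: "h \<in> gr L 2" "curv L y = h \<otimes> \<iota> 1" and r: "r \<in> gr M 1" "gauge M p (tmap1 \<chi> y) = r \<otimes> \<iota> 1"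
    using w(2) by (auto simp: obstruction_pair_def yp)
  have in_tgr: "tmap2 \<phi> t \<in> tgr K i" if "t \<in> tgr K i" for t :: "('k::cvector, 'a) tensor" and K i
    using that unfolding tgr_tspan
    by (rule tmap2_tspan[OF _ \<phi>(2)]) (rule calg_hom_max_ideal[OF art(1,3) \<phi>(1)])
  have comp: "tmap2 \<alpha>' (tmap2 \<phi> t) = tmap2 \<psi> (tmap2 \<alpha> t)" for t :: "('k::cvector, 'a) tensor"
    by (simp add: tmap2_compose \<phi>(2) \<psi>(2) \<alpha>(2) \<alpha>'(2) sq)
  have lift: "is_lift L M \<alpha>' (MC_map \<psi> xq) (MC_map \<phi> yp)"
    using in_tgr[OF y] in_tgr[OF p] mc by (auto simp: is_lift_def yp MC_map_def comp)
  have e: "x \<otimes> \<phi> (\<iota> 1) = (c *\<^sub>C x) \<otimes> \<iota>' 1" for x :: "'k::cvector"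
    using small_extension_socle(4)[OF art(3,4) ext', of c] by (simp add: \<iota> ptensor_simps)
  have "curv L (tmap2 \<phi> y) = (c *\<^sub>C h) \<otimes> \<iota>' 1"
    by (simp add: h tmap2_pure[OF \<phi>(2)] e flip: curv_map[OF L.dgla_axioms \<phi>(1)])
  moreover have "gauge M (tmap2 \<phi> p) (tmap1 \<chi> (tmap2 \<phi> y)) = (c *\<^sub>C r) \<otimes> \<iota>' 1"
    using gauge_tmap2[OF M.dgla_axioms art(1) \<phi>(1) p, of "tmap1 \<chi> y"]
    by (simp add: r tmap2_pure[OF \<phi>(2)] e tmap1_tmap2[OF clinear_hom \<phi>(2)])
  ultimately have "obstruction_pair L M \<chi> \<iota>' (MC_map \<phi> yp) (c *\<^sub>C hr)"
    using h(1) r(1) by (simp add: obstruction_pair_def yp MC_map_def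
        cvec.subspace_scale[OF L.subspace_gr] cvec.subspace_scale[OF M.subspace_gr])
  then have "obstruction L M \<chi> \<iota>' \<alpha>' (def_class L M \<chi> (MC_map \<psi> xq)) = cone_class L M \<chi> 2 (c *\<^sub>C hr)"
    by (rule obstruction_eq[OF art(3,4) ext' MC_map_in[OF art(2,4) \<psi>(1) xq] lift])
  then show ?thesis by (simp add: w(3) coh_scale_class)
qed

end


section \<open>The tangent space\<close>

lemma triv_sel [simp]:
  "sca 0 = 0" "inf 0 = 0" "sca (x + y) = sca x + sca y" "inf (x + y) = inf x + inf y"
  "sca (c *\<^sub>C x) = c * sca x" "inf (c *\<^sub>C x) = c *\<^sub>C inf x"
  by (simp_all add: zero_triv_def plus_triv_def cscale_triv_def)

lemma clinear_inf: "clinear inf"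
  by (simp add: clinear_iff)

lemma clinear_triv_map: "clinear f \<Longrightarrow> clinear (triv_map f)"
  by (auto simp: clinear_iff triv_map_def plus_triv_def cscale_triv_def)

lemma max_ideal_triv_times: "a \<in> max_ideal \<Longrightarrow> b \<in> max_ideal \<Longrightarrow> a * b = (0 :: 'v::cvector triv)"
  by (simp add: max_ideal_triv times_triv_def zero_triv_def)

lemma triv_map_max_ideal: "a \<in> max_ideal \<Longrightarrow> triv_map f a \<in> max_ideal"
  by (simp add: max_ideal_triv triv_map_def)

lemma tgr_dual:
  fixes t :: "('v::cvector, dual) tensor"
  assumes t: "t \<in> tgr K i"
  shows "contract inf t \<otimes> Triv 0 1 = t"
proof (rule tspan_eqI[OF t[unfolded tgr_tspan], where F = "\<lambda>t. contract inf t \<otimes> Triv 0 1" and G = "\<lambda>t. t"])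
  show "clinear (\<lambda>t :: ('v, dual) tensor. contract inf t \<otimes> Triv 0 (1 :: complex))"
    by (rule clinear_compose[OF clinear_ptensor(1) clinear_contract[OF clinear_inf]])
  fix v :: 'v and a :: dual assume "a \<in> max_ideal"
  then have "a = inf a *\<^sub>C Triv 0 1"
    by (cases a) (simp add: max_ideal_triv cscale_triv_def cscale_complex_def)
  then show "contract inf (v \<otimes> a) \<otimes> Triv 0 1 = v \<otimes> a"
    by (metis contract_pure[OF clinear_inf] ptensor_simps(3,4))
qed (rule clinear_id)

context dgla
begin

lemma tbr_triv:
  assumes "s \<in> tspan UNIV max_ideal" "t \<in> tspan UNIV max_ideal"
  shows "tbr K s t = (0 :: ('v, 'u::cvector triv) tensor)"
proof -
  have "tbr K s t \<in> {0}"
    by (rule tspan_map2[OF assms cbilinear_tbr])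
      (auto simp: tbr_pure max_ideal_triv_times cvec.subspace_def)
  then show ?thesis by simp
qed

lemma gauge_triv:
  assumes a: "a \<in> tgr K 0" and w: "w \<in> tgr K 1"
  shows "gauge K a w = w - (tdf K a :: ('v, 'u::cvector triv) tensor)"
proof -
  have da: "tdf K a \<in> tgr K 1" using tdf_tgr[OF a] by simp
  have aw: "tbr K a w = 0" "tbr K a (tdf K a) = 0" by (rule tbr_triv; rule tgr_tspan_UNIV; fact)+
  have "(tbr K a ^^ n) (- tdf K a) = (if n = 0 then - tdf K a else 0)" for n
    by (induction n) (simp_all add: tbr_linear aw)
  then have "(1 / fact (n + 1)) *\<^sub>C (tbr K a ^^ n) (tbr K a w - tdf K a) = (if n = 0 then - tdf K a else 0)" for n
    by (simp add: aw cscale_one)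
  then show ?thesis unfolding gauge_def by (simp only:) (simp add: Sum_any.delta)
qed

lemma bch_triv:
  assumes "s \<in> tspan UNIV max_ideal" "t \<in> tspan UNIV max_ideal"
  shows "bch (tbr K) s t = s + (t :: ('v, 'u::cvector triv) tensor)"
  by (rule bch_abelian, rule tbr_triv) (use assms cvec.subspace_0[OF subspace_tspan] in auto)

end

context dgla_morphism
begin

text \<open>The cone with coefficients in \<open>\<mm>\<^sub>A\<close>.  When \<open>\<mm>\<^sub>A\<close> has square zero, \<open>MC\<^sub>\<chi>(A)\<close> is its space of
  \<open>1\<close>-cocycles and the classes are the cosets of the coboundaries.\<close>

definition tcone :: "int \<Rightarrow> (('l, 'a::calgebra) tensor \<times> ('m, 'a) tensor) set"
  where "tcone i = tgr L i \<times> tgr M (i - 1)"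

definition tcone_df ::
    "('l, 'a::calgebra) tensor \<times> ('m, 'a) tensor \<Rightarrow> ('l, 'a) tensor \<times> ('m, 'a) tensor"
  where "tcone_df z = (tdf L (fst z), tmap1 \<chi> (fst z) - tdf M (snd z))"

lemma subspace_tcone: "cvec.subspace (tcone i)"
  using subspace_tgr[of L i] subspace_tgr[of M "i - 1"]
  by (auto simp: tcone_def cvec.subspace_def zero_prod_def)

lemma clinear_tcone_df: "clinear tcone_df"
  unfolding clinear_iff
  by (auto simp: tcone_df_def L.tdf_linear M.tdf_linear clinear_add[OF clinear_tmap1[OF clinear_hom]]
      clinear_scale[OF clinear_tmap1[OF clinear_hom]] cvec.scale_right_diff_distrib)

lemma tcone_df_tcone:
  assumes "z \<in> tcone i"
  shows "tcone_df z \<in> tcone (i + 1)"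
  using assms L.tdf_tgr[of "fst z" i] M.tdf_tgr[of "snd z" "i - 1"] hom_tgr[of "fst z" i]
  by (auto simp: tcone_def tcone_df_def intro!: cvec.subspace_diff[OF subspace_tgr])

lemma MC_triv:
  "(MC L M \<chi> :: (('l, 'u::cvector triv) tensor \<times> ('m, 'u triv) tensor) set) = {z \<in> tcone 1. tcone_df z = 0}"
proof -
  have "curv L x = tdf L x" if "x \<in> tgr L 1" for x :: "('l, 'u triv) tensor"
    using L.tbr_triv[OF tgr_tspan_UNIV[OF that] tgr_tspan_UNIV[OF that]] by (simp add: curv_def)
  moreover have "gauge M a (tmap1 \<chi> x) = tmap1 \<chi> x - tdf M a" if "x \<in> tgr L 1" "a \<in> tgr M 0"
    for x :: "('l, 'u triv) tensor" and a
    by (rule M.gauge_triv[OF that(2) hom_tgr[OF that(1)]])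
  ultimately show ?thesis
    unfolding MC_def tcone_def tcone_df_def zero_prod_def set_eq_iff
    by (simp add: conj_ac cong: conj_cong)
qed

text \<open>The pair \<open>(e\<^sup>l, e\<^bsup>dm\<^esup>)\<close> acts by subtracting the coboundary of \<open>(l, m)\<close>.\<close>

lemma def_class_triv:
  assumes "z \<in> tcone 1"
  shows "def_class L M \<chi> z =
    {z + tcone_df b | b :: ('l, 'u::cvector triv) tensor \<times> ('m, 'u triv) tensor. b \<in> tcone 0}"
proof -
  obtain x a where z: "z = (x, a)" "x \<in> tgr L 1" "a \<in> tgr M 0" using assms by (auto simp: tcone_def)
  have act: "act L M \<chi> l m z = z + tcone_df (- (l, m))" if l: "l \<in> tgr L 0" and m: "m \<in> tgr M (- 1)" for l m
  proof -
    have dm: "tdf M m \<in> tgr M 0" using M.tdf_tgr[OF m] by simp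
    have \<chi>l: "- tmap1 \<chi> l \<in> tgr M 0" by (rule cvec.subspace_neg[OF subspace_tgr hom_tgr[OF l]])
    have sum: "tdf M m + a \<in> tgr M 0" by (rule cvec.subspace_add[OF subspace_tgr dm z(3)])
    show ?thesis
      by (simp add: act_def z(1) L.gauge_triv[OF l z(2)]
          M.bch_triv[OF tgr_tspan_UNIV[OF dm] tgr_tspan_UNIV[OF z(3)]]
          M.bch_triv[OF tgr_tspan_UNIV[OF sum] tgr_tspan_UNIV[OF \<chi>l]]
          clinear_uminus[OF clinear_tmap1[OF clinear_hom]] L.tdf_linear M.tdf_linear tcone_df_def)
  qed
  have neg: "- b \<in> tcone 0" if "b \<in> tcone 0" for b :: "('l, 'u triv) tensor \<times> ('m, 'u triv) tensor"
    by (rule cvec.subspace_neg[OF subspace_tcone that])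
  show ?thesis
  proof (intro equalityI subsetI)
    fix p assume "p \<in> def_class L M \<chi> z"
    then obtain l m where "l \<in> tgr L 0" "m \<in> tgr M (- 1)" "p = z + tcone_df (- (l, m))"
      using act unfolding def_class_def by auto
    moreover from this have "- (l, m) \<in> tcone 0" by (intro neg) (simp add: tcone_def)
    ultimately show "p \<in> {z + tcone_df b | b. b \<in> tcone 0}" by blast
  next
    fix p assume "p \<in> {z + tcone_df b | b. b \<in> tcone 0}"
    then obtain b where b: "b \<in> tcone 0" "p = z + tcone_df b" by blast
    then have "- b \<in> tcone 0" by (intro neg)
    then obtain l m where lm: "- b = (l, m)" "l \<in> tgr L 0" "m \<in> tgr M (- 1)" by (auto simp: tcone_def)
    then have "p = act L M \<chi> l m z" using act[OF lm(2,3)] b(2) by (simp flip: lm(1))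
    then show "p \<in> def_class L M \<chi> z" unfolding def_class_def using lm by blast
  qed
qed

lemma def_class_triv_eq_iff:
  fixes z z' :: "('l, 'u::cvector triv) tensor \<times> ('m, 'u triv) tensor"
  assumes "z \<in> tcone 1" "z' \<in> tcone 1"
  shows "def_class L M \<chi> z = def_class L M \<chi> z' \<longleftrightarrow> (\<exists>b\<in>tcone 0. z - z' = tcone_df b)"
  unfolding assms[THEN def_class_triv] by (rule coset_eq_iff[OF clinear_tcone_df subspace_tcone])

lemma MC_map_triv:
  fixes f :: "'u::cvector \<Rightarrow> 'w::cvector"
  assumes f: "clinear f"
  shows "clinear (MC_map (triv_map f) :: ('l, 'u triv) tensor \<times> ('m, 'u triv) tensor \<Rightarrow> _)"
    and "z \<in> tcone i \<Longrightarrow> MC_map (triv_map f) z \<in> tcone i"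
    and "MC_map (triv_map f) (tcone_df z) = tcone_df (MC_map (triv_map f) z)"
proof -
  note lin = clinear_triv_map[OF f]
  show "clinear (MC_map (triv_map f) :: ('l, 'u triv) tensor \<times> ('m, 'u triv) tensor \<Rightarrow> _)"
    unfolding clinear_iff
    by (auto simp: MC_map_def clinear_add[OF clinear_tmap2[OF lin]] clinear_scale[OF clinear_tmap2[OF lin]])
  show "z \<in> tcone i \<Longrightarrow> MC_map (triv_map f) z \<in> tcone i"
    by (auto simp: tcone_def MC_map_def tgr_tspan intro!: tmap2_tspan[OF _ lin] triv_map_max_ideal)
  show "MC_map (triv_map f) (tcone_df z) = tcone_df (MC_map (triv_map f) z)"
    by (simp add: MC_map_def tcone_df_def case_prod_beta clinear_diff[OF clinear_tmap2[OF lin]]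
        tmap2_tdf[OF L.dgla_axioms lin] tmap2_tdf[OF M.dgla_axioms lin] tmap1_tmap2[OF clinear_hom lin])
qed

lemma MC_map_triv_MC:
  assumes "clinear f" "z \<in> MC L M \<chi>"
  shows "MC_map (triv_map f) z \<in> MC L M \<chi>"
  using assms(2) MC_map_triv[OF assms(1)] clinear_0[OF MC_map_triv(1)[OF assms(1)]]
  unfolding MC_triv by (metis (mono_tags, lifting) mem_Collect_eq)

lemma Def_map_triv:
  fixes f :: "'u::cvector \<Rightarrow> 'w::cvector"
  assumes f: "clinear f" and z: "z \<in> tcone 1"
  shows "Def_map L M \<chi> (triv_map f) (def_class L M \<chi> z) = def_class L M \<chi> (MC_map (triv_map f) z)"
proof -
  note F = MC_map_triv[OF f]
  have eq: "def_class L M \<chi> (MC_map (triv_map f) p) = def_class L M \<chi> (MC_map (triv_map f) z)"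
    if p: "p \<in> def_class L M \<chi> z" for p
  proof -
    obtain b where b: "b \<in> tcone 0" "p = z + tcone_df b" using p unfolding def_class_triv[OF z] by blast
    have "tcone_df b \<in> tcone 1" using tcone_df_tcone[OF b(1)] by simp
    then have "p \<in> tcone 1" using b(2) cvec.subspace_add[OF subspace_tcone z] by simp
    moreover have "MC_map (triv_map f) p - MC_map (triv_map f) z = tcone_df (MC_map (triv_map f) b)"
      by (simp add: b(2) clinear_add[OF F(1)] F(3))
    ultimately show ?thesis using F(2) z b(1) def_class_triv_eq_iff by blast
  qed
  have "z = z + tcone_df 0" by (simp add: clinear_0[OF clinear_tcone_df])
  then have "z \<in> def_class L M \<chi> z"
    unfolding def_class_triv[OF z] using cvec.subspace_0[OF subspace_tcone] by blast
  then show ?thesis unfolding Def_map_def using eq by blast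
qed

lemma MC_map_triv_compose:
  fixes f :: "'u::cvector \<Rightarrow> 'w::cvector" and g :: "'w \<Rightarrow> 'x::cvector"
  assumes "clinear f" "clinear g"
  shows "MC_map (triv_map g) (MC_map (triv_map f) z) = MC_map (triv_map (\<lambda>v. g (f v))) z"
  by (simp add: MC_map_def case_prod_beta tmap2_compose clinear_triv_map assms)
    (simp add: triv_map_def[abs_def])

lemma tmap2_triv_linear:
  fixes t :: "('v::cvector, 'u::cvector triv) tensor" and f g :: "'u \<Rightarrow> 'w::cvector"
  assumes t: "t \<in> tgr K i"
  shows "clinear f \<Longrightarrow> clinear g \<Longrightarrow>
      tmap2 (triv_map (\<lambda>v. f v + g v)) t = tmap2 (triv_map f) t + tmap2 (triv_map g) t"
    and "tmap2 (triv_map (\<lambda>v. c *\<^sub>C v)) t = c *\<^sub>C t"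
proof -
  note t = t[unfolded tgr_tspan]
  have 1: "clinear (triv_map (\<lambda>v :: 'u. c *\<^sub>C v))" by (intro clinear_triv_map clinear_scaled clinear_id)
  show "tmap2 (triv_map (\<lambda>v. c *\<^sub>C v)) t = c *\<^sub>C t"
    by (rule tspan_eqI[OF t clinear_tmap2[OF 1] clinear_scaled[OF clinear_id]], unfold tmap2_pure[OF 1])
      (simp add: max_ideal_triv triv_map_def cscale_triv_def flip: ptensor_simps(4))
  assume lin: "clinear f" "clinear g"
  then have 2: "clinear (triv_map (\<lambda>v. f v + g v))" "clinear (triv_map f)" "clinear (triv_map g)"
    by (intro clinear_triv_map clinear_plus lin)+
  show "tmap2 (triv_map (\<lambda>v. f v + g v)) t = tmap2 (triv_map f) t + tmap2 (triv_map g) t"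
    by (rule tspan_eqI[OF t clinear_tmap2[OF 2(1)] clinear_plus[OF clinear_tmap2[OF 2(2)] clinear_tmap2[OF 2(3)]]],
        unfold tmap2_pure[OF 2(1)] tmap2_pure[OF 2(2)] tmap2_pure[OF 2(3)])
      (simp add: max_ideal_triv triv_map_def plus_triv_def flip: ptensor_simps(2))
qed

lemma MC_map_triv_linear:
  fixes z :: "('l, 'u::cvector triv) tensor \<times> ('m, 'u triv) tensor" and f g :: "'u \<Rightarrow> 'w::cvector"
  assumes z: "z \<in> tcone i"
  shows "clinear f \<Longrightarrow> clinear g \<Longrightarrow>
      MC_map (triv_map (\<lambda>v. f v + g v)) z = MC_map (triv_map f) z + MC_map (triv_map g) z"
    and "MC_map (triv_map (\<lambda>v. c *\<^sub>C v)) z = c *\<^sub>C z"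
  using z tmap2_triv_linear[of "fst z" L i] tmap2_triv_linear[of "snd z" M "i - 1"]
  by (auto simp: MC_map_def tcone_def)

lemma clinear_pair_maps:
  "clinear (fst :: complex \<times> complex \<Rightarrow> complex)" "clinear (snd :: complex \<times> complex \<Rightarrow> complex)"
  "clinear (\<lambda>c :: complex. (c, 0 :: complex))" "clinear (\<lambda>c :: complex. (0 :: complex, c))"
  "clinear (\<lambda>v :: complex \<times> complex. fst v + snd v)" "clinear (\<lambda>v :: complex. c * v)"
  by (auto simp: clinear_iff cscale_complex_def algebra_simps)

abbreviation proj1 :: "('l, (complex \<times> complex) triv) tensor \<times> ('m, (complex \<times> complex) triv) tensor \<Rightarrow> _"
  where "proj1 \<equiv> MC_map (triv_map fst)"
abbreviation proj2 :: "('l, (complex \<times> complex) triv) tensor \<times> ('m, (complex \<times> complex) triv) tensor \<Rightarrow> _"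
  where "proj2 \<equiv> MC_map (triv_map snd)"
abbreviation emb1 :: "('l, dual) tensor \<times> ('m, dual) tensor \<Rightarrow> _"
  where "emb1 \<equiv> MC_map (triv_map (\<lambda>c. (c, 0 :: complex)))"
abbreviation emb2 :: "('l, dual) tensor \<times> ('m, dual) tensor \<Rightarrow> _"
  where "emb2 \<equiv> MC_map (triv_map (\<lambda>c. (0 :: complex, c)))"
abbreviation addmap :: "('l, (complex \<times> complex) triv) tensor \<times> ('m, (complex \<times> complex) triv) tensor \<Rightarrow> _"
  where "addmap \<equiv> MC_map (triv_map (\<lambda>v. fst v + snd v))"

lemma scale_triv:
  fixes z :: "('l, dual) tensor \<times> ('m, dual) tensor"
  shows "z \<in> tcone i \<Longrightarrow> MC_map (triv_map (\<lambda>v. c * v)) z = c *\<^sub>C z"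
  using MC_map_triv_linear(2)[of z i c] by (simp add: cscale_complex_def)

lemma proj_emb:
  assumes "z \<in> tcone i"
  shows "proj1 (emb1 z) = z" "proj2 (emb1 z) = 0" "proj1 (emb2 z) = 0" "proj2 (emb2 z) = z"
    "addmap (emb1 z) = z" "addmap (emb2 z) = z"
  using scale_triv[OF assms, of 1] scale_triv[OF assms, of 0]
  by (simp_all add: MC_map_triv_compose clinear_pair_maps cscale_one)

lemma emb_proj:
  assumes "z \<in> tcone i"
  shows "z = emb1 (proj1 z) + emb2 (proj2 z)"
proof -
  have lin: "clinear (\<lambda>v :: complex \<times> complex. (fst v, 0 :: complex))"
    "clinear (\<lambda>v :: complex \<times> complex. (0 :: complex, snd v))"
    by (auto simp: clinear_iff)
  have "emb1 (proj1 z) + emb2 (proj2 z) = MC_map (triv_map (\<lambda>v. (fst v, 0) + (0, snd v))) z"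
    by (simp only: MC_map_triv_compose clinear_pair_maps MC_map_triv_linear(1)[OF assms lin])
  also have "\<dots> = z" using MC_map_triv_linear(2)[OF assms, of 1] by (simp add: cscale_one)
  finally show ?thesis ..
qed

lemma MC_tcone:
  fixes z :: "('l, 'u::cvector triv) tensor \<times> ('m, 'u triv) tensor"
  shows "z \<in> MC L M \<chi> \<Longrightarrow> z \<in> tcone 1"
  unfolding MC_triv by blast

lemma join_MC:
  assumes "z \<in> MC L M \<chi>" "z' \<in> MC L M \<chi>"
  shows "emb1 z + emb2 z' \<in> MC L M \<chi>" "proj1 (emb1 z + emb2 z') = z" "proj2 (emb1 z + emb2 z') = z'"
    "addmap (emb1 z + emb2 z') = z + z'"
proof -
  note lin = MC_map_triv(1)[OF clinear_pair_maps(1)] MC_map_triv(1)[OF clinear_pair_maps(2)]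
    MC_map_triv(1)[OF clinear_pair_maps(5)]
  show "proj1 (emb1 z + emb2 z') = z" "proj2 (emb1 z + emb2 z') = z'" "addmap (emb1 z + emb2 z') = z + z'"
    using proj_emb[OF MC_tcone[OF assms(1)]] proj_emb[OF MC_tcone[OF assms(2)]]
    by (simp_all add: clinear_add[OF lin(1)] clinear_add[OF lin(2)] clinear_add[OF lin(3)])
  have "emb1 z \<in> MC L M \<chi>" "emb2 z' \<in> MC L M \<chi>"
    by (rule MC_map_triv_MC[OF clinear_pair_maps(3) assms(1)] MC_map_triv_MC[OF clinear_pair_maps(4) assms(2)])+
  then show "emb1 z + emb2 z' \<in> MC L M \<chi>"
    unfolding MC_triv by (auto simp: clinear_add[OF clinear_tcone_df] cvec.subspace_add[OF subspace_tcone])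
qed

lemma join_unique:
  assumes z: "z \<in> tcone 1" and z': "z' \<in> tcone 1"
    and "def_class L M \<chi> (proj1 z) = def_class L M \<chi> (proj1 z')"
    and "def_class L M \<chi> (proj2 z) = def_class L M \<chi> (proj2 z')"
  shows "def_class L M \<chi> z = def_class L M \<chi> z'"
proof -
  note P1 = MC_map_triv[OF clinear_pair_maps(1)] and P2 = MC_map_triv[OF clinear_pair_maps(2)]
    and I1 = MC_map_triv[OF clinear_pair_maps(3)] and I2 = MC_map_triv[OF clinear_pair_maps(4)]
  obtain b where b: "b \<in> tcone 0" "proj1 z - proj1 z' = tcone_df b"
    using assms(3) unfolding def_class_triv_eq_iff[OF P1(2)[OF z] P1(2)[OF z']] by blast
  obtain c where c: "c \<in> tcone 0" "proj2 z - proj2 z' = tcone_df c"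
    using assms(4) unfolding def_class_triv_eq_iff[OF P2(2)[OF z] P2(2)[OF z']] by blast
  have "z - z' = emb1 (proj1 (z - z')) + emb2 (proj2 (z - z'))"
    by (rule emb_proj[OF cvec.subspace_diff[OF subspace_tcone z z']])
  also have "\<dots> = emb1 (tcone_df b) + emb2 (tcone_df c)"
    by (simp only: clinear_diff[OF P1(1)] clinear_diff[OF P2(1)] b(2) c(2))
  also have "\<dots> = tcone_df (emb1 b + emb2 c)"
    by (simp only: I1(3) I2(3) clinear_add[OF clinear_tcone_df])
  finally show ?thesis
    unfolding def_class_triv_eq_iff[OF z z']
    using cvec.subspace_add[OF subspace_tcone I1(2)[OF b(1)] I2(2)[OF c(1)]] by blast
qed

text \<open>Both inclusions of \<open>\<complex>\<close> in \<open>\<complex>\<^sup>2\<close> act on cocycles and on coboundaries, so a class over \<open>\<complex> \<oplus> \<complex>\<^sup>2\<close> is a pair of classes.\<close>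

lemma Def_triv_fibre_product:
  "bij_betw
     (\<lambda>\<zeta>. (Def_map L M \<chi> (triv_map fst) \<zeta>, Def_map L M \<chi> (triv_map snd) \<zeta>))
     (Def L M \<chi> :: (('l, (complex \<times> complex) triv) tensor \<times>
        ('m, (complex \<times> complex) triv) tensor) set set)
     (tangent_space L M \<chi> \<times> tangent_space L M \<chi>)"
proof -
  note D1 = Def_map_triv[OF clinear_pair_maps(1) MC_tcone] and D2 = Def_map_triv[OF clinear_pair_maps(2) MC_tcone]
  let ?F = "\<lambda>\<zeta>. (Def_map L M \<chi> (triv_map (fst :: complex \<times> complex \<Rightarrow> complex)) \<zeta>,
    Def_map L M \<chi> (triv_map (snd :: complex \<times> complex \<Rightarrow> complex)) \<zeta>)"
  show ?thesis
    unfolding bij_betw_def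
  proof (rule conjI[OF inj_onI equalityI[OF subsetI subsetI]])
    fix \<zeta> \<zeta>' :: "(('l, (complex \<times> complex) triv) tensor \<times> ('m, (complex \<times> complex) triv) tensor) set"
    assume "\<zeta> \<in> Def L M \<chi>" "\<zeta>' \<in> Def L M \<chi>" and
      eq: "?F \<zeta> = ?F \<zeta>'"
    then obtain z z' where z: "z \<in> MC L M \<chi>" "\<zeta> = def_class L M \<chi> z" and z': "z' \<in> MC L M \<chi>" "\<zeta>' = def_class L M \<chi> z'"
      by (auto simp: Def_def)
    show "\<zeta> = \<zeta>'"
      unfolding z(2) z'(2)
      by (rule join_unique[OF MC_tcone[OF z(1)] MC_tcone[OF z'(1)]])
        (use eq D1[OF z(1)] D1[OF z'(1)] D2[OF z(1)] D2[OF z'(1)] z(2) z'(2) in auto)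
  next
    fix p assume "p \<in> ?F ` Def L M \<chi>"
    then obtain z where z: "z \<in> MC L M \<chi>" "p = (def_class L M \<chi> (proj1 z), def_class L M \<chi> (proj2 z))"
      using D1 D2 by (auto simp: Def_def)
    then show "p \<in> tangent_space L M \<chi> \<times> tangent_space L M \<chi>"
      using MC_map_triv_MC[OF clinear_pair_maps(1)] MC_map_triv_MC[OF clinear_pair_maps(2)]
      by (auto simp: tangent_space_def Def_def)
  next
    fix p :: "(('l, dual) tensor \<times> ('m, dual) tensor) set \<times> (('l, dual) tensor \<times> ('m, dual) tensor) set"
    assume "p \<in> tangent_space L M \<chi> \<times> tangent_space L M \<chi>"
    then obtain z z' where z: "z \<in> MC L M \<chi>" "z' \<in> MC L M \<chi>" "p = (def_class L M \<chi> z, def_class L M \<chi> z')"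
      by (auto simp: tangent_space_def Def_def)
    let ?z = "emb1 z + emb2 z'"
    have "p = (Def_map L M \<chi> (triv_map fst) (def_class L M \<chi> ?z), Def_map L M \<chi> (triv_map snd) (def_class L M \<chi> ?z))"
      using join_MC[OF z(1,2)] by (simp add: z(3) D1 D2)
    moreover have "def_class L M \<chi> ?z \<in> Def L M \<chi>" using join_MC(1)[OF z(1,2)] by (simp add: Def_def)
    ultimately show "p \<in> ?F ` Def L M \<chi>"
      by blast
  qed
qed

lemma tangent_add_class:
  assumes z: "z \<in> MC L M \<chi>" and z': "z' \<in> MC L M \<chi>"
  shows "tangent_add L M \<chi> (def_class L M \<chi> z) (def_class L M \<chi> z') = def_class L M \<chi> (z + z')"
proof -
  note D1 = Def_map_triv[OF clinear_pair_maps(1) MC_tcone] and D2 = Def_map_triv[OF clinear_pair_maps(2) MC_tcone]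
  let ?z = "emb1 z + emb2 z'"
  have mem: "def_class L M \<chi> ?z \<in> Def L M \<chi>" using join_MC(1)[OF z z'] by (simp add: Def_def)
  have val: "Def_map L M \<chi> (triv_map fst) (def_class L M \<chi> ?z) = def_class L M \<chi> z"
    "Def_map L M \<chi> (triv_map snd) (def_class L M \<chi> ?z) = def_class L M \<chi> z'"
    using join_MC[OF z z'] by (simp_all add: D1 D2)
  have "(THE \<zeta>. \<zeta> \<in> Def L M \<chi> \<and> Def_map L M \<chi> (triv_map fst) \<zeta> = def_class L M \<chi> z \<and>
      Def_map L M \<chi> (triv_map snd) \<zeta> = def_class L M \<chi> z') = def_class L M \<chi> ?z"
  proof (rule the_equality)
    fix \<zeta> assume \<zeta>: "\<zeta> \<in> Def L M \<chi> \<and> Def_map L M \<chi> (triv_map fst) \<zeta> = def_class L M \<chi> z \<and>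
      Def_map L M \<chi> (triv_map snd) \<zeta> = def_class L M \<chi> z'"
    show "\<zeta> = def_class L M \<chi> ?z"
      by (rule inj_onD[OF bij_betw_imp_inj_on[OF Def_triv_fibre_product]]) (use \<zeta> mem val in simp_all)
  qed (use mem val in blast)
  then show ?thesis
    unfolding tangent_add_def
    by (simp only: Def_map_triv[OF clinear_pair_maps(5) MC_tcone[OF join_MC(1)[OF z z']]] join_MC(4)[OF z z'])
qed

lemma tangent_scale_class:
  assumes z: "z \<in> MC L M \<chi>"
  shows "tangent_scale L M \<chi> c (def_class L M \<chi> z) = def_class L M \<chi> (c *\<^sub>C z)"
  unfolding tangent_scale_def Def_map_triv[OF clinear_pair_maps(6) MC_tcone[OF z]]
    scale_triv[OF MC_tcone[OF z]] ..

text \<open>The inverse maps \<open>(h \<otimes> \<epsilon>, r \<otimes> \<epsilon>) \<mapsto> (h, r)\<close> and \<open>eps\<close> identify the cone over \<open>\<complex>[\<epsilon>]\<close> with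
  \<open>C\<^sub>\<chi>\<close>.\<close>

definition coeff :: "('l, dual) tensor \<times> ('m, dual) tensor \<Rightarrow> 'l \<times> 'm"
  where "coeff z = (contract inf (fst z), contract inf (snd z))"

definition eps :: "'l \<times> 'm \<Rightarrow> ('l, dual) tensor \<times> ('m, dual) tensor"
  where "eps z = (fst z \<otimes> Triv 0 1, snd z \<otimes> Triv 0 1)"

lemma clinear_coeff: "clinear coeff"
  unfolding clinear_iff coeff_def
  by (simp add: clinear_add[OF clinear_contract[OF clinear_inf]] clinear_scale[OF clinear_contract[OF clinear_inf]])

lemma clinear_eps: "clinear eps"
  unfolding clinear_iff eps_def by (simp add: ptensor_simps)

lemma coeff_eps: "coeff (eps z) = z"
  by (simp add: coeff_def eps_def contract_pure[OF clinear_inf] cscale_one)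

lemma eps_coeff:
  assumes "z \<in> tcone i"
  shows "eps (coeff z) = z"
proof -
  have "x \<in> tgr L i" "a \<in> tgr M (i - 1)" if "z = (x, a)" for x a
    using assms by (simp_all add: tcone_def that)
  then show ?thesis by (cases z) (simp add: eps_def coeff_def tgr_dual)
qed

lemma eps_tcone: "z \<in> cone L M i \<Longrightarrow> eps z \<in> tcone i"
  by (auto simp: cone_def tcone_def eps_def tgr_tspan max_ideal_triv intro!: tspan_pure)

lemma coeff_cone: "z \<in> tcone i \<Longrightarrow> coeff z \<in> cone L M i"
  by (auto simp: cone_def tcone_def coeff_def tgr_tspan
      intro: contract_in[OF clinear_inf L.subspace_gr] contract_in[OF clinear_inf M.subspace_gr])

lemma tcone_df_eps: "tcone_df (eps z) = eps (cone_df L M \<chi> z)"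
  by (simp add: tcone_df_def eps_def cone_df_def case_prod_beta L.tdf_pure M.tdf_pure
      tmap1_pure[OF clinear_hom] ptensor_diff)

lemma coeff_tcone_df:
  assumes "z \<in> tcone i"
  shows "coeff (tcone_df z) = cone_df L M \<chi> (coeff z)"
  using tcone_df_eps[of "coeff z"] by (simp add: eps_coeff[OF assms] coeff_eps)

lemma coeff_def_class:
  assumes z: "z \<in> tcone 1"
  shows "coeff ` def_class L M \<chi> z = cone_class L M \<chi> 1 (coeff z)"
proof (intro equalityI subsetI)
  fix p assume "p \<in> coeff ` def_class L M \<chi> z"
  then obtain b where "b \<in> tcone 0" "p = coeff (z + tcone_df b)" unfolding def_class_triv[OF z] by blast
  then have "coeff b \<in> cone L M (1 - 1)" "p = coeff z + cone_df L M \<chi> (coeff b)"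
    using coeff_cone[of b 0] by (simp_all add: clinear_add[OF clinear_coeff] coeff_tcone_df[of b 0])
  then show "p \<in> cone_class L M \<chi> 1 (coeff z)" unfolding cone_class_def by blast
next
  fix p assume "p \<in> cone_class L M \<chi> 1 (coeff z)"
  then obtain b where b: "b \<in> cone L M 0" "p = coeff z + cone_df L M \<chi> b" by (auto simp: cone_class_def)
  then have "p = coeff (z + tcone_df (eps b))"
    by (simp add: clinear_add[OF clinear_coeff] tcone_df_eps coeff_eps)
  then show "p \<in> coeff ` def_class L M \<chi> z"
    unfolding def_class_triv[OF z] using eps_tcone[OF b(1)] by blast
qed

lemma tangent_space_iso:
  "bij_betw ((`) coeff) (tangent_space L M \<chi>) (cone_coh L M \<chi> 1)"
  unfolding bij_betw_def
proof (rule conjI[OF inj_onI equalityI[OF subsetI subsetI]])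
  fix \<xi> \<eta> assume "\<xi> \<in> tangent_space L M \<chi>" "\<eta> \<in> tangent_space L M \<chi>" and eq: "coeff ` \<xi> = coeff ` \<eta>"
  then obtain z z' where z: "z \<in> MC L M \<chi>" "\<xi> = def_class L M \<chi> z" and z': "z' \<in> MC L M \<chi>" "\<eta> = def_class L M \<chi> z'"
    by (auto simp: tangent_space_def Def_def)
  have "cone_class L M \<chi> 1 (coeff z) = cone_class L M \<chi> 1 (coeff z')"
    using eq by (simp add: z(2) z'(2) coeff_def_class MC_tcone z(1) z'(1))
  then obtain b where b: "b \<in> cone L M 0" "coeff (z - z') = cone_df L M \<chi> b"
    unfolding cone_class_eq_iff by (auto simp: clinear_diff[OF clinear_coeff])
  have "z - z' = eps (coeff (z - z'))"
    by (rule eps_coeff[OF cvec.subspace_diff[OF subspace_tcone MC_tcone[OF z(1)] MC_tcone[OF z'(1)]], symmetric])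
  then have "z - z' = tcone_df (eps b)" by (simp add: b(2) tcone_df_eps)
  then show "\<xi> = \<eta>"
    unfolding z(2) z'(2) def_class_triv_eq_iff[OF MC_tcone[OF z(1)] MC_tcone[OF z'(1)]]
    using eps_tcone[OF b(1)] by blast
next
  fix p assume "p \<in> (`) coeff ` tangent_space L M \<chi>"
  then obtain z where z: "z \<in> MC L M \<chi>" "p = cone_class L M \<chi> 1 (coeff z)"
    using coeff_def_class[OF MC_tcone] by (auto simp: tangent_space_def Def_def)
  have "cone_df L M \<chi> (coeff z) = 0"
    using z(1) coeff_tcone_df[OF MC_tcone[OF z(1)]] clinear_0[OF clinear_coeff] unfolding MC_triv by simp
  then show "p \<in> cone_coh L M \<chi> 1"
    using coeff_cone[OF MC_tcone[OF z(1)]] z(2) by (auto simp: cone_coh_def)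
next
  fix p assume "p \<in> cone_coh L M \<chi> 1"
  then obtain z where z: "z \<in> cone L M 1" "cone_df L M \<chi> z = 0" "p = cone_class L M \<chi> 1 z"
    by (auto simp: cone_coh_def)
  have "eps z \<in> MC L M \<chi>"
    unfolding MC_triv using eps_tcone[OF z(1)] by (simp add: tcone_df_eps z(2) clinear_0[OF clinear_eps])
  then have "def_class L M \<chi> (eps z) \<in> tangent_space L M \<chi>" "p = coeff ` def_class L M \<chi> (eps z)"
    by (simp_all add: tangent_space_def Def_def coeff_def_class MC_tcone coeff_eps z(3))
  then show "p \<in> (`) coeff ` tangent_space L M \<chi>" by blast
qed

lemma tangent_space_iso_add:
  assumes "\<xi> \<in> tangent_space L M \<chi>" "\<eta> \<in> tangent_space L M \<chi>"
  shows "coeff ` tangent_add L M \<chi> \<xi> \<eta> = coh_add (coeff ` \<xi>) (coeff ` \<eta>)"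
proof -
  obtain z z' where z: "z \<in> MC L M \<chi>" "\<xi> = def_class L M \<chi> z" and z': "z' \<in> MC L M \<chi>" "\<eta> = def_class L M \<chi> z'"
    using assms by (auto simp: tangent_space_def Def_def)
  have "z + z' \<in> tcone 1" by (rule cvec.subspace_add[OF subspace_tcone MC_tcone[OF z(1)] MC_tcone[OF z'(1)]])
  then show ?thesis
    by (simp add: z z' tangent_add_class coeff_def_class MC_tcone coh_add_class clinear_add[OF clinear_coeff])
qed

lemma tangent_space_iso_scale:
  assumes "\<xi> \<in> tangent_space L M \<chi>"
  shows "coeff ` tangent_scale L M \<chi> c \<xi> = coh_scale L M \<chi> 1 c (coeff ` \<xi>)"
proof -
  obtain z where z: "z \<in> MC L M \<chi>" "\<xi> = def_class L M \<chi> z"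
    using assms by (auto simp: tangent_space_def Def_def)
  have "c *\<^sub>C z \<in> tcone 1" by (rule cvec.subspace_scale[OF subspace_tcone MC_tcone[OF z(1)]])
  then show ?thesis
    by (simp add: z tangent_scale_class coeff_def_class MC_tcone coh_scale_class clinear_scale[OF clinear_coeff])
qed

end

theorem mainTheorem2:
  fixes L :: "'l::cvector dgl" and M :: "'m::cvector dgl" and \<chi> :: "'l \<Rightarrow> 'm"
  assumes "dgla L" and "dgla M" and "dgla_hom L M \<chi>"
  shows
    \<comment> \<open>The tangent space: the first conjunct is what makes \<open>tangent_add\<close> well defined.\<close>
    "bij_betw
       (\<lambda>\<zeta>. (Def_map L M \<chi> (triv_map fst) \<zeta>, Def_map L M \<chi> (triv_map snd) \<zeta>))
       (Def L M \<chi> :: (('l, (complex \<times> complex) triv) tensor \<times>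
          ('m, (complex \<times> complex) triv) tensor) set set)
       (tangent_space L M \<chi> \<times> tangent_space L M \<chi>) \<and>
     (\<exists>\<Phi>. bij_betw \<Phi> (tangent_space L M \<chi>) (cone_coh L M \<chi> 1) \<and>
        (\<forall>\<xi>\<in>tangent_space L M \<chi>. \<forall>\<eta>\<in>tangent_space L M \<chi>.
           \<Phi> (tangent_add L M \<chi> \<xi> \<eta>) = coh_add (\<Phi> \<xi>) (\<Phi> \<eta>)) \<and>
        (\<forall>c. \<forall>\<xi>\<in>tangent_space L M \<chi>.
           \<Phi> (tangent_scale L M \<chi> c \<xi>) = coh_scale L M \<chi> 1 c (\<Phi> \<xi>))) \<and>
     \<comment> \<open>The obstruction class of a point of \<open>MC\<^sub>\<chi>(B)\<close> for a small extension \<open>A \<rightarrow> B\<close>.\<close>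
     (art TYPE('a::calgebra) \<and> art TYPE('b::calgebra) \<longrightarrow>
       (\<forall>(\<iota> :: complex \<Rightarrow> 'a) (\<alpha> :: 'a \<Rightarrow> 'b). small_extension \<iota> \<alpha> \<longrightarrow>
         (\<forall>xq\<in>MC L M \<chi>.
           (\<exists>yp. is_lift L M \<alpha> xq yp) \<and>
           (\<forall>yp. is_lift L M \<alpha> xq yp \<longrightarrow> (\<exists>!hr. obstruction_pair L M \<chi> \<iota> yp hr)) \<and>
           (\<forall>yp hr. is_lift L M \<alpha> xq yp \<and> obstruction_pair L M \<chi> \<iota> yp hr \<longrightarrow>
             cone_df L M \<chi> hr = 0) \<and>
           (\<forall>yp hr yp' hr'. is_lift L M \<alpha> xq yp \<and> obstruction_pair L M \<chi> \<iota> yp hr \<and>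
               is_lift L M \<alpha> xq yp' \<and> obstruction_pair L M \<chi> \<iota> yp' hr' \<longrightarrow>
             cone_class L M \<chi> 2 hr = cone_class L M \<chi> 2 hr') \<and>
           (\<forall>yp hr. is_lift L M \<alpha> xq yp \<and> obstruction_pair L M \<chi> \<iota> yp hr \<longrightarrow>
             (cone_class L M \<chi> 2 hr = cone_class L M \<chi> 2 0 \<longleftrightarrow>
               (\<exists>z\<in>MC L M \<chi>. MC_map \<alpha> z = xq)))))) \<and>
     \<comment> \<open>It depends only on the induced element of \<open>Def\<^sub>\<chi>(B)\<close>, and vanishes iff that element
         lifts to \<open>Def\<^sub>\<chi>(A)\<close>.\<close>
     (art TYPE('a) \<and> art TYPE('b) \<longrightarrow>
       (\<forall>(\<iota> :: complex \<Rightarrow> 'a) (\<alpha> :: 'a \<Rightarrow> 'b). small_extension \<iota> \<alpha> \<longrightarrow>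
         (\<forall>xq\<in>MC L M \<chi>. \<forall>yp hr.
            is_lift L M \<alpha> xq yp \<and> obstruction_pair L M \<chi> \<iota> yp hr \<longrightarrow>
            obstruction L M \<chi> \<iota> \<alpha> (def_class L M \<chi> xq) = cone_class L M \<chi> 2 hr) \<and>
         (\<forall>\<xi>\<in>Def L M \<chi>.
            obstruction L M \<chi> \<iota> \<alpha> \<xi> \<in> cone_coh L M \<chi> 2 \<and>
            (obstruction L M \<chi> \<iota> \<alpha> \<xi> = cone_class L M \<chi> 2 0 \<longleftrightarrow>
               (\<exists>z\<in>MC L M \<chi>. def_class L M \<chi> (MC_map \<alpha> z) = \<xi>))))) \<and>
     \<comment> \<open>It is natural in the small extension.\<close>
     (art TYPE('a) \<and> art TYPE('b) \<and> art TYPE('c::calgebra) \<and> art TYPE('d::calgebra) \<longrightarrow>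
       (\<forall>(\<iota> :: complex \<Rightarrow> 'a) (\<alpha> :: 'a \<Rightarrow> 'b) (\<iota>' :: complex \<Rightarrow> 'c) (\<alpha>' :: 'c \<Rightarrow> 'd) c \<phi> \<psi>.
         small_extension \<iota> \<alpha> \<and> small_extension \<iota>' \<alpha>' \<and>
         small_extension_hom c \<phi> \<psi> \<iota> \<alpha> \<iota>' \<alpha>' \<longrightarrow>
         (\<forall>xq\<in>MC L M \<chi>.
            obstruction L M \<chi> \<iota>' \<alpha>' (def_class L M \<chi> (MC_map \<psi> xq)) =
              coh_scale L M \<chi> 2 c (obstruction L M \<chi> \<iota> \<alpha> (def_class L M \<chi> xq)))))"
proof -
  interpret dgla_morphism L M \<chi>
    by (intro dgla_morphism.intro dgla_morphism_axioms.intro assms)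
  show ?thesis
    by (intro conjI impI allI ballI Def_triv_fibre_product exI[of _ "(`) coeff"]
        tangent_space_iso tangent_space_iso_add tangent_space_iso_scale; (elim conjE)?)
      ((assumption | rule lift_exists obstruction_pair_ex1 obstruction_pair_closed
        obstruction_independent obstruction_vanishes_iff obstruction_eq obstruction_in_cohomology
        obstruction_zero_iff obstruction_natural)+)
qed

end
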